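(* Let $m\ge 1$, $n\ge 0$, $k>1$ be integers, $\omega,q\in\mathbb C$, and write $\partial_i=\partial/\partial y_i$, $\Delta=\sum_{i=1}^{m+n}\partial_i^2$. The operator $$H-\omega^2\sum_{i=1}^{m+n}y_i^2$$ is quantum integrable if $H$ is given either by $$H=\Delta-2k\sum_{1\le i<j\le m}\frac{\partial_i-\partial_j}{y_i-y_j}-\frac2k\sum_{m+1\le i<j\le m+n}\frac{\partial_i-\partial_j}{y_i-y_j}-2\sum_{i=1}^m\sum_{j=m+1}^{m+n}\frac{\partial_i-\sqrt k\,\partial_j}{y_i-\sqrt k\,y_j},$$ or by $$H=\Delta-\sum_{1\le i<j\le m}\Big(\frac{2k(\partial_i-\partial_j)}{y_i-y_j}+\frac{2k(\partial_i+\partial_j)}{y_i+y_j}\Big)-\sum_{i=1}^m\sum_{j=m+1}^{m+n}\Big(\frac{2(\partial_i-\sqrt k\,\partial_j)}{y_i-\sqrt k\,y_j}+\frac{2(\partial_i+\sqrt k\,\partial_j)}{y_i+\sqrt k\,y_j}\Big)$$ $$\qquad-\sum_{m+1\le i<j\le m+n}\Big(\frac{2k^{-1}(\partial_i-\partial_j)}{y_i-y_j}+\frac{2k^{-1}(\partial_i+\partial_j)}{y_i+y_j}\Big)-\sum_{i=1}^m\frac{(kq+k-1)\partial_i}{y_i}-\sum_{i=m+1}^{m+n}\frac{q\,\partial_i}{y_i}.$$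
   Context: A differential operator $L$ acting in $M$-dimensional space is called quantum integrable if there exist $M$ pairwise commuting differential operators $L_1=L,L_2,\dots,L_M$ which are algebraically independent. (Here $M=m+n$.) *)

theory Defs
  imports Complex_Main "HOL-Library.Poly_Mapping" "HOL-Computational_Algebra.Fraction_Field"
begin

text \<open>
  Everything takes place over the field of rational functions in countably many variables
  \<open>y\<^sub>1, y\<^sub>2, \<dots>\<close> with complex coefficients. Operators in dimension \<open>M\<close> act on the
  subfield of rational functions in \<open>y\<^sub>1, \<dots>, y\<^sub>M\<close>; this allows the dimension to be a natural
  number. A monomial is its exponent function, so a polynomial is a finitely supported function
  from exponent functions to coefficients.
\<close>

type_synonym mono = "nat \<Rightarrow>\<^sub>0 nat"
type_synonym mpol = "mono \<Rightarrow>\<^sub>0 complex"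
type_synonym ratfun = "mpol fract"

definition indets :: "mpol \<Rightarrow> nat set" where
  "indets p = (\<Union>\<alpha>\<in>Poly_Mapping.keys p. Poly_Mapping.keys \<alpha>)"

definition ratfuns :: "nat \<Rightarrow> ratfun set" where
  "ratfuns M = {Fract p q | p q. q \<noteq> 0 \<and> indets p \<subseteq> {1..M} \<and> indets q \<subseteq> {1..M}}"

definition Y :: "nat \<Rightarrow> ratfun" where
  "Y i = Fract (Poly_Mapping.single (Poly_Mapping.single i 1) 1) 1"

definition Cst :: "complex \<Rightarrow> ratfun" where
  "Cst c = Fract (Poly_Mapping.single 0 c) 1"


subsection \<open>Partial derivatives\<close>

definition mderiv :: "nat \<Rightarrow> mpol \<Rightarrow> mpol" where
  "mderiv i p = (\<Sum>\<alpha>\<in>Poly_Mapping.keys p.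
     Poly_Mapping.single (\<alpha> - Poly_Mapping.single i 1)
       (of_nat (Poly_Mapping.lookup \<alpha> i) * Poly_Mapping.lookup p \<alpha>))"

lemma mderiv_superset:
  assumes "finite A" "Poly_Mapping.keys p \<subseteq> A"
  shows "mderiv i p = (\<Sum>\<alpha>\<in>A. Poly_Mapping.single (\<alpha> - Poly_Mapping.single i 1)
           (of_nat (Poly_Mapping.lookup \<alpha> i) * Poly_Mapping.lookup p \<alpha>))"
  unfolding mderiv_def using assms
  by (intro sum.mono_neutral_left) (auto simp: in_keys_iff)

lemma mderiv_0 [simp]: "mderiv i 0 = 0"
  by (simp add: mderiv_def)

lemma mderiv_add: "mderiv i (p + q) = mderiv i p + mderiv i q"
proof -
  let ?A = "Poly_Mapping.keys p \<union> Poly_Mapping.keys q"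
  have A: "finite ?A" "Poly_Mapping.keys p \<subseteq> ?A" "Poly_Mapping.keys q \<subseteq> ?A"
    "Poly_Mapping.keys (p + q) \<subseteq> ?A"
    using Poly_Mapping.keys_add[of p q] by auto
  show ?thesis
    unfolding mderiv_superset[OF A(1,2)] mderiv_superset[OF A(1,3)] mderiv_superset[OF A(1,4)]
    by (simp add: lookup_add algebra_simps single_add sum.distrib)
qed

lemma mderiv_sum: "mderiv i (\<Sum>x\<in>A. f x) = (\<Sum>x\<in>A. mderiv i (f x))"
  by (induction A rule: infinite_finite_induct) (simp_all add: mderiv_add)

lemma mderiv_single:
  "mderiv i (Poly_Mapping.single \<alpha> c) =
     Poly_Mapping.single (\<alpha> - Poly_Mapping.single i 1) (of_nat (Poly_Mapping.lookup \<alpha> i) * c)"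
  by (subst mderiv_superset[of "{\<alpha>}"]) auto

lemma mpol_sum_singles:
  "p = (\<Sum>\<alpha>\<in>Poly_Mapping.keys p. Poly_Mapping.single \<alpha> (Poly_Mapping.lookup p \<alpha>))"
proof (rule poly_mapping_eqI)
  fix k
  show "Poly_Mapping.lookup p k = Poly_Mapping.lookup
     (\<Sum>\<alpha>\<in>Poly_Mapping.keys p. Poly_Mapping.single \<alpha> (Poly_Mapping.lookup p \<alpha>)) k"
    by (simp add: lookup_sum lookup_single when_def in_keys_iff)
qed

lemma mderiv_mult_single:
  fixes \<alpha> \<beta> :: mono and a b :: complex
  defines "s \<equiv> Poly_Mapping.single \<alpha> a" and "t \<equiv> Poly_Mapping.single \<beta> b"
  shows "mderiv i (s * t) = mderiv i s * t + s * mderiv i t"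
proof -
  let ?e = "Poly_Mapping.single i (1::nat)"
  have 1: "\<alpha> - ?e + \<beta> = \<alpha> + \<beta> - ?e" if "Poly_Mapping.lookup \<alpha> i \<noteq> 0"
    using that by (intro poly_mapping_eqI) (auto simp: lookup_add lookup_minus lookup_single when_def)
  have 2: "\<alpha> + (\<beta> - ?e) = \<alpha> + \<beta> - ?e" if "Poly_Mapping.lookup \<beta> i \<noteq> 0"
    using that by (intro poly_mapping_eqI) (auto simp: lookup_add lookup_minus lookup_single when_def)
  show ?thesis
    unfolding s_def t_def using 1 2
    by (cases "Poly_Mapping.lookup \<alpha> i = 0"; cases "Poly_Mapping.lookup \<beta> i = 0")
       (simp_all add: mult_single mderiv_single lookup_add algebra_simps flip: single_add)
qed

lemma mderiv_mult: "mderiv i (p * q) = mderiv i p * q + p * mderiv i q"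
proof -
  have "mderiv i (sum f A * sum g B) = mderiv i (sum f A) * sum g B + sum f A * mderiv i (sum g B)"
    if "\<And>x y. mderiv i (f x * g y) = mderiv i (f x) * g y + f x * mderiv i (g y)"
    for f g :: "mono \<Rightarrow> mpol" and A B
    by (simp add: mderiv_sum sum_product that sum.distrib)
  from this[of "\<lambda>\<alpha>. Poly_Mapping.single \<alpha> (Poly_Mapping.lookup p \<alpha>)"
      "\<lambda>\<alpha>. Poly_Mapping.single \<alpha> (Poly_Mapping.lookup q \<alpha>)",
      OF mderiv_mult_single, of "Poly_Mapping.keys p" "Poly_Mapping.keys q"]
  show ?thesis unfolding mpol_sum_singles[symmetric] .
qed

lift_definition partial :: "nat \<Rightarrow> ratfun \<Rightarrow> ratfun"
  is "\<lambda>i x. (mderiv i (fst x) * snd x - fst x * mderiv i (snd x), snd x * snd x)"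
proof (clarsimp)
  fix i and p q r s :: mpol
  assume nz: "q \<noteq> 0" "s \<noteq> 0" and eq: "p * s = r * q"
  have "mderiv i p * s + p * mderiv i s = mderiv i r * q + r * mderiv i q"
    using arg_cong[OF eq, of "mderiv i"] by (simp add: mderiv_mult)
  then have D: "mderiv i p * s = mderiv i r * q + r * mderiv i q - p * mderiv i s"
    by (simp add: algebra_simps)
  have "(mderiv i p * q - p * mderiv i q) * (s * s)
      = (mderiv i p * s) * (q * s) - (p * s) * (mderiv i q * s)"
    by (simp add: algebra_simps)
  also have "\<dots> = (mderiv i r * q + r * mderiv i q - p * mderiv i s) * (q * s)
      - (r * q) * (mderiv i q * s)"
    by (simp only: D eq)
  also have "\<dots> = mderiv i r * s * (q * q) - (p * s) * (q * mderiv i s)"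
    by (simp add: algebra_simps)
  also have "\<dots> = mderiv i r * s * (q * q) - (r * q) * (q * mderiv i s)"
    by (simp only: eq)
  also have "\<dots> = (mderiv i r * s - r * mderiv i s) * (q * q)"
    by (simp add: algebra_simps)
  finally show "(mderiv i p * q - p * mderiv i q) * (s * s) =
    (mderiv i r * s - r * mderiv i s) * (q * q)" .
qed

lemma partial_Fract:
  "q \<noteq> 0 \<Longrightarrow> partial i (Fract p q) = Fract (mderiv i p * q - p * mderiv i q) (q * q)"
  by (simp add: Fract_def partial.abs_eq)

lemma mderiv_1 [simp]: "mderiv i 1 = 0"
  using mderiv_single[of i 0 1] by simp

lemma partial_Cst: "partial i (Cst c) = 0"
  by (simp add: Cst_def partial_Fract mderiv_single Zero_fract_def)

lemma partial_Y: "partial i (Y j) = (if i = j then 1 else 0)"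
  by (simp add: Y_def partial_Fract mderiv_single Zero_fract_def One_fract_def lookup_single when_def)

lemma partial_add: "partial i (f + g) = partial i f + partial i g"
  by (cases f; cases g) (simp add: partial_Fract mderiv_mult mderiv_add eq_fract algebra_simps)

lemma partial_mult: "partial i (f * g) = partial i f * g + f * partial i g"
  by (cases f; cases g) (simp add: partial_Fract mderiv_mult eq_fract algebra_simps)


lemma mderiv_commute: "mderiv i (mderiv j p) = mderiv j (mderiv i p)"
proof -
  have "mderiv i (mderiv j (Poly_Mapping.single \<alpha> c)) = mderiv j (mderiv i (Poly_Mapping.single \<alpha> c))"
    for \<alpha> :: mono and c
    by (cases "i = j")
       (simp_all add: mderiv_single lookup_minus lookup_single diff_right_commute algebra_simps)
  then show ?thesis
    by (subst (1 2) mpol_sum_singles[of p]) (simp add: mderiv_sum)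
qed

lemma mderiv_diff: "mderiv i (p - q) = mderiv i p - mderiv i q"
  using mderiv_add[of i "p - q" q] by (simp add: algebra_simps)

lemma partial_commute: "partial i (partial j f) = partial j (partial i f)"
  by (cases f)
     (simp add: partial_Fract mderiv_mult mderiv_diff mderiv_add eq_fract mderiv_commute[of j i]
        algebra_simps)


subsection \<open>Differential operators and quantum integrability\<close>

text \<open>
  The composition of the powers \<open>T i ^^ lookup \<alpha> i\<close> for \<open>i = 1, \<dots>, M\<close>. It is only relevant for
  pairwise commuting operators, where the order of the factors is immaterial.
\<close>

definition op_monomial ::
  "nat \<Rightarrow> (nat \<Rightarrow> ratfun \<Rightarrow> ratfun) \<Rightarrow> mono \<Rightarrow> ratfun \<Rightarrow> ratfun" where
  "op_monomial M T \<alpha> f = foldr (\<lambda>i g. (T i ^^ Poly_Mapping.lookup \<alpha> i) g) [1..<Suc M] f"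

text \<open>
  Operators on the rational functions in \<open>y\<^sub>1, \<dots>, y\<^sub>M\<close> of the form \<open>\<Sum>\<^sub>\<alpha> a\<^sub>\<alpha> \<partial>\<^sup>\<alpha>\<close> with finitely many
  nonzero coefficients, which are rational functions in the same variables. The values of \<open>L\<close>
  outside \<open>ratfuns M\<close> are irrelevant, here and below.
\<close>

definition diff_op :: "nat \<Rightarrow> (ratfun \<Rightarrow> ratfun) \<Rightarrow> bool" where
  "diff_op M L \<longleftrightarrow> (\<exists>a :: mono \<Rightarrow>\<^sub>0 ratfun.
     (\<forall>\<alpha>\<in>Poly_Mapping.keys a. Poly_Mapping.keys \<alpha> \<subseteq> {1..M} \<and> Poly_Mapping.lookup a \<alpha> \<in> ratfuns M) \<and>
     (\<forall>f\<in>ratfuns M. L f =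
        (\<Sum>\<alpha>\<in>Poly_Mapping.keys a. Poly_Mapping.lookup a \<alpha> * op_monomial M partial \<alpha> f)))"

definition ops_commute :: "nat \<Rightarrow> (ratfun \<Rightarrow> ratfun) \<Rightarrow> (ratfun \<Rightarrow> ratfun) \<Rightarrow> bool" where
  "ops_commute M L L' \<longleftrightarrow> (\<forall>f\<in>ratfuns M. L (L' f) = L' (L f))"

definition op_poly ::
  "nat \<Rightarrow> (nat \<Rightarrow> ratfun \<Rightarrow> ratfun) \<Rightarrow> mpol \<Rightarrow> ratfun \<Rightarrow> ratfun" where
  "op_poly M T P f =
     (\<Sum>\<alpha>\<in>Poly_Mapping.keys P. Cst (Poly_Mapping.lookup P \<alpha>) * op_monomial M T \<alpha> f)"

definition alg_independent_ops :: "nat \<Rightarrow> (nat \<Rightarrow> ratfun \<Rightarrow> ratfun) \<Rightarrow> bool" where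
  "alg_independent_ops M T \<longleftrightarrow>
     (\<forall>P. indets P \<subseteq> {1..M} \<and> (\<forall>f\<in>ratfuns M. op_poly M T P f = 0) \<longrightarrow> P = 0)"

definition quantum_integrable :: "nat \<Rightarrow> (ratfun \<Rightarrow> ratfun) \<Rightarrow> bool" where
  "quantum_integrable M L \<longleftrightarrow> (\<exists>T :: nat \<Rightarrow> ratfun \<Rightarrow> ratfun.
     T 1 = L \<and>
     (\<forall>i\<in>{1..M}. diff_op M (T i)) \<and>
     (\<forall>i\<in>{1..M}. \<forall>j\<in>{1..M}. ops_commute M (T i) (T j)) \<and>
     alg_independent_ops M T)"


subsection \<open>The Hamiltonians\<close>

definition laplacian :: "nat \<Rightarrow> ratfun \<Rightarrow> ratfun" where
  "laplacian M f = (\<Sum>i=1..M. partial i (partial i f))"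

definition sqrt_k :: "nat \<Rightarrow> ratfun" where
  "sqrt_k k = Cst (complex_of_real (sqrt (real k)))"

definition H_A :: "nat \<Rightarrow> nat \<Rightarrow> nat \<Rightarrow> ratfun \<Rightarrow> ratfun" where
  "H_A m n k f = laplacian (m + n) f
     - 2 * of_nat k * (\<Sum>i=1..m. \<Sum>j=i+1..m. (partial i f - partial j f) / (Y i - Y j))
     - 2 / of_nat k *
         (\<Sum>i=m+1..m+n. \<Sum>j=i+1..m+n. (partial i f - partial j f) / (Y i - Y j))
     - 2 * (\<Sum>i=1..m. \<Sum>j=m+1..m+n.
         (partial i f - sqrt_k k * partial j f) / (Y i - sqrt_k k * Y j))"

definition H_B :: "nat \<Rightarrow> nat \<Rightarrow> nat \<Rightarrow> complex \<Rightarrow> ratfun \<Rightarrow> ratfun" where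
  "H_B m n k q f = laplacian (m + n) f
     - (\<Sum>i=1..m. \<Sum>j=i+1..m.
         2 * of_nat k * (partial i f - partial j f) / (Y i - Y j) +
         2 * of_nat k * (partial i f + partial j f) / (Y i + Y j))
     - (\<Sum>i=1..m. \<Sum>j=m+1..m+n.
         2 * (partial i f - sqrt_k k * partial j f) / (Y i - sqrt_k k * Y j) +
         2 * (partial i f + sqrt_k k * partial j f) / (Y i + sqrt_k k * Y j))
     - (\<Sum>i=m+1..m+n. \<Sum>j=i+1..m+n.
         2 * inverse (of_nat k) * (partial i f - partial j f) / (Y i - Y j) +
         2 * inverse (of_nat k) * (partial i f + partial j f) / (Y i + Y j))
     - (\<Sum>i=1..m. Cst (of_nat k * q + of_nat k - 1) * partial i f / Y i)
     - (\<Sum>i=m+1..m+n. Cst q * partial i f / Y i)"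

definition with_oscillator :: "nat \<Rightarrow> complex \<Rightarrow> (ratfun \<Rightarrow> ratfun) \<Rightarrow> ratfun \<Rightarrow> ratfun" where
  "with_oscillator M \<omega> H f = H f - Cst (\<omega>\<^sup>2) * (\<Sum>i=1..M. (Y i)\<^sup>2) * f"

end

theory Submission
  imports Defs "HOL-Computational_Algebra.Polynomial" "HOL-Library.Nat_Bijection"
begin

text \<open>
  The heavy particles are clusters of \<open>k\<close> ordinary ones. On \<open>km + n\<close> variables, the Dunkl operators
  of type \<open>A\<close> or \<open>B\<close> with parameter \<open>c = 1/k\<close> commute, and on invariant polynomials the power sums of
  the operators \<open>h\<^sub>i = (D\<^sub>i + \<omega>x\<^sub>i)(D\<^sub>i - \<omega>x\<^sub>i)\<close> commute because \<open>[h\<^sub>i, h\<^sub>j]\<close> is a multiple of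
  \<open>(h\<^sub>i - h\<^sub>j)\<close> times a sum of reflections. For \<open>c = 1/k\<close> these power sums can be restricted to the
  stratum on which the variables of each cluster coincide, where they become differential operators
  \<open>T\<^sub>r\<close> in \<open>m + n\<close> variables, and \<open>T\<^sub>1\<close> is the given Hamiltonian up to a constant. The \<open>T\<^sub>r\<close> commute on
  all rational functions, since a differential operator which annihilates an algebra containing
  sufficiently many weighted power sums is zero. Their symbols at the differential of
  \<open>\<Sum>\<^sub>a y\<^sub>a\<^sup>2/2\<close> are weighted power sums, which are algebraically independent by the Jacobian criterion.
\<close>

section \<open>Polynomials and substitution\<close>

text \<open>The value of \<open>c\<close> matters for the following reason. On the stratum, the
  divided difference along two variables of one cluster becomes the difference of the two partial
  derivatives. Summed over a cluster of size \<mu> with weight c, these differences give c \<mu>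
  times the derivative in the variable at hand, minus c \<mu> times the mean derivative of the
  cluster. At c \<mu> = 1 the first part cancels the partial derivative in the Dunkl operator. What
  survives is the mean derivative, which is tangent to the stratum. The obstacle is that a single
  Dunkl operator does not preserve invariants and that the reflections do not act on the stratum.
  Hence whole families \<open>g i\<close>, permuted by the reflections up to sign, are restricted
  together. A reflected member is again a member up to sign, so the restricted operators act on
  vectors with one component per cluster. The coordinates u_a = s_a y_a with \<mu>_a s_a^2 = 1 are
  chosen so that the second-order part becomes the standard Laplacian. The ratio of the scale of a
  light particle to that of a heavy one is the square root of k seen in the Hamiltonians.\<close>

definition X :: "nat \<Rightarrow> mpol" where
  "X i = Poly_Mapping.single (Poly_Mapping.single i 1) 1"

definition K :: "complex \<Rightarrow> mpol" where
  "K c = Poly_Mapping.single 0 c"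

lemma K_0 [simp]: "K 0 = 0" and K_1 [simp]: "K 1 = 1"
  by (simp_all add: K_def)

lemma K_add: "K (a + b) = K a + K b"
  by (simp add: K_def single_add)

lemma K_mult: "K (a * b) = K a * K b"
  by (simp add: K_def mult_single)

lemma K_minus: "K (- a) = - K a"
  by (simp add: K_def single_uminus)

lemma K_eq_0_iff [simp]: "K a = 0 \<longleftrightarrow> a = 0"
  by (metis K_0 K_def lookup_single_eq)

lemma K_of_nat: "K (of_nat n) = of_nat n"
  by (induction n) (simp_all add: K_add)

lemma single_eq_K_mult_prod_X:
  "Poly_Mapping.single \<alpha> c = K c * (\<Prod>i\<in>Poly_Mapping.keys \<alpha>. X i ^ Poly_Mapping.lookup \<alpha> i)"
proof -
  have pow: "X i ^ n = Poly_Mapping.single (Poly_Mapping.single i n) 1" for i n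
    by (induction n) (simp_all add: X_def mult_single flip: single_add)
  have prod: "(\<Prod>i\<in>A. Poly_Mapping.single (\<beta> i) (1::complex)) = Poly_Mapping.single (\<Sum>i\<in>A. \<beta> i) 1"
    for A and \<beta> :: "nat \<Rightarrow> mono"
    by (induction A rule: infinite_finite_induct) (simp_all add: mult_single)
  have "\<alpha> = (\<Sum>i\<in>Poly_Mapping.keys \<alpha>. Poly_Mapping.single i (Poly_Mapping.lookup \<alpha> i))"
    by (rule poly_mapping_eqI) (simp add: lookup_sum lookup_single when_def in_keys_iff)
  then show ?thesis
    unfolding pow prod by (simp add: K_def mult_single)
qed

lemma indets_single: "c \<noteq> 0 \<Longrightarrow> indets (Poly_Mapping.single \<alpha> c) = Poly_Mapping.keys \<alpha>"
  by (simp add: indets_def)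

lemma mpol_induct_indets [consumes 1, case_names const var add mult]:
  assumes "indets p \<subseteq> S"
    and const: "\<And>c. P (K c)" and var: "\<And>i. i \<in> S \<Longrightarrow> P (X i)"
    and add: "\<And>p q. P p \<Longrightarrow> P q \<Longrightarrow> P (p + q)" and mult: "\<And>p q. P p \<Longrightarrow> P q \<Longrightarrow> P (p * q)"
  shows "P p"
proof -
  have pow: "P (X i ^ n)" if "i \<in> S" for i n
    using const[of 1] by (induction n) (auto intro: mult var that)
  have prod: "P (\<Prod>i\<in>A. X i ^ e i)" if "A \<subseteq> S" for A e
    using that const[of 1]
    by (induction A rule: infinite_finite_induct) (auto intro: mult pow)
  have sum: "P (\<Sum>a\<in>A. f a)" if "\<And>a. a \<in> A \<Longrightarrow> P (f a)" for A and f :: "mono \<Rightarrow> mpol"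
    using that const[of 0]
    by (induction A rule: infinite_finite_induct) (auto intro: add)
  show ?thesis
    by (subst mpol_sum_singles, rule sum, subst single_eq_K_mult_prod_X, intro mult const prod)
       (use assms(1) in \<open>auto simp: indets_def\<close>)
qed

lemma mpol_induct [case_names const var add mult]:
  assumes "\<And>c. P (K c)" and "\<And>i. P (X i)"
    and "\<And>p q. P p \<Longrightarrow> P q \<Longrightarrow> P (p + q)" and "\<And>p q. P p \<Longrightarrow> P q \<Longrightarrow> P (p * q)"
  shows "P (p :: mpol)"
  by (rule mpol_induct_indets[where S = UNIV]) (use assms in auto)

section \<open>Evaluation of polynomials in a commutative ring\<close>

definition subst_mono :: "(nat \<Rightarrow> 'a::comm_ring_1) \<Rightarrow> mono \<Rightarrow> 'a" where
  "subst_mono \<sigma> \<alpha> = (\<Prod>i\<in>Poly_Mapping.keys \<alpha>. \<sigma> i ^ Poly_Mapping.lookup \<alpha> i)"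

definition subst_poly :: "(complex \<Rightarrow> 'a::comm_ring_1) \<Rightarrow> (nat \<Rightarrow> 'a) \<Rightarrow> mpol \<Rightarrow> 'a" where
  "subst_poly e \<sigma> p = (\<Sum>\<alpha>\<in>Poly_Mapping.keys p. e (Poly_Mapping.lookup p \<alpha>) * subst_mono \<sigma> \<alpha>)"

lemma subst_mono_superset:
  "finite A \<Longrightarrow> Poly_Mapping.keys \<alpha> \<subseteq> A \<Longrightarrow> subst_mono \<sigma> \<alpha> = (\<Prod>i\<in>A. \<sigma> i ^ Poly_Mapping.lookup \<alpha> i)"
  unfolding subst_mono_def by (intro prod.mono_neutral_left) (auto simp: in_keys_iff)

lemma subst_mono_0 [simp]: "subst_mono \<sigma> 0 = 1"
  by (simp add: subst_mono_def)

lemma subst_mono_add: "subst_mono \<sigma> (\<alpha> + \<beta>) = subst_mono \<sigma> \<alpha> * subst_mono \<sigma> \<beta>"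
proof -
  let ?A = "Poly_Mapping.keys \<alpha> \<union> Poly_Mapping.keys \<beta>"
  have "finite ?A" "Poly_Mapping.keys (\<alpha> + \<beta>) \<subseteq> ?A"
    using Poly_Mapping.keys_add[of \<alpha> \<beta>] by auto
  then show ?thesis
    by (simp add: subst_mono_superset[of ?A] lookup_add power_add prod.distrib)
qed

text \<open>Two targets are needed: \<open>K\<close> evaluates inside the polynomials, which yields
  the reflections, and \<open>Cst\<close> evaluates in the rational functions, which yields the
  restriction to the stratum and the relations between power sums.\<close>

locale scalar_hom =
  fixes e :: "complex \<Rightarrow> 'a::comm_ring_1"
  assumes e_1 [simp]: "e 1 = 1"
    and e_add: "e (a + b) = e a + e b" and e_mult: "e (a * b) = e a * e b"
begin

lemma e_0 [simp]: "e 0 = 0"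
  using e_add[of 0 0] by simp

lemma e_diff: "e (a - b) = e a - e b"
  using e_add[of "a - b" b] by simp

lemma e_sum: "e (sum f A) = (\<Sum>x\<in>A. e (f x))"
  by (induction A rule: infinite_finite_induct) (simp_all add: e_add)

lemma subst_poly_superset:
  "finite A \<Longrightarrow> Poly_Mapping.keys p \<subseteq> A \<Longrightarrow>
    subst_poly e \<sigma> p = (\<Sum>\<alpha>\<in>A. e (Poly_Mapping.lookup p \<alpha>) * subst_mono \<sigma> \<alpha>)"
  unfolding subst_poly_def by (intro sum.mono_neutral_left) (auto simp: in_keys_iff)

lemma subst_poly_add: "subst_poly e \<sigma> (p + q) = subst_poly e \<sigma> p + subst_poly e \<sigma> q"
proof -
  let ?A = "Poly_Mapping.keys p \<union> Poly_Mapping.keys q"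
  have "finite ?A" "Poly_Mapping.keys (p + q) \<subseteq> ?A"
    using Poly_Mapping.keys_add[of p q] by auto
  then show ?thesis
    by (simp add: subst_poly_superset[of ?A] lookup_add e_add sum.distrib algebra_simps)
qed

lemma subst_poly_0 [simp]: "subst_poly e \<sigma> 0 = 0"
  by (simp add: subst_poly_def)

lemma subst_poly_sum: "subst_poly e \<sigma> (\<Sum>x\<in>A. f x) = (\<Sum>x\<in>A. subst_poly e \<sigma> (f x))"
  by (induction A rule: infinite_finite_induct) (simp_all add: subst_poly_add)

lemma subst_poly_single: "subst_poly e \<sigma> (Poly_Mapping.single \<alpha> c) = e c * subst_mono \<sigma> \<alpha>"
  by (subst subst_poly_superset[of "{\<alpha>}"]) auto

lemma subst_poly_K [simp]: "subst_poly e \<sigma> (K c) = e c"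
  by (simp add: K_def subst_poly_single)

lemma subst_poly_1 [simp]: "subst_poly e \<sigma> 1 = 1"
  using subst_poly_K[of \<sigma> 1] by simp

lemma subst_poly_X [simp]: "subst_poly e \<sigma> (X i) = \<sigma> i"
  by (simp add: X_def subst_poly_single subst_mono_def)

lemma subst_poly_mult: "subst_poly e \<sigma> (p * q) = subst_poly e \<sigma> p * subst_poly e \<sigma> q"
  by (subst (1 2) mpol_sum_singles[of p], subst (1 2) mpol_sum_singles[of q])
     (simp add: sum_product subst_poly_sum subst_poly_single mult_single subst_mono_add e_mult
       algebra_simps)

lemma subst_poly_minus: "subst_poly e \<sigma> (- p) = - subst_poly e \<sigma> p"
  using subst_poly_add[of \<sigma> p "- p"] by (simp add: add_eq_0_iff)

lemma subst_poly_diff: "subst_poly e \<sigma> (p - q) = subst_poly e \<sigma> p - subst_poly e \<sigma> q"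
  using subst_poly_add[of \<sigma> "p - q" q] by simp

lemma subst_poly_power: "subst_poly e \<sigma> (p ^ n) = subst_poly e \<sigma> p ^ n"
  by (induction n) (simp_all add: subst_poly_mult)

end

interpretation K: scalar_hom K
  by unfold_locales (simp_all add: K_add K_mult)

lemma Cst_0 [simp]: "Cst 0 = 0" and Cst_1 [simp]: "Cst 1 = 1"
  by (simp_all add: Cst_def Zero_fract_def One_fract_def)

lemma Cst_add: "Cst (a + b) = Cst a + Cst b"
  by (simp add: Cst_def single_add)

lemma Cst_mult: "Cst (a * b) = Cst a * Cst b"
  by (simp add: Cst_def mult_single)

interpretation Cst: scalar_hom Cst
  by unfold_locales (simp_all add: Cst_add Cst_mult)

lemma Cst_minus: "Cst (- a) = - Cst a"
  using Cst_add[of a "- a"] by (simp add: add_eq_0_iff)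

lemma Cst_of_nat: "Cst (of_nat n) = of_nat n"
  by (induction n) (simp_all add: Cst_add)

lemma Cst_eq_0_iff [simp]: "Cst a = 0 \<longleftrightarrow> a = 0"
proof
  assume "Cst a = 0"
  then have "Poly_Mapping.single 0 a = (0 :: mpol)"
    by (simp add: Cst_def Zero_fract_def eq_fract)
  then show "a = 0" by (metis lookup_single_eq lookup_zero)
qed simp

lemma Cst_inverse: "Cst (inverse a) = inverse (Cst a)"
proof (cases "a = 0")
  case False
  then have "Cst (inverse a) * Cst a = 1" by (simp flip: Cst_mult)
  then show ?thesis by (metis inverse_unique mult.commute)
qed simp

lemma of_nat_ratfun_eq_0_iff [simp]: "(of_nat n :: ratfun) = 0 \<longleftrightarrow> n = 0"
  by (metis Cst_eq_0_iff Cst_of_nat of_nat_eq_0_iff)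

lemma Y_eq_X: "Y i = Fract (X i) 1"
  by (simp add: Y_def X_def)

lemma mderiv_K [simp]: "mderiv i (K c) = 0"
  by (simp add: K_def mderiv_single)

lemma mderiv_X: "mderiv i (X j) = (if i = j then 1 else 0)"
  by (simp add: X_def mderiv_single lookup_single when_def)

text \<open>The chain rule. There are infinitely many variables, so the sum is confined to a finite
  set \<open>J\<close> outside of which \<delta> kills the substituted values.\<close>

lemma derivation_subst_poly:
  fixes \<delta> :: "ratfun \<Rightarrow> ratfun"
  assumes add: "\<And>f g. \<delta> (f + g) = \<delta> f + \<delta> g" and mult: "\<And>f g. \<delta> (f * g) = \<delta> f * g + f * \<delta> g"
    and const: "\<And>c. \<delta> (Cst c) = 0" and "finite J" and outside: "\<And>i. i \<notin> J \<Longrightarrow> \<delta> (\<sigma> i) = 0"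
  shows "\<delta> (subst_poly Cst \<sigma> p) = (\<Sum>i\<in>J. subst_poly Cst \<sigma> (mderiv i p) * \<delta> (\<sigma> i))"
proof (induction p rule: mpol_induct)
  case (var j)
  have "(\<Sum>i\<in>J. subst_poly Cst \<sigma> (mderiv i (X j)) * \<delta> (\<sigma> i)) = (\<Sum>i\<in>J. if j = i then \<delta> (\<sigma> i) else 0)"
    by (intro sum.cong) (auto simp: mderiv_X)
  then show ?case using \<open>finite J\<close> outside by auto
next
  case (mult p q)
  then show ?case
    by (simp add: Cst.subst_poly_mult assms(2) mderiv_mult Cst.subst_poly_add sum.distrib
        sum_distrib_left sum_distrib_right algebra_simps)
qed (simp_all add: const add Cst.subst_poly_add mderiv_add sum.distrib distrib_right)

section \<open>Reflections and divided differences\<close>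

text \<open>
  \<open>reflect i j \<tau>\<close> with \<open>\<tau> = \<plusminus>1\<close> is the reflection in the root \<open>x\<^sub>i - \<tau> x\<^sub>j\<close>. Sign changes are the case
  \<open>i = j\<close>, \<open>\<tau> = -1\<close>, with root \<open>2 x\<^sub>i\<close>; this treats the types \<open>A\<close> and \<open>B\<close> uniformly.
\<close>

definition reflect :: "nat \<Rightarrow> nat \<Rightarrow> complex \<Rightarrow> mpol \<Rightarrow> mpol" where
  "reflect i j \<tau> = subst_poly K (\<lambda>l. if l = i then K \<tau> * X j else if l = j then K \<tau> * X i else X l)"

definition root_form :: "nat \<Rightarrow> nat \<Rightarrow> complex \<Rightarrow> mpol" where
  "root_form i j \<tau> = X i - K \<tau> * X j"

text \<open>A choice that stays inside the polynomials: the quotient exists by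
  \<open>root_dvd\<close> and is unique because root forms are nonzero in an integral
  domain.\<close>

definition ddiff :: "nat \<Rightarrow> nat \<Rightarrow> complex \<Rightarrow> mpol \<Rightarrow> mpol" where
  "ddiff i j \<tau> f = (SOME g. root_form i j \<tau> * g = f - reflect i j \<tau> f)"

definition is_root :: "nat \<Rightarrow> nat \<Rightarrow> complex \<Rightarrow> bool" where
  "is_root i j \<tau> \<longleftrightarrow> \<tau> * \<tau> = 1 \<and> (i = j \<longrightarrow> \<tau> \<noteq> 1)"

text \<open>A reflection is a signed permutation of the variables; \<open>sw\<close> is its
  permutation and \<open>sgn_at\<close> gives its signs.\<close>

definition sw :: "nat \<Rightarrow> nat \<Rightarrow> nat \<Rightarrow> nat" where
  "sw a b i = (if i = a then b else if i = b then a else i)"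

definition sgn_at :: "nat \<Rightarrow> nat \<Rightarrow> complex \<Rightarrow> nat \<Rightarrow> complex" where
  "sgn_at a b t i = (if i = a \<or> i = b then t else 1)"

lemma reflect_K [simp]: "reflect i j \<tau> (K c) = K c"
  and reflect_1 [simp]: "reflect i j \<tau> 1 = 1"
  and reflect_0 [simp]: "reflect i j \<tau> 0 = 0"
  and reflect_add: "reflect i j \<tau> (p + q) = reflect i j \<tau> p + reflect i j \<tau> q"
  and reflect_diff: "reflect i j \<tau> (p - q) = reflect i j \<tau> p - reflect i j \<tau> q"
  and reflect_mult: "reflect i j \<tau> (p * q) = reflect i j \<tau> p * reflect i j \<tau> q"
  and reflect_power: "reflect i j \<tau> (p ^ n) = reflect i j \<tau> p ^ n"
  and reflect_sum: "reflect i j \<tau> (sum f A) = (\<Sum>x\<in>A. reflect i j \<tau> (f x))"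
  by (simp_all add: reflect_def K.subst_poly_add K.subst_poly_mult K.subst_poly_diff
      K.subst_poly_power K.subst_poly_sum)

lemma reflect_X: "reflect a b t (X i) = K (sgn_at a b t i) * X (sw a b i)"
  by (simp add: reflect_def sgn_at_def sw_def)

lemma sw_sw [simp]: "sw a b (sw a b i) = i"
  by (simp add: sw_def)

lemma sw_eq_iff [simp]: "sw a b i = sw a b j \<longleftrightarrow> i = j"
  by (metis sw_sw)

lemma sgn_at_sw [simp]: "sgn_at a b t (sw a b i) = sgn_at a b t i"
  by (auto simp: sgn_at_def sw_def)

lemma sgn_at_square: "t * t = 1 \<Longrightarrow> sgn_at a b t i * sgn_at a b t i = 1"
  by (simp add: sgn_at_def)

lemma K_sgn_at_square: "t * t = 1 \<Longrightarrow> K (sgn_at a b t i) * K (sgn_at a b t i) = 1"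
  by (simp add: sgn_at_square flip: K_mult)

lemma reflect_commute: "reflect i j \<tau> = reflect j i \<tau>"
  unfolding reflect_def by (rule arg_cong[where f = "subst_poly K"]) auto

text \<open>Differentiation by x_i gives 1, or 1 - \<tau> if i = j.\<close>

lemma root_nonzero:
  assumes "is_root i j \<tau>"
  shows "root_form i j \<tau> \<noteq> 0"
proof
  assume "root_form i j \<tau> = 0"
  then have "mderiv i (root_form i j \<tau>) = 0" by simp
  then have "1 - K (if i = j then \<tau> else 0) = 0"
    by (auto simp: root_form_def mderiv_diff mderiv_mult mderiv_X split: if_splits)
  then have "K (1 - (if i = j then \<tau> else 0)) = 0"
    by (metis K_1 K_add K_minus diff_conv_add_uminus)
  with assms show False by (auto simp: is_root_def split: if_splits)
qed

text \<open>The map taking f to \<open>f - reflect i j \<tau> f\<close> is a skew derivation, so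
  divisibility passes from the variables to all polynomials.\<close>

lemma root_dvd: 
  assumes "is_root i j \<tau>"
  shows "root_form i j \<tau> dvd f - reflect i j \<tau> f"
proof (induction f rule: mpol_induct)
  case (var l)
  have tt: "K \<tau> * K \<tau> = 1" using assms by (simp add: is_root_def flip: K_mult)
  have "X l - reflect i j \<tau> (X l) = root_form i j \<tau> * (if l = i then 1 else if l = j then - K \<tau> else 0)"
    using tt by (auto simp: reflect_X sw_def sgn_at_def root_form_def algebra_simps simp flip: mult.assoc)
  then show ?case by simp
next
  case (add p q)
  have "p + q - reflect i j \<tau> (p + q) = (p - reflect i j \<tau> p) + (q - reflect i j \<tau> q)"
    by (simp add: reflect_add)
  then show ?case using add by (metis dvd_add)
next
  case (mult p q)
  have "p * q - reflect i j \<tau> (p * q) = (p - reflect i j \<tau> p) * q + reflect i j \<tau> p * (q - reflect i j \<tau> q)"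
    by (simp add: reflect_mult algebra_simps)
  then show ?case using mult by (metis dvd_add dvd_mult dvd_mult2)
qed simp

lemma root_ddiff: "is_root i j \<tau> \<Longrightarrow> root_form i j \<tau> * ddiff i j \<tau> f = f - reflect i j \<tau> f"
  unfolding ddiff_def by (rule someI_ex) (metis root_dvd dvd_def)

lemma ddiff_eqI: "is_root i j \<tau> \<Longrightarrow> root_form i j \<tau> * g = f - reflect i j \<tau> f \<Longrightarrow> ddiff i j \<tau> f = g"
  by (metis mult_left_cancel root_nonzero root_ddiff)

context
  fixes i j \<tau> assumes root: "is_root i j \<tau>"
begin

lemma ddiff_add: "ddiff i j \<tau> (p + q) = ddiff i j \<tau> p + ddiff i j \<tau> q"
  by (rule ddiff_eqI[OF root]) (simp add: distrib_left root_ddiff[OF root] reflect_add)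

lemma ddiff_mult: "ddiff i j \<tau> (p * q) = p * ddiff i j \<tau> q + ddiff i j \<tau> p * reflect i j \<tau> q"
proof (rule ddiff_eqI[OF root])
  have "root_form i j \<tau> * (p * ddiff i j \<tau> q + ddiff i j \<tau> p * reflect i j \<tau> q)
      = p * (root_form i j \<tau> * ddiff i j \<tau> q) + (root_form i j \<tau> * ddiff i j \<tau> p) * reflect i j \<tau> q"
    by (simp add: algebra_simps)
  also have "\<dots> = p * q - reflect i j \<tau> (p * q)"
    unfolding root_ddiff[OF root] by (simp add: algebra_simps reflect_mult)
  finally show "root_form i j \<tau> * (p * ddiff i j \<tau> q + ddiff i j \<tau> p * reflect i j \<tau> q)
      = p * q - reflect i j \<tau> (p * q)" .
qed

lemma ddiff_K [simp]: "ddiff i j \<tau> (K c) = 0"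
  by (rule ddiff_eqI[OF root]) simp

lemma ddiff_X: "ddiff i j \<tau> (X l) = (if l = i then 1 else if l = j then - K \<tau> else 0)"
proof -
  have "K \<tau> * K \<tau> = 1" using root by (simp add: is_root_def flip: K_mult)
  then show ?thesis
    by (intro ddiff_eqI[OF root])
       (auto simp: reflect_X sw_def sgn_at_def root_form_def algebra_simps simp flip: mult.assoc)
qed

end

lemma reflect_X_simps:
  "reflect i j \<tau> (X i) = K \<tau> * X j" "reflect i j \<tau> (X j) = K \<tau> * X i"
  "l \<noteq> i \<Longrightarrow> l \<noteq> j \<Longrightarrow> reflect i j \<tau> (X l) = X l"
  by (simp_all add: reflect_def)

text \<open>Conjugating a reflection by \<open>w\<close> gives the reflection in the image of its
  root. The new sign \<open>\<tau> * \<eta> i * \<eta> j\<close> appears when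
  \<open>\<eta> i\<close> is factored out of that image. Both sides are ring homomorphisms in
  \<open>f\<close>, so the variables suffice.\<close>

lemma reflect_reflect_conj:
  fixes a b :: nat
  assumes t: "t * t = 1"
  defines "w \<equiv> reflect a b t" and "\<pi> \<equiv> sw a b" and "\<eta> \<equiv> sgn_at a b t"
  shows "w (reflect i j \<tau> f) = reflect (\<pi> i) (\<pi> j) (\<tau> * \<eta> i * \<eta> j) (w f)"
proof (induction f rule: mpol_induct)
  case (var l)
  have X: "w (X l) = K (\<eta> l) * X (\<pi> l)" for l
    by (simp add: w_def reflect_X \<eta>_def \<pi>_def)
  have KX: "w (K c * p) = K c * w p" for c p
    by (simp add: w_def reflect_mult)
  have sq: "K (\<eta> l) * K (\<eta> l) = 1" for l
    unfolding \<eta>_def by (rule K_sgn_at_square[OF t])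
  have inj: "\<pi> l = \<pi> l' \<longleftrightarrow> l = l'" for l l' by (simp add: \<pi>_def)
  consider "l = i" | "l = j" | "l \<noteq> i" "l \<noteq> j" by blast
  then show ?case
  proof cases
    case 1
    have "K (\<eta> i) * (K (\<tau> * \<eta> i * \<eta> j) * X (\<pi> j)) = K \<tau> * (K (\<eta> j) * X (\<pi> j)) * (K (\<eta> i) * K (\<eta> i))"
      by (simp only: K_mult ac_simps)
    then show ?thesis by (auto simp: 1 sq X KX reflect_X_simps reflect_mult)
  next
    case 2
    have "K (\<eta> j) * (K (\<tau> * \<eta> i * \<eta> j) * X (\<pi> i)) = K \<tau> * (K (\<eta> i) * X (\<pi> i)) * (K (\<eta> j) * K (\<eta> j))"
      by (simp only: K_mult ac_simps)
    then show ?thesis by (auto simp: 2 sq X KX reflect_X_simps reflect_mult)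
  qed (simp add: X reflect_X_simps reflect_mult inj)
qed (simp_all add: w_def reflect_add reflect_mult)

lemma is_root_sw:
  assumes "t * t = 1" "is_root i j \<tau>"
  shows "is_root (sw a b i) (sw a b j) (\<tau> * sgn_at a b t i * sgn_at a b t j)"
  using assms sgn_at_square[OF assms(1), of a b] unfolding is_root_def
  by (auto simp: mult.assoc mult.left_commute)

lemma reflect_root:
  assumes "t * t = 1"
  shows "reflect a b t (root_form i j \<tau>)
    = K (sgn_at a b t i) * root_form (sw a b i) (sw a b j) (\<tau> * sgn_at a b t i * sgn_at a b t j)"
proof -
  let ?\<eta> = "sgn_at a b t"
  have "K (?\<eta> i) * (K (\<tau> * ?\<eta> i * ?\<eta> j) * X (sw a b j)) = K \<tau> * (K (?\<eta> j) * X (sw a b j)) * (K (?\<eta> i) * K (?\<eta> i))"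
    by (simp only: K_mult ac_simps)
  then show ?thesis
    by (auto simp: root_form_def reflect_diff reflect_mult reflect_X right_diff_distrib K_sgn_at_square[OF assms])
qed

text \<open>The factor in front is the one by which the reflected root form differs from the form of
  the reflected root; it is its own inverse.\<close>

lemma reflect_ddiff:
  assumes "t * t = 1" "is_root i j \<tau>"
  shows "reflect a b t (ddiff i j \<tau> f) = K (sgn_at a b t i) *
    ddiff (sw a b i) (sw a b j) (\<tau> * sgn_at a b t i * sgn_at a b t j) (reflect a b t f)"
proof -
  let ?\<rho> = "root_form (sw a b i) (sw a b j) (\<tau> * sgn_at a b t i * sgn_at a b t j)"
  have "?\<rho> * (K (sgn_at a b t i) * reflect a b t (ddiff i j \<tau> f)) = reflect a b t (root_form i j \<tau> * ddiff i j \<tau> f)"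
    by (simp add: reflect_mult reflect_root[OF assms(1)] algebra_simps)
  also have "\<dots> = reflect a b t f - reflect a b t (reflect i j \<tau> f)"
    by (simp add: root_ddiff[OF assms(2)] reflect_diff)
  finally have "ddiff (sw a b i) (sw a b j) (\<tau> * sgn_at a b t i * sgn_at a b t j) (reflect a b t f)
     = K (sgn_at a b t i) * reflect a b t (ddiff i j \<tau> f)"
    by (intro ddiff_eqI is_root_sw assms) (simp add: reflect_reflect_conj[OF assms(1)])
  then show ?thesis
    using K_sgn_at_square[OF assms(1), of a b i] by (simp flip: mult.assoc)
qed

lemma reflect_mderiv:
  assumes "t * t = 1"
  shows "reflect a b t (mderiv i f) = K (sgn_at a b t i) * mderiv (sw a b i) (reflect a b t f)"
proof (induction f rule: mpol_induct)
  case (var l)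
  show ?case using K_sgn_at_square[OF assms, of a b i]
    by (auto simp: mderiv_X reflect_X mderiv_mult)
qed (simp_all add: reflect_add reflect_mult mderiv_add mderiv_mult algebra_simps)

section \<open>Dunkl operators\<close>

text \<open>\<open>S = {1}\<close> gives type A and \<open>S = {1, -1}\<close> type B;
  \<open>c\<close> is the multiplicity of the roots x_i \<plusminus> x_j and \<open>q\<close> that
  of the sign changes.\<close>

locale dunkl =
  fixes I :: "nat set" and S :: "complex set" and c q :: complex
  assumes finite_I: "finite I" and one_in_S: "1 \<in> S" and S_subset: "S \<subseteq> {1, -1}"
begin

lemma finite_S: "finite S"
  using S_subset finite_subset by blast

lemma S_square: "\<tau> \<in> S \<Longrightarrow> \<tau> * \<tau> = 1"
  using S_subset by auto

lemma S_mult: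
  assumes "\<tau> \<in> S" "\<tau>' \<in> S"
  shows "\<tau> * \<tau>' \<in> S"
proof -
  have "\<tau> = 1 \<or> \<tau> = -1" using assms(1) S_subset by blast
  moreover have "\<tau>' = 1 \<or> \<tau>' = -1" using assms(2) S_subset by blast
  ultimately show ?thesis using assms one_in_S by auto
qed

lemma sgn_at_in_S: "t \<in> S \<Longrightarrow> sgn_at a b t i \<in> S"
  using one_in_S by (simp add: sgn_at_def)

definition roots :: "nat \<Rightarrow> (nat \<times> complex) set" where
  "roots i = I \<times> S - {(i, 1)}"

definition mult :: "nat \<Rightarrow> nat \<Rightarrow> complex" where
  "mult i j = (if i = j then q else c)"

definition D :: "nat \<Rightarrow> mpol \<Rightarrow> mpol" where
  "D i f = mderiv i f - (\<Sum>(j, \<tau>)\<in>roots i. K (mult i j) * ddiff i j \<tau> f)"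

lemma finite_roots: "finite (roots i)"
  by (simp add: roots_def finite_I finite_S)

lemma mem_roots: "(j, \<tau>) \<in> roots i \<longleftrightarrow> j \<in> I \<and> \<tau> \<in> S \<and> (j = i \<longrightarrow> \<tau> \<noteq> 1)"
  by (auto simp: roots_def)

lemma is_root: "(j, \<tau>) \<in> roots i \<Longrightarrow> is_root i j \<tau>"
  by (auto simp: roots_def is_root_def S_square)

lemma D_add: "D i (f + g) = D i f + D i g"
proof -
  have "(\<Sum>(j, \<tau>)\<in>roots i. K (mult i j) * ddiff i j \<tau> (f + g)) =
    (\<Sum>(j, \<tau>)\<in>roots i. K (mult i j) * ddiff i j \<tau> f + K (mult i j) * ddiff i j \<tau> g)"
    by (rule sum.cong) (auto simp: ddiff_add is_root distrib_left)
  then show ?thesis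
    by (simp add: D_def mderiv_add case_prod_unfold sum.distrib)
qed

lemma D_K [simp]: "D i (K a) = 0"
  by (auto simp: D_def intro!: sum.neutral dest: is_root)

lemma D_K_mult: "D i (K a * f) = K a * D i f"
proof -
  have "(\<Sum>(j, \<tau>)\<in>roots i. K (mult i j) * ddiff i j \<tau> (K a * f)) =
    (\<Sum>(j, \<tau>)\<in>roots i. K a * (K (mult i j) * ddiff i j \<tau> f))"
    by (rule sum.cong) (auto simp: ddiff_mult is_root)
  then show ?thesis
    by (simp add: D_def mderiv_mult case_prod_unfold sum_distrib_left right_diff_distrib)
qed

lemma D_0 [simp]: "D i 0 = 0"
  using D_K[of i 0] by simp

lemma D_1 [simp]: "D i 1 = 0"
  using D_K[of i 1] by simp

lemma D_minus: "D i (- f) = - D i f"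
  using D_add[of i f "- f"] by (simp add: add_eq_0_iff)

lemma D_diff: "D i (f - g) = D i f - D i g"
  using D_add[of i f "- g"] by (simp add: D_minus)

lemma D_sum: "D i (\<Sum>x\<in>A. f x) = (\<Sum>x\<in>A. D i (f x))"
  by (induction A rule: infinite_finite_induct) (simp_all add: D_add)

text \<open>The reflection carries the roots at \<open>i\<close> to the roots at
  \<open>sw a b i\<close> and preserves multiplicities, so the sum of divided differences is merely
  reindexed.\<close>

lemma reflect_D:
  assumes "a \<in> I" "b \<in> I" "t \<in> S"
  shows "reflect a b t (D i f) = K (sgn_at a b t i) * D (sw a b i) (reflect a b t f)"
proof -
  let ?\<eta> = "sgn_at a b t" and ?\<pi> = "sw a b" and ?g = "reflect a b t f"
  let ?\<phi> = "\<lambda>i (j, \<tau>). (?\<pi> j, \<tau> * ?\<eta> i * ?\<eta> j)"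
  have t: "t * t = 1" using assms S_square by blast
  have sq: "?\<eta> i * (?\<eta> i * x) = x" for i x
    using sgn_at_square[OF t, of a b i] by (simp flip: mult.assoc)
  have img: "?\<phi> i x \<in> roots (?\<pi> i)" if "x \<in> roots i" for x i
  proof -
    obtain j \<tau> where x: "x = (j, \<tau>)" by force
    have "?\<pi> j \<in> I" if "j \<in> I" for j using assms that by (auto simp: sw_def)
    then show ?thesis
      using that sgn_at_square[OF t, of a b] unfolding x
      by (auto simp: roots_def assms sgn_at_in_S mult.assoc intro!: S_mult)
  qed
  \<comment> \<open>This makes the two reindexing maps inverse to each other: each sign occurs
    twice.\<close>
  have cancel: "\<tau> * ?\<eta> i * ?\<eta> j * ?\<eta> i * ?\<eta> j = \<tau>" for \<tau> j
  proof -
    have "\<tau> * ?\<eta> i * ?\<eta> j * ?\<eta> i * ?\<eta> j = \<tau> * (?\<eta> i * (?\<eta> i * (?\<eta> j * (?\<eta> j * 1))))"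
      by (simp add: ac_simps)
    then show ?thesis unfolding sq by simp
  qed
  have mult_sw: "mult i (?\<pi> j) = mult (?\<pi> i) j" for j
    using sw_eq_iff[of a b i "?\<pi> j"] by (auto simp: mult_def)
  have "(\<Sum>(j, \<tau>)\<in>roots (?\<pi> i). K (?\<eta> i) * (K (mult (?\<pi> i) j) * ddiff (?\<pi> i) j \<tau> ?g))
    = (\<Sum>(j, \<tau>)\<in>roots i. K (?\<eta> i) * (K (mult i j) * ddiff (?\<pi> i) (?\<pi> j) (\<tau> * ?\<eta> i * ?\<eta> j) ?g))"
    by (rule sum.reindex_bij_witness[where i = "?\<phi> i" and j = "?\<phi> (?\<pi> i)"])
       (use img[of _ i] img[of _ "?\<pi> i"] in \<open>auto simp: cancel mult_sw\<close>)
  also have "\<dots> = (\<Sum>(j, \<tau>)\<in>roots i. reflect a b t (K (mult i j) * ddiff i j \<tau> f))"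
    by (intro sum.cong refl)
       (auto simp: reflect_mult reflect_ddiff[OF t] is_root algebra_simps)
  finally show ?thesis
    by (simp add: D_def reflect_diff reflect_sum reflect_mderiv[OF t] right_diff_distrib
        sum_distrib_left case_prod_unfold)
qed

text \<open>\<open>mixed i k\<close> is the commutator of \<open>D i\<close> with x_k for k \<noteq>
  i, and \<open>diagonal i\<close> that with x_i. A variable outside \<open>I\<close> commutes with
  \<open>D i\<close>, whence the value 0.\<close>

definition mixed :: "nat \<Rightarrow> nat \<Rightarrow> mpol \<Rightarrow> mpol" where
  "mixed i k f = (if k \<in> I then \<Sum>\<tau>\<in>S. K (c * \<tau>) * reflect i k \<tau> f else 0)"

definition diagonal :: "nat \<Rightarrow> mpol \<Rightarrow> mpol" where
  "diagonal i f = f - (\<Sum>(j, \<tau>)\<in>roots i. K (mult i j) * reflect i j \<tau> f)"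

lemma D_X_mult: "D i (X k * f) = X k * D i f + (if i = k then diagonal i f else mixed i k f)"
proof -
  have eq: "(\<Sum>(j, \<tau>)\<in>roots i. K (mult i j) * ddiff i j \<tau> (X k * f))
    = (\<Sum>(j, \<tau>)\<in>roots i. X k * (K (mult i j) * ddiff i j \<tau> f))
      + (\<Sum>(j, \<tau>)\<in>roots i. K (mult i j) * (ddiff i j \<tau> (X k) * reflect i j \<tau> f))"
    unfolding sum.distrib[symmetric]
    by (rule sum.cong) (auto simp: ddiff_mult is_root distrib_left mult.left_commute)
  have "(\<Sum>(j, \<tau>)\<in>roots i. K (mult i j) * (ddiff i j \<tau> (X k) * reflect i j \<tau> f))
    = (if i = k then f - diagonal i f else - mixed i k f)"
  proof (cases "i = k")
    case True
    have "(\<Sum>(j, \<tau>)\<in>roots i. K (mult i j) * (ddiff i j \<tau> (X k) * reflect i j \<tau> f))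
      = (\<Sum>(j, \<tau>)\<in>roots i. K (mult i j) * reflect i j \<tau> f)"
      by (rule sum.cong) (auto simp: ddiff_X is_root True)
    then show ?thesis by (simp add: True diagonal_def)
  next
    case False
    have "(\<Sum>(j, \<tau>)\<in>roots i. K (mult i j) * (ddiff i j \<tau> (X k) * reflect i j \<tau> f))
      = (\<Sum>(j, \<tau>)\<in>(I \<inter> {k}) \<times> S. - (K (c * \<tau>) * reflect i j \<tau> f))"
      using False
      by (intro sum.mono_neutral_cong_right)
         (auto simp: ddiff_X is_root_def S_square finite_roots mult_def mem_roots K_mult split: if_splits)
    also have "\<dots> = - mixed i k f"
      by (simp add: mixed_def sum_negf flip: sum.cartesian_product)
    finally show ?thesis using False by simp
  qed
  then show ?thesis
    unfolding D_def eq by (simp add: mderiv_mult mderiv_X sum_distrib_left case_prod_unfold algebra_simps)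
qed

lemma mixed_commute: "i \<in> I \<Longrightarrow> k \<in> I \<Longrightarrow> mixed i k = mixed k i"
  by (simp add: mixed_def fun_eq_iff reflect_commute[of i k])

lemma D_mixed:
  assumes "j \<in> I" "i \<noteq> j" "i \<noteq> k"
  shows "D i (mixed j k f) = mixed j k (D i f)"
proof (cases "k \<in> I")
  case True
  have "D i (K (c * \<tau>) * reflect j k \<tau> f) = K (c * \<tau>) * reflect j k \<tau> (D i f)" if "\<tau> \<in> S" for \<tau>
    using assms True that by (simp add: D_K_mult reflect_D sgn_at_def sw_def)
  then show ?thesis by (simp add: mixed_def D_sum True)
qed (simp add: mixed_def)

text \<open>Rearranged, this equates the commutator of \<open>D i\<close> with
  \<open>mixed i j\<close> and that of \<open>D j\<close> with \<open>diagonal i\<close>. By the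
  Jacobi identity, x_i then commutes with the commutator of \<open>D i\<close> and
  \<open>D j\<close>. Among the reflections in \<open>diagonal i\<close>, only those involving
  \<open>j\<close> fail to commute with \<open>D j\<close>.\<close>

lemma D_diagonal:
  assumes "i \<in> I" "j \<in> I" "i \<noteq> j"
  shows "diagonal i (D j f) + D i (mixed i j f) = D j (diagonal i f) + mixed i j (D i f)"
proof -
  have refl_D: "reflect i l \<tau> (D j f) = (if l = j then K \<tau> * D i (reflect i l \<tau> f) else D j (reflect i l \<tau> f))"
    if "l \<in> I" "\<tau> \<in> S" for l \<tau>
    using that assms by (subst reflect_D) (auto simp: sgn_at_def sw_def)
  have "(\<Sum>(l, \<tau>)\<in>roots i. K (mult i l) * reflect i l \<tau> (D j f))
      - (\<Sum>(l, \<tau>)\<in>roots i. K (mult i l) * D j (reflect i l \<tau> f))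
    = (\<Sum>(l, \<tau>)\<in>roots i. K (mult i l) * (reflect i l \<tau> (D j f) - D j (reflect i l \<tau> f)))"
    by (simp add: case_prod_unfold right_diff_distrib sum_subtractf)
  also have "\<dots> = (\<Sum>(l, \<tau>)\<in>{j} \<times> S. K c * (K \<tau> * D i (reflect i j \<tau> f) - D j (reflect i j \<tau> f)))"
    using assms
    by (intro sum.mono_neutral_cong_right) (auto simp: finite_roots refl_D mult_def mem_roots split: if_splits)
  also have "\<dots> = (\<Sum>\<tau>\<in>S. K c * (K \<tau> * D i (reflect i j \<tau> f) - D j (reflect i j \<tau> f)))"
    by (simp flip: sum.cartesian_product)
  also have "\<dots> = (\<Sum>\<tau>\<in>S. D i (K (c * \<tau>) * reflect i j \<tau> f) - K (c * \<tau>) * reflect i j \<tau> (D i f))"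
  proof (rule sum.cong[OF refl])
    fix \<tau> assume \<tau>: "\<tau> \<in> S"
    then have "reflect i j \<tau> (D i f) = K \<tau> * D j (reflect i j \<tau> f)"
      using assms by (simp add: reflect_D sgn_at_def sw_def)
    moreover have "K \<tau> * (K \<tau> * g) = g" for g
      using S_square[OF \<tau>] by (simp flip: mult.assoc K_mult)
    ultimately show "K c * (K \<tau> * D i (reflect i j \<tau> f) - D j (reflect i j \<tau> f))
      = D i (K (c * \<tau>) * reflect i j \<tau> f) - K (c * \<tau>) * reflect i j \<tau> (D i f)"
      by (simp add: D_K_mult K_mult right_diff_distrib mult.assoc)
  qed
  also have "\<dots> = D i (mixed i j f) - mixed i j (D i f)"
    using assms by (simp add: mixed_def D_sum sum_subtractf)
  finally show ?thesis
    by (simp add: diagonal_def D_diff D_sum D_K_mult case_prod_unfold algebra_simps)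
qed

text \<open>The commutator \<open>[D\<^sub>i, D\<^sub>j]\<close> commutes with multiplication by every variable and annihilates \<open>1\<close>.\<close>

lemma D_commute:
  assumes "i \<in> I" "j \<in> I"
  shows "D i (D j f) = D j (D i f)"
proof (cases "i = j")
  case False
  define comm where "comm f = D i (D j f) - D j (D i f)" for f
  \<comment> \<open>Stated for an arbitrary function \<open>comm\<close>, so that the case k = j
    follows by exchanging the roles of \<open>i\<close> and \<open>j\<close> and using the negated
    commutator.\<close>
  have pair: "comm (X i * f) = X i * comm f" if "i \<in> I" "j \<in> I" "i \<noteq> j" "\<And>f. comm f = D i (D j f) - D j (D i f)" for i j comm f
    using D_diagonal[OF that(1,2,3), of f] that(3) mixed_commute[OF that(1,2)]
    unfolding that(4) by (simp add: D_X_mult D_add right_diff_distrib diff_eq_eq add_diff_eq)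
  have X: "comm (X k * f) = X k * comm f" for k f
  proof -
    consider "k = i" | "k = j" | "k \<noteq> i" "k \<noteq> j" by blast
    then show ?thesis
    proof cases
      case 1
      then show ?thesis using pair[OF assms False comm_def] by simp
    next
      case 2
      have "- comm (X j * f) = X j * - comm f"
        by (rule pair[OF assms(2,1) False[symmetric]]) (simp add: comm_def)
      then show ?thesis by (simp add: 2)
    next
      case 3
      have "D i (mixed j k f) = mixed j k (D i f)" "D j (mixed i k f) = mixed i k (D j f)"
        using D_mixed[of j i k f] D_mixed[of i j k f] 3 assms False by auto
      then show ?thesis using 3 by (simp add: comm_def D_X_mult D_add right_diff_distrib)
    qed
  qed
  have "\<forall>g. comm (f * g) = f * comm g"
  proof (induction f rule: mpol_induct)
    case (const a)
    then show ?case by (simp add: comm_def D_K_mult right_diff_distrib)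
  next
    case (add p r)
    then show ?case by (simp add: comm_def D_add algebra_simps)
  qed (simp_all add: X mult.assoc)
  from this[rule_format, of 1] show ?thesis by (simp add: comm_def)
qed simp

end

section \<open>Commuting power sums\<close>

text \<open>An abstract setting: T_ij interchanges h_i and h_j, the commutator of h_i and h_j is
  (h_i - h_j) T_ij, and \<open>f\<close> is a common eigenvector of all T_ij. The eigenvalue
  \<kappa> is the same for all pairs, so it can be pulled out of sums over pairs.\<close>

context
  fixes h :: "nat \<Rightarrow> 'a::comm_ring_1 \<Rightarrow> 'a" and I :: "nat set" and T :: "nat \<Rightarrow> nat \<Rightarrow> 'a \<Rightarrow> 'a"
    and \<kappa> f :: 'a
  assumes fin: "finite I"
    and add: "\<And>i x y. h i (x + y) = h i x + h i y"
    and scale: "\<And>i x. h i (\<kappa> * x) = \<kappa> * h i x"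
    and comm: "\<And>i j x. i \<in> I \<Longrightarrow> j \<in> I \<Longrightarrow> i \<noteq> j \<Longrightarrow> h i (h j x) = h j (h i x) + h i (T i j x) - h j (T i j x)"
    and swap: "\<And>i j x. i \<in> I \<Longrightarrow> j \<in> I \<Longrightarrow> i \<noteq> j \<Longrightarrow> T i j (h i x) = h j (T i j x)"
      "\<And>i j x. i \<in> I \<Longrightarrow> j \<in> I \<Longrightarrow> i \<noteq> j \<Longrightarrow> T i j (h j x) = h i (T i j x)"
    and invariant: "\<And>i j. i \<in> I \<Longrightarrow> j \<in> I \<Longrightarrow> i \<noteq> j \<Longrightarrow> T i j f = \<kappa> * f"
begin

private lemma h_0: "h i 0 = 0"
  using add[of i 0 0] by simp

private lemma h_diff: "h i (x - y) = h i x - h i y"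
  using add[of i "x - y" y] by (simp add: eq_diff_eq)

private lemma h_sum: "h i (\<Sum>x\<in>A. g x) = (\<Sum>x\<in>A. h i (g x))"
  by (induction A rule: infinite_finite_induct) (simp_all add: h_0 add)

private lemma pow_sum: "(h i ^^ r) (\<Sum>x\<in>A. g x) = (\<Sum>x\<in>A. (h i ^^ r) (g x))"
  by (induction r) (simp_all add: h_sum)

private lemma pow_scale: "(h i ^^ r) (\<kappa> * x) = \<kappa> * (h i ^^ r) x"
  by (induction r) (simp_all add: scale)

text \<open>T_ij turns powers of h_i into powers of h_j, so the corrections from the successive
  exchanges telescope.\<close>

private lemma pow_comm:
  assumes "i \<in> I" "j \<in> I" "i \<noteq> j"
  shows "(h i ^^ r) (h j x) = h j ((h i ^^ r) x) + (h i ^^ r) (T i j x) - (h j ^^ r) (T i j x)"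
proof (induction r)
  case (Suc r)
  have "T i j ((h i ^^ r) x) = (h j ^^ r) (T i j x)"
    by (induction r) (simp_all add: swap assms)
  with Suc comm[OF assms, of "(h i ^^ r) x"] show ?case by (simp add: add h_diff)
qed simp

text \<open>On \<open>f\<close>, T_ij h_j^s becomes \<kappa> h_i^s, so no T_ij is left over, and
  every correction has total degree r + s - 1.\<close>

private lemma pow_comm_pow:
  assumes "i \<in> I" "j \<in> I" "i \<noteq> j"
  shows "(h i ^^ r) ((h j ^^ s) f) = (h j ^^ s) ((h i ^^ r) f)
    + \<kappa> * (\<Sum>b<s. (h j ^^ b) ((h i ^^ (r + (s - Suc b))) f) - (h j ^^ (b + r)) ((h i ^^ (s - Suc b)) f))"
proof (induction s)
  case (Suc s)
  have T: "T i j ((h j ^^ s) f) = \<kappa> * (h i ^^ s) f"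
    by (induction s) (simp_all add: swap assms invariant scale)
  have "(h i ^^ r) ((h j ^^ Suc s) f) = h j ((h i ^^ r) ((h j ^^ s) f))
      + \<kappa> * ((h i ^^ (r + s)) f - (h j ^^ r) ((h i ^^ s) f))"
    by (simp add: pow_comm[OF assms] T pow_scale funpow_add right_diff_distrib)
  then show ?case
    unfolding Suc by (subst sum.lessThan_Suc_shift) (simp add: add scale h_sum h_diff algebra_simps)
qed simp

definition off_diagonal :: "nat \<Rightarrow> nat \<Rightarrow> 'a" where
  "off_diagonal r s = (\<Sum>i\<in>I. \<Sum>j\<in>I - {i}. (h i ^^ r) ((h j ^^ s) f))"

private lemma swap_sum: "(\<Sum>i\<in>I. \<Sum>j\<in>I - {i}. (g i j :: 'a)) = (\<Sum>i\<in>I. \<Sum>j\<in>I - {i}. g j i)"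
  unfolding sum.Sigma[OF fin ballI[OF finite_Diff[OF fin]]]
  by (rule sum.reindex_bij_witness[where i = prod.swap and j = prod.swap]) auto

text \<open>
  Moving \<open>h\<^sub>i\<^sup>r\<close> past \<open>h\<^sub>j\<^sup>s\<close> produces off-diagonal sums of total degree \<open>r + s - 1\<close> only, and these
  cancel by induction on the total degree.
\<close>

private lemma off_diagonal_sym: "off_diagonal r s = off_diagonal s r"
proof (induction "r + s" arbitrary: r s rule: less_induct)
  case less
  let ?W = off_diagonal
  have "?W r s = (\<Sum>i\<in>I. \<Sum>j\<in>I - {i}. (h j ^^ s) ((h i ^^ r) f) + \<kappa> * (\<Sum>b<s.
      (h j ^^ b) ((h i ^^ (r + (s - Suc b))) f) - (h j ^^ (b + r)) ((h i ^^ (s - Suc b)) f)))"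
    unfolding off_diagonal_def by (intro sum.cong refl pow_comm_pow) auto
  also have "\<dots> = (\<Sum>i\<in>I. \<Sum>j\<in>I - {i}. (h i ^^ s) ((h j ^^ r) f) + \<kappa> * (\<Sum>b<s.
      (h i ^^ b) ((h j ^^ (r + (s - Suc b))) f) - (h i ^^ (b + r)) ((h j ^^ (s - Suc b)) f)))"
    by (rule swap_sum)
  also have "\<dots> = ?W s r + \<kappa> * (\<Sum>i\<in>I. \<Sum>j\<in>I - {i}. \<Sum>b<s.
      (h i ^^ b) ((h j ^^ (r + (s - Suc b))) f) - (h i ^^ (b + r)) ((h j ^^ (s - Suc b)) f))"
    by (simp add: sum.distrib sum_distrib_left off_diagonal_def)
  also have "(\<Sum>i\<in>I. \<Sum>j\<in>I - {i}. \<Sum>b<s.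
      (h i ^^ b) ((h j ^^ (r + (s - Suc b))) f) - (h i ^^ (b + r)) ((h j ^^ (s - Suc b)) f))
    = (\<Sum>b<s. ?W b (r + (s - Suc b)) - ?W (b + r) (s - Suc b))"
    unfolding off_diagonal_def sum_subtractf[symmetric] by (simp only: sum.swap[of _ "{..<s}"])
  also have "\<dots> = 0"
  proof -
    \<comment> \<open>Replacing b by s - 1 - b turns this sum into the other one with the arguments
      of \<open>?W\<close> exchanged; their total degree r + s - 1 admits the induction
      hypothesis.\<close>
    have "(\<Sum>b<s. ?W (b + r) (s - Suc b)) = (\<Sum>b<s. ?W (r + (s - Suc b)) b)"
      by (rule sum.reindex_bij_witness[where i = "\<lambda>b. s - Suc b" and j = "\<lambda>b. s - Suc b"])
         (auto simp: add.commute)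
    also have "\<dots> = (\<Sum>b<s. ?W b (r + (s - Suc b)))"
      by (intro sum.cong refl less) auto
    finally show ?thesis by (simp add: sum_subtractf)
  qed
  finally show ?case by simp
qed

text \<open>The terms with i = j are powers of exponent r + s and thus symmetric in r and s; the
  others form \<open>off_diagonal\<close>.\<close>

lemma power_sums_commute:
  "(\<Sum>i\<in>I. (h i ^^ r) (\<Sum>j\<in>I. (h j ^^ s) f)) = (\<Sum>i\<in>I. (h i ^^ s) (\<Sum>j\<in>I. (h j ^^ r) f))"
proof -
  have "(\<Sum>i\<in>I. (h i ^^ r) (\<Sum>j\<in>I. (h j ^^ s) f)) = off_diagonal r s + (\<Sum>i\<in>I. (h i ^^ (r + s)) f)" for r s
    unfolding off_diagonal_def pow_sum sum.distrib[symmetric]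
    by (intro sum.cong refl) (simp add: sum.remove[OF fin] funpow_add add.commute)
  then show ?thesis by (simp add: off_diagonal_sym[of r s] add.commute[of r s])
qed

end

section \<open>Dunkl operators with an oscillator term\<close>

locale dunkl_oscillator = dunkl +
  fixes \<omega> :: complex
begin

text \<open>For \<open>s = 1\<close> and \<open>s = -1\<close> these are the two ladder operators of
  the oscillator.\<close>

definition A :: "complex \<Rightarrow> nat \<Rightarrow> mpol \<Rightarrow> mpol" where
  "A s i f = D i f + K (s * \<omega>) * (X i * f)"

definition h :: "nat \<Rightarrow> mpol \<Rightarrow> mpol" where
  "h i f = A 1 i (A (-1) i f)"

text \<open>It differs from \<open>mixed\<close> by the missing sign \<tau>; this sum is the one
  that interchanges \<open>h i\<close> and \<open>h j\<close>.\<close>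

definition exchange :: "nat \<Rightarrow> nat \<Rightarrow> mpol \<Rightarrow> mpol" where
  "exchange i j f = (\<Sum>\<tau>\<in>S. K c * reflect i j \<tau> f)"

lemma A_add: "A s i (f + g) = A s i f + A s i g"
  by (simp add: A_def D_add algebra_simps)

lemma A_K_mult: "A s i (K a * f) = K a * A s i f"
  by (simp add: A_def D_K_mult distrib_left mult.left_commute)

lemma A_0: "A s i 0 = 0"
  by (simp add: A_def)

lemma A_sum: "A s i (\<Sum>x\<in>B. f x) = (\<Sum>x\<in>B. A s i (f x))"
  by (induction B rule: infinite_finite_induct) (simp_all add: A_add A_0)

lemma reflect_A:
  assumes "a \<in> I" "b \<in> I" "t \<in> S"
  shows "reflect a b t (A s i f) = K (sgn_at a b t i) * A s (sw a b i) (reflect a b t f)"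
  by (simp add: A_def reflect_D[OF assms] reflect_add reflect_mult reflect_X algebra_simps)

text \<open>Dunkl operators commute, variables commute, and the commutator of \<open>D i\<close>
  with x_j is symmetric in i and j. Only the difference of the two signs remains; factors of equal
  sign commute.\<close>

lemma A_A:
  assumes "i \<in> I" "j \<in> I" "i \<noteq> j"
  shows "A s i (A t j f) = A t j (A s i f) + K ((t - s) * \<omega>) * mixed i j f"
proof -
  have K: "K ((t - s) * \<omega>) = K (t * \<omega>) - K (s * \<omega>)"
    by (simp add: left_diff_distrib K.e_diff)
  have "A s i (A t j f) = D i (D j f) + K (t * \<omega>) * (X j * D i f + mixed i j f)
      + K (s * \<omega>) * (X i * (D j f + K (t * \<omega>) * (X j * f)))"
    and "A t j (A s i f) = D j (D i f) + K (s * \<omega>) * (X i * D j f + mixed i j f)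
      + K (t * \<omega>) * (X j * (D i f + K (s * \<omega>) * (X i * f)))"
    using assms(3) mixed_commute[OF assms(1,2)]
    by (simp_all add: A_def D_add D_K_mult D_X_mult[of i j] D_X_mult[of j i])
  then show ?thesis
    using D_commute[OF assms(1,2)] unfolding K by (simp add: algebra_simps)
qed

text \<open>The reflection turns A_j into \<tau> A_i, and this sign cancels the one in
  \<open>mixed\<close>.\<close>

lemma mixed_A:
  assumes "i \<in> I" "j \<in> I"
  shows "mixed i j (A s j f) = A s i (exchange i j f)"
proof -
  have "K (c * \<tau>) * reflect i j \<tau> (A s j f) = A s i (K c * reflect i j \<tau> f)" if "\<tau> \<in> S" for \<tau>
  proof -
    have "K (c * \<tau>) * reflect i j \<tau> (A s j f) = K (\<tau> * \<tau>) * (K c * A s i (reflect i j \<tau> f))"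
      using assms that by (simp add: reflect_A sgn_at_def sw_def K_mult mult_ac)
    then show ?thesis by (simp add: S_square that A_K_mult)
  qed
  then show ?thesis using assms by (simp add: mixed_def exchange_def A_sum)
qed

lemma reflect_h:
  assumes "a \<in> I" "b \<in> I" "t \<in> S"
  shows "reflect a b t (h i f) = h (sw a b i) (reflect a b t f)"
proof -
  have "K (sgn_at a b t i) * K (sgn_at a b t i) = 1"
    using K_sgn_at_square S_square assms by blast
  then show ?thesis
    by (simp add: h_def reflect_A[OF assms] A_K_mult flip: mult.assoc)
qed

lemma h_add: "h i (f + g) = h i f + h i g"
  by (simp add: h_def A_add)

lemma h_K_mult: "h i (K a * f) = K a * h i f"
  by (simp add: h_def A_K_mult)

lemma exchange_commute: "exchange i j f = exchange j i f"
  by (simp add: exchange_def reflect_commute[of i j])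

lemma exchange_h: 
  assumes "i \<in> I" "j \<in> I"
  shows "exchange i j (h i f) = h j (exchange i j f)"
proof -
  have h_sum: "h j (\<Sum>x\<in>B. g x) = (\<Sum>x\<in>B. h j (g x))" for g :: "complex \<Rightarrow> mpol" and B
    by (simp add: h_def A_sum)
  show ?thesis
    unfolding exchange_def h_sum h_K_mult
    by (intro sum.cong refl) (auto simp: reflect_h assms sw_def)
qed

lemma h_h:
  assumes "i \<in> I" "j \<in> I" "i \<noteq> j"
  shows "h i (h j f) = h j (h i f) + h i (K (2 * \<omega>) * exchange i j f) - h j (K (2 * \<omega>) * exchange i j f)"
proof -
  \<comment> \<open>Exchanging the two middle factors, whose signs differ by 2, produces the
    correction with 2 \<omega>. The remaining quartic term is symmetric in i and j because factors
    of equal sign commute.\<close>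
  have A: "h i (h j f) = A 1 i (A 1 j (A (-1) i (A (-1) j f))) + h i (K (2 * \<omega>) * exchange i j f)"
    if "i \<in> I" "j \<in> I" "i \<noteq> j" for i j
    using that by (simp add: h_def A_A[of i j _ 1] A_add A_K_mult mixed_A)
  have "A 1 i (A 1 j (A (-1) i (A (-1) j f))) = A 1 j (A 1 i (A (-1) j (A (-1) i f)))"
    using A_A[OF assms, of 1 1] A_A[OF assms, of "-1" "-1"] by simp
  then show ?thesis
    using A[OF assms] A[OF assms(2,1)] assms(3) by (simp add: exchange_commute[of j i])
qed

section \<open>Invariant polynomials and the commuting integrals\<close>

definition invariant :: "mpol \<Rightarrow> bool" where
  "invariant f \<longleftrightarrow> (\<forall>a\<in>I. \<forall>b\<in>I. \<forall>t\<in>S. reflect a b t f = f)"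

definition integral :: "nat \<Rightarrow> mpol \<Rightarrow> mpol" where
  "integral r f = (\<Sum>i\<in>I. (h i ^^ r) f)"

lemma integral_commute:
  assumes "invariant f"
  shows "integral r (integral s f) = integral s (integral r f)"
  unfolding integral_def
\<comment> \<open>All \<open>card S\<close> reflections in \<open>exchange\<close> fix the invariant
  \<open>f\<close>; hence the eigenvalue.\<close>
proof (rule power_sums_commute[where T = "\<lambda>i j f. K (2 * \<omega>) * exchange i j f"
      and \<kappa> = "K (2 * \<omega>) * (of_nat (card S) * K c)"])
  fix i j x assume "i \<in> I" "j \<in> I" "i \<noteq> j"
  show "K (2 * \<omega>) * exchange i j (h i x) = h j (K (2 * \<omega>) * exchange i j x)"
    and "K (2 * \<omega>) * exchange i j (h j x) = h i (K (2 * \<omega>) * exchange i j x)"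
    using exchange_h[of i j x] exchange_h[of j i x] \<open>i \<in> I\<close> \<open>j \<in> I\<close>
    by (simp_all add: h_K_mult exchange_commute[of j i])
next
  fix i j assume "i \<in> I" "j \<in> I"
  then have "(\<Sum>\<tau>\<in>S. K c * reflect i j \<tau> f) = (\<Sum>\<tau>\<in>S. K c * f)"
    using assms by (intro sum.cong) (auto simp: invariant_def)
  then show "K (2 * \<omega>) * exchange i j f = K (2 * \<omega>) * (of_nat (card S) * K c) * f"
    by (simp add: exchange_def)
next
  fix i x
  have "K (2 * \<omega>) * (of_nat (card S) * K c) = K (2 * \<omega> * (of_nat (card S) * c))"
    by (simp only: K_mult K_of_nat)
  then show "h i (K (2 * \<omega>) * (of_nat (card S) * K c) * x) = K (2 * \<omega>) * (of_nat (card S) * K c) * h i x"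
    by (simp only: h_K_mult)
qed (simp_all add: finite_I h_add, fact h_h)

lemma invariant_integral:
  assumes "invariant f"
  shows "invariant (integral r f)"
  unfolding invariant_def
proof (intro ballI)
  fix a b t assume *: "a \<in> I" "b \<in> I" "t \<in> S"
  have "reflect a b t ((h i ^^ r) f) = (h (sw a b i) ^^ r) f" for i
    using assms * by (induction r) (simp_all add: reflect_h invariant_def)
  then have "reflect a b t (integral r f) = (\<Sum>i\<in>I. (h (sw a b i) ^^ r) f)"
    by (simp add: integral_def reflect_sum)
  also have "\<dots> = integral r f"
    unfolding integral_def
    by (rule sum.reindex_bij_witness[where i = "sw a b" and j = "sw a b"])
       (use * in \<open>auto simp: sw_def\<close>)
  finally show "reflect a b t (integral r f) = integral r f" .
qed

text \<open>Even exponents absorb the signs, so the same invariants serve both types.\<close>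

lemma invariant_power_sum: "invariant (\<Sum>i\<in>I. X i ^ (2 * r))"
  unfolding invariant_def
proof (intro ballI)
  fix a b t assume *: "a \<in> I" "b \<in> I" "t \<in> S"
  have "reflect a b t (X i ^ (2 * r)) = X (sw a b i) ^ (2 * r)" for i
  proof -
    have "K (sgn_at a b t i) ^ (2 * r) = 1"
      using K_sgn_at_square[OF S_square[OF *(3)]] by (simp add: power_mult power2_eq_square)
    then show ?thesis by (simp add: reflect_power reflect_X power_mult_distrib)
  qed
  then have "reflect a b t (\<Sum>i\<in>I. X i ^ (2 * r)) = (\<Sum>i\<in>I. X (sw a b i) ^ (2 * r))"
    by (simp add: reflect_sum)
  also have "\<dots> = (\<Sum>i\<in>I. X i ^ (2 * r))"
    by (rule sum.reindex_bij_witness[where i = "sw a b" and j = "sw a b"])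
       (use * in \<open>auto simp: sw_def\<close>)
  finally show "reflect a b t (\<Sum>i\<in>I. X i ^ (2 * r)) = (\<Sum>i\<in>I. X i ^ (2 * r))" .
qed

lemma invariant_mult: "invariant f \<Longrightarrow> invariant g \<Longrightarrow> invariant (f * g)"
  by (simp add: invariant_def reflect_mult)

lemma invariant_1: "invariant 1"
  by (simp add: invariant_def)

end

section \<open>The field of rational functions in finitely many variables\<close>

lemma indets_add: "indets (p + q) \<subseteq> indets p \<union> indets q"
  using Poly_Mapping.keys_add[of p q] by (auto simp: indets_def)

lemma indets_mult: "indets (p * q) \<subseteq> indets p \<union> indets q"
proof
  fix i assume "i \<in> indets (p * q)"
  then obtain \<gamma> where "\<gamma> \<in> Poly_Mapping.keys (p * q)" and i: "i \<in> Poly_Mapping.keys \<gamma>"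
    by (auto simp: indets_def)
  then obtain \<alpha> \<beta> where "\<alpha> \<in> Poly_Mapping.keys p" "\<beta> \<in> Poly_Mapping.keys q" "\<gamma> = \<alpha> + \<beta>"
    using Poly_Mapping.keys_mult[of p q] by blast
  with i Poly_Mapping.keys_add[of \<alpha> \<beta>] show "i \<in> indets p \<union> indets q"
    by (auto simp: indets_def)
qed

lemma indets_minus: "indets (- p) = indets p"
  by (simp add: indets_def)

lemma indets_0 [simp]: "indets 0 = {}"
  by (simp add: indets_def)

lemma indets_K [simp]: "indets (K c) = {}"
  by (cases "c = 0") (simp_all add: K_def indets_single)

lemma indets_1 [simp]: "indets 1 = {}"
  using indets_K[of 1] by simp

lemma indets_X [simp]: "indets (X i) = {i}"
  by (simp add: X_def indets_single)

lemma indets_mderiv: "indets (mderiv i p) \<subseteq> indets p"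
proof -
  have "indets r \<subseteq> S \<and> indets (mderiv i r) \<subseteq> S" if "indets r \<subseteq> S" for r S
    using that
  proof (induction r rule: mpol_induct_indets)
    case (add r s)
    then show ?case using indets_add[of r s] indets_add[of "mderiv i r" "mderiv i s"]
      by (auto simp: mderiv_add)
  next
    case (mult r s)
    then show ?case
      using indets_mult[of r s] indets_mult[of "mderiv i r" s] indets_mult[of r "mderiv i s"]
        indets_add[of "mderiv i r * s" "r * mderiv i s"]
      unfolding mderiv_mult by blast
  qed (auto simp: mderiv_X)
  from this[of p "indets p"] show ?thesis by simp
qed

lemma partial_0 [simp]: "partial i 0 = 0"
  using partial_Cst[of i 0] by simp

lemma partial_1 [simp]: "partial i 1 = 0"
  using partial_Cst[of i 1] by simp

lemma partial_minus: "partial i (- f) = - partial i f"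
  using partial_add[of i f "- f"] by (simp add: add_eq_0_iff)

lemma partial_diff: "partial i (f - g) = partial i f - partial i g"
  using partial_add[of i f "- g"] by (simp add: partial_minus)

lemma partial_sum: "partial i (\<Sum>x\<in>A. f x) = (\<Sum>x\<in>A. partial i (f x))"
  by (induction A rule: infinite_finite_induct) (simp_all add: partial_add)

lemma partial_Cst_mult: "partial i (Cst c * f) = Cst c * partial i f"
  by (simp add: partial_mult partial_Cst)

text \<open>The Leibniz rule is assumed on \<open>F\<close> alone because the derivations obtained
  later from brackets are only known to obey it on \<open>ratfuns M\<close>.\<close>

lemma derivation_power:
  fixes \<delta> :: "'a::comm_ring_1 \<Rightarrow> 'a"
  assumes "\<And>n. f ^ n \<in> F" and "\<And>f g. f \<in> F \<Longrightarrow> g \<in> F \<Longrightarrow> \<delta> (f * g) = \<delta> f * g + f * \<delta> g"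
  shows "\<delta> (f ^ Suc n) = of_nat (Suc n) * f ^ n * \<delta> f"
proof (induction n)
  case (Suc n)
  have "\<delta> (f ^ Suc (Suc n)) = \<delta> f * f ^ Suc n + f * \<delta> (f ^ Suc n)"
    using assms(2)[of "f ^ 1" "f ^ Suc n"] assms(1)[of "Suc 0"] assms(1)[of "Suc n"] by simp
  then show ?case unfolding Suc by (simp add: algebra_simps)
qed simp

context
  fixes M :: nat
begin

lemma ratfuns_Fract: "indets p \<subseteq> {1..M} \<Longrightarrow> indets q \<subseteq> {1..M} \<Longrightarrow> q \<noteq> 0 \<Longrightarrow> Fract p q \<in> ratfuns M"
  unfolding ratfuns_def by blast

lemma ratfuns_cases:
  assumes "f \<in> ratfuns M"
  obtains p q where "f = Fract p q" "q \<noteq> 0" "indets p \<subseteq> {1..M}" "indets q \<subseteq> {1..M}"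
  using assms unfolding ratfuns_def by blast

lemma ratfuns_Cst [simp, intro]: "Cst c \<in> ratfuns M"
  unfolding Cst_def K_def[symmetric] by (rule ratfuns_Fract) auto

lemma ratfuns_0 [simp, intro]: "0 \<in> ratfuns M" and ratfuns_1 [simp, intro]: "1 \<in> ratfuns M"
  and ratfuns_of_nat [simp, intro]: "of_nat n \<in> ratfuns M"
  using ratfuns_Cst[of 0] ratfuns_Cst[of 1] ratfuns_Cst[of "of_nat n"] by (simp_all add: Cst_of_nat)

lemma ratfuns_Y [simp, intro]: "i \<in> {1..M} \<Longrightarrow> Y i \<in> ratfuns M"
  unfolding Y_eq_X by (rule ratfuns_Fract) auto

lemma ratfuns_add [intro]:
  assumes "f \<in> ratfuns M" "g \<in> ratfuns M"
  shows "f + g \<in> ratfuns M"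
proof -
  from assms obtain p q r s where *: "f = Fract p q" "q \<noteq> 0" "indets p \<subseteq> {1..M}" "indets q \<subseteq> {1..M}"
    "g = Fract r s" "s \<noteq> 0" "indets r \<subseteq> {1..M}" "indets s \<subseteq> {1..M}"
    by (elim ratfuns_cases)
  then have "f + g = Fract (p * s + r * q) (q * s)" by simp
  moreover have "indets (p * s + r * q) \<subseteq> {1..M}" "indets (q * s) \<subseteq> {1..M}"
    using * indets_add[of "p * s" "r * q"] indets_mult[of p s] indets_mult[of r q] indets_mult[of q s]
    by blast+
  ultimately show ?thesis using * ratfuns_Fract[of "p * s + r * q" "q * s"] by simp
qed

lemma ratfuns_mult [intro]:
  assumes "f \<in> ratfuns M" "g \<in> ratfuns M"
  shows "f * g \<in> ratfuns M"
proof -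
  from assms obtain p q r s where *: "f = Fract p q" "q \<noteq> 0" "indets p \<subseteq> {1..M}" "indets q \<subseteq> {1..M}"
    "g = Fract r s" "s \<noteq> 0" "indets r \<subseteq> {1..M}" "indets s \<subseteq> {1..M}"
    by (elim ratfuns_cases)
  then have "f * g = Fract (p * r) (q * s)" by simp
  moreover have "indets (p * r) \<subseteq> {1..M}" "indets (q * s) \<subseteq> {1..M}"
    using * indets_mult[of p r] indets_mult[of q s] by blast+
  ultimately show ?thesis using * ratfuns_Fract[of "p * r" "q * s"] by simp
qed

lemma ratfuns_minus [intro]: "f \<in> ratfuns M \<Longrightarrow> - f \<in> ratfuns M"
  using ratfuns_mult[OF ratfuns_Cst[of "- 1"], of f] by (simp add: Cst_minus)

lemma ratfuns_diff [intro]: "f \<in> ratfuns M \<Longrightarrow> g \<in> ratfuns M \<Longrightarrow> f - g \<in> ratfuns M"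
  using ratfuns_add[of f "- g"] ratfuns_minus[of g] by simp

lemma ratfuns_inverse [intro]:
  assumes "f \<in> ratfuns M"
  shows "inverse f \<in> ratfuns M"
proof (cases "f = 0")
  case False
  from assms obtain p q where *: "f = Fract p q" "q \<noteq> 0" "indets p \<subseteq> {1..M}" "indets q \<subseteq> {1..M}"
    by (elim ratfuns_cases)
  with False have "p \<noteq> 0" by (auto simp: Zero_fract_def eq_fract)
  then show ?thesis using * ratfuns_Fract[of q p] by simp
qed simp

lemma ratfuns_divide [intro]: "f \<in> ratfuns M \<Longrightarrow> g \<in> ratfuns M \<Longrightarrow> f / g \<in> ratfuns M"
  using ratfuns_mult[of f "inverse g"] ratfuns_inverse[of g] by (simp add: divide_inverse)

lemma ratfuns_sum [intro]: "(\<And>x. x \<in> A \<Longrightarrow> f x \<in> ratfuns M) \<Longrightarrow> (\<Sum>x\<in>A. f x) \<in> ratfuns M"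
  by (induction A rule: infinite_finite_induct) auto

lemma ratfuns_power [intro]: "f \<in> ratfuns M \<Longrightarrow> f ^ n \<in> ratfuns M"
  by (induction n) auto

lemma ratfuns_partial [intro]:
  assumes "f \<in> ratfuns M"
  shows "partial i f \<in> ratfuns M"
proof -
  from assms obtain p q where *: "f = Fract p q" "q \<noteq> 0" "indets p \<subseteq> {1..M}" "indets q \<subseteq> {1..M}"
    by (elim ratfuns_cases)
  have "indets (mderiv i p * q - p * mderiv i q) \<subseteq> {1..M}"
    using indets_add[of "mderiv i p * q" "- (p * mderiv i q)"] indets_minus[of "p * mderiv i q"]
      indets_mult[of "mderiv i p" q] indets_mult[of p "mderiv i q"] indets_mderiv[of i p] indets_mderiv[of i q] *
    by (simp, blast)
  moreover have "indets (q * q) \<subseteq> {1..M}" using indets_mult[of q q] * by blast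
  ultimately show ?thesis using * ratfuns_Fract[of "mderiv i p * q - p * mderiv i q" "q * q"]
    by (simp add: partial_Fract)
qed

text \<open>Polynomials are handled by induction; for a fraction f = p/q, apply \<delta> to f q =
  p.\<close>

lemma derivation_ratfuns_eq_0:
  fixes \<delta> :: "ratfun \<Rightarrow> ratfun"
  assumes add: "\<And>f g. f \<in> ratfuns M \<Longrightarrow> g \<in> ratfuns M \<Longrightarrow> \<delta> (f + g) = \<delta> f + \<delta> g"
    and mult: "\<And>f g. f \<in> ratfuns M \<Longrightarrow> g \<in> ratfuns M \<Longrightarrow> \<delta> (f * g) = \<delta> f * g + f * \<delta> g"
    and const: "\<And>c. \<delta> (Cst c) = 0" and var: "\<And>i. i \<in> {1..M} \<Longrightarrow> \<delta> (Y i) = 0"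
    and f: "f \<in> ratfuns M"
  shows "\<delta> f = 0"
proof -
  have poly: "indets p \<subseteq> {1..M} \<Longrightarrow> Fract p 1 \<in> ratfuns M \<and> \<delta> (Fract p 1) = 0" for p
  proof (induction p rule: mpol_induct_indets)
    case (const c)
    show ?case using assms(3)[of c] ratfuns_Cst[of c] by (simp add: Cst_def K_def)
  next
    case (var i)
    then show ?case using assms(4)[of i] ratfuns_Y[of i] by (simp add: Y_eq_X)
  next
    case (add p q)
    have "Fract (p + q) 1 = Fract p 1 + Fract q 1" by simp
    then show ?case using add assms(1)[of "Fract p 1" "Fract q 1"] by (simp only: ratfuns_add) simp
  next
    case (mult p q)
    have "Fract (p * q) 1 = Fract p 1 * Fract q 1" by simp
    then show ?case using mult assms(2)[of "Fract p 1" "Fract q 1"] by (simp only: ratfuns_mult) simp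
  qed
  from f obtain p q where *: "f = Fract p q" "q \<noteq> 0" "indets p \<subseteq> {1..M}" "indets q \<subseteq> {1..M}"
    by (elim ratfuns_cases)
  then have "f * Fract q 1 = Fract p 1" by (simp add: eq_fract)
  then have "\<delta> f * Fract q 1 = 0"
    using mult[OF f, of "Fract q 1"] poly[of p] poly[of q] * by simp
  moreover have "Fract q 1 \<noteq> 0" using * by (simp add: Zero_fract_def eq_fract)
  ultimately show ?thesis by simp
qed

section \<open>Linear operators and their order\<close>

text \<open>Operators are only considered on \<open>ratfuns M\<close>; \<open>order_less d C\<close> is Grothendieck's notion of order.\<close>

definition linear_op :: "(ratfun \<Rightarrow> ratfun) \<Rightarrow> bool" where
  "linear_op C \<longleftrightarrow> (\<forall>f\<in>ratfuns M. C f \<in> ratfuns M) \<and>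
     (\<forall>f\<in>ratfuns M. \<forall>g\<in>ratfuns M. C (f + g) = C f + C g) \<and>
     (\<forall>f\<in>ratfuns M. \<forall>c. C (Cst c * f) = Cst c * C f)"

definition bracket :: "(ratfun \<Rightarrow> ratfun) \<Rightarrow> ratfun \<Rightarrow> ratfun \<Rightarrow> ratfun" where
  "bracket C g f = C (g * f) - g * C f"

fun order_less :: "nat \<Rightarrow> (ratfun \<Rightarrow> ratfun) \<Rightarrow> bool" where
  "order_less 0 C \<longleftrightarrow> (\<forall>f\<in>ratfuns M. C f = 0)"
| "order_less (Suc d) C \<longleftrightarrow> (\<forall>g\<in>ratfuns M. order_less d (bracket C g))"

lemma linear_opD:
  assumes "linear_op C"
  shows "f \<in> ratfuns M \<Longrightarrow> C f \<in> ratfuns M"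
    and "f \<in> ratfuns M \<Longrightarrow> g \<in> ratfuns M \<Longrightarrow> C (f + g) = C f + C g"
    and "f \<in> ratfuns M \<Longrightarrow> C (Cst c * f) = Cst c * C f"
  using assms by (auto simp: linear_op_def)

lemma linear_op_0: "linear_op C \<Longrightarrow> C 0 = 0"
  using linear_opD(3)[of C 0 0] by simp

lemma linear_op_diff:
  assumes "linear_op C" "f \<in> ratfuns M" "g \<in> ratfuns M"
  shows "C (f - g) = C f - C g"
  using linear_opD(2)[OF assms(1), of "f - g" g] ratfuns_diff assms by (simp add: eq_diff_eq)

lemma linear_op_bracket:
  assumes C: "linear_op C" and g: "g \<in> ratfuns M"
  shows "linear_op (bracket C g)"
  unfolding linear_op_def
proof (intro conjI ballI allI)
  fix f c assume f: "f \<in> ratfuns M"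
  show "bracket C g f \<in> ratfuns M"
    using f g by (auto simp: bracket_def intro!: linear_opD[OF C])
  show "bracket C g (Cst c * f) = Cst c * bracket C g f"
    using f g linear_opD(3)[OF C, of "g * f" c] linear_opD(3)[OF C, of f c]
    by (simp add: bracket_def ratfuns_mult right_diff_distrib mult.left_commute)
next
  fix f f' assume "f \<in> ratfuns M" "f' \<in> ratfuns M"
  then show "bracket C g (f + f') = bracket C g f + bracket C g f'"
    using g by (simp add: bracket_def ratfuns_mult linear_opD(2)[OF C] distrib_left)
qed

lemma order_less_cong:
  "(\<And>f. f \<in> ratfuns M \<Longrightarrow> C f = C' f) \<Longrightarrow> order_less d C \<longleftrightarrow> order_less d C'"
proof (induction d arbitrary: C C')
  case (Suc d)
  then have "order_less d (bracket C g) \<longleftrightarrow> order_less d (bracket C' g)" if "g \<in> ratfuns M" for g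
    using that by (intro Suc.IH) (simp add: bracket_def ratfuns_mult Suc.prems)
  then show ?case by simp
qed simp

lemma order_less_zero: "(\<And>f. f \<in> ratfuns M \<Longrightarrow> C f = 0) \<Longrightarrow> order_less d C"
proof (induction d arbitrary: C)
  case (Suc d)
  then show ?case by (auto simp: bracket_def ratfuns_mult intro!: Suc.IH)
qed simp

lemma order_less_mono: "order_less d C \<Longrightarrow> d \<le> e \<Longrightarrow> order_less e C"
proof (induction d arbitrary: C e)
  case 0
  then show ?case by (auto intro: order_less_zero)
next
  case (Suc d)
  then show ?case by (cases e) auto
qed

lemma order_less_add: "order_less d C \<Longrightarrow> order_less d C' \<Longrightarrow> order_less d (\<lambda>f. C f + C' f)"
proof (induction d arbitrary: C C')
  case (Suc d)
  have "bracket (\<lambda>f. C f + C' f) g = (\<lambda>f. bracket C g f + bracket C' g f)" for g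
    by (auto simp: bracket_def algebra_simps)
  with Suc show ?case by simp
qed simp

lemma bracket_comp:
  assumes "linear_op C" "linear_op C'" "f \<in> ratfuns M" "g \<in> ratfuns M"
  shows "bracket (\<lambda>f. C (C' f)) g f = bracket C g (C' f) + C (bracket C' g f)"
  using assms by (simp add: bracket_def linear_op_diff linear_opD ratfuns_mult)

text \<open>The bracket with \<open>g\<close> obeys a Leibniz rule for composition, and each of its
  two terms lowers \<open>d + e\<close> by one. The bound is not sharp; finiteness of the order is
  the point.\<close>

lemma order_less_comp:
  "linear_op C \<Longrightarrow> linear_op C' \<Longrightarrow> order_less d C \<Longrightarrow> order_less e C' \<Longrightarrow> order_less (d + e) (\<lambda>f. C (C' f))"
proof (induction "d + e" arbitrary: C C' d e rule: less_induct)
  case less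
  note linear = less.prems(1,2)
  show ?case
  proof (cases "d = 0 \<or> e = 0")
    case True
    with less.prems show ?thesis
      by (auto intro!: order_less_zero simp: linear_opD linear_op_0)
  next
    case False
    then obtain d' e' where d: "d = Suc d'" and e: "e = Suc e'" by (metis not0_implies_Suc)
    have "order_less (d' + e) (bracket (\<lambda>f. C (C' f)) g)" if g: "g \<in> ratfuns M" for g
    proof -
      have "order_less (d' + e) (\<lambda>f. bracket C g (C' f))" "order_less (d + e') (\<lambda>f. C (bracket C' g f))"
        using less.hyps[OF _ linear_op_bracket[OF linear(1) g] linear(2), of d' e]
          less.hyps[OF _ linear(1) linear_op_bracket[OF linear(2) g], of d e'] less.prems(3,4) g d e
        by simp_all
      then have "order_less (d' + e) (\<lambda>f. bracket C g (C' f) + C (bracket C' g f))"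
        using d e order_less_add[of "d' + e"] by (simp del: order_less.simps)
      then show ?thesis
        by (rule order_less_cong[THEN iffD1, rotated]) (simp add: bracket_comp linear g)
    qed
    then show ?thesis by (simp add: d)
  qed
qed

definition finite_order :: "(ratfun \<Rightarrow> ratfun) \<Rightarrow> bool" where
  "finite_order C \<longleftrightarrow> linear_op C \<and> (\<exists>d. order_less d C)"

lemma finite_order_add: "finite_order C \<Longrightarrow> finite_order C' \<Longrightarrow> finite_order (\<lambda>f. C f + C' f)"
  unfolding finite_order_def
proof (elim conjE exE, intro conjI exI)
  fix d e assume "order_less d C" "order_less e C'"
  then show "order_less (max d e) (\<lambda>f. C f + C' f)"
    by (intro order_less_add) (auto elim: order_less_mono)
qed (auto simp: linear_op_def algebra_simps)

lemma linear_op_comp: "linear_op C \<Longrightarrow> linear_op C' \<Longrightarrow> linear_op (\<lambda>f. C (C' f))"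
  by (simp add: linear_op_def)

lemma finite_order_comp: "finite_order C \<Longrightarrow> finite_order C' \<Longrightarrow> finite_order (\<lambda>f. C (C' f))"
  unfolding finite_order_def using order_less_comp linear_op_comp by blast

lemma linear_op_mult: "w \<in> ratfuns M \<Longrightarrow> linear_op ((*) w)"
  by (auto simp: linear_op_def algebra_simps)

lemma finite_order_mult: "w \<in> ratfuns M \<Longrightarrow> finite_order ((*) w)"
  by (auto simp: finite_order_def linear_op_mult bracket_def intro!: exI[of _ "Suc 0"])

lemma linear_op_partial: "linear_op (partial i)"
  by (auto simp: linear_op_def partial_add partial_Cst_mult)

lemma finite_order_partial: "finite_order (partial i)"
proof -
  have "order_less (Suc (Suc 0)) (partial i)"
    by (auto simp: bracket_def partial_mult algebra_simps)
  then show ?thesis using linear_op_partial unfolding finite_order_def by blast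
qed

end

section \<open>Weighted power sums\<close>

text \<open>Lagrange interpolation: a polynomial vanishing at all nodes but that of \<open>b\<close>
  has degree below \<open>card A\<close>, so the hypothesis extends to it and leaves only the term
  of \<open>b\<close>.\<close>

lemma vandermonde_eq_0:
  fixes x w :: "'b \<Rightarrow> 'a::field"
  assumes "finite A" "inj_on x A" and zero: "\<And>r. r < card A \<Longrightarrow> (\<Sum>a\<in>A. w a * x a ^ r) = 0" and "b \<in> A"
  shows "w b = 0"
proof -
  define p where "p = (\<Prod>a\<in>A - {b}. [:- x a, 1:])"
  have "degree p = card (A - {b})"
    unfolding p_def by (subst degree_prod_eq_sum_degree) auto
  then have deg: "degree p < card A"
    using assms by (simp add: card_gt_0_iff) (metis card_gt_0_iff empty_iff diff_Suc_less)
  have "(\<Sum>a\<in>A. w a * poly p (x a)) = (\<Sum>a\<in>A. \<Sum>i\<le>degree p. coeff p i * (w a * x a ^ i))"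
    by (simp add: poly_altdef sum_distrib_left mult_ac)
  also have "\<dots> = (\<Sum>i\<le>degree p. coeff p i * (\<Sum>a\<in>A. w a * x a ^ i))"
    by (subst sum.swap) (simp add: sum_distrib_left)
  also have "\<dots> = 0"
    using deg zero by (intro sum.neutral) auto
  finally have "0 = (\<Sum>a\<in>A. w a * poly p (x a))" ..
  also have "\<dots> = w b * poly p (x b)"
  proof -
    have "poly p (x a) = 0" if "a \<in> A - {b}" for a
      using that \<open>finite A\<close> unfolding p_def poly_prod by (intro prod_zero) auto
    then show ?thesis using assms(1) \<open>b \<in> A\<close> by (simp add: sum.remove[of A b])
  qed
  finally have "w b * poly p (x b) = 0" ..
  moreover have "poly p (x b) \<noteq> 0"
    using assms(1,2,4) by (auto simp: p_def poly_prod inj_on_def)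
  ultimately show ?thesis by simp
qed

locale scaled_variables =
  fixes M :: nat and \<mu> :: "nat \<Rightarrow> nat" and s :: "nat \<Rightarrow> complex"
  assumes \<mu>_pos: "a \<in> {1..M} \<Longrightarrow> \<mu> a > 0" and s_nonzero: "a \<in> {1..M} \<Longrightarrow> s a \<noteq> 0"
begin

definition u :: "nat \<Rightarrow> ratfun" where
  "u a = Cst (s a) * Y a"

text \<open>The deformed Newton sums: an ordinary power sum with even exponent in which \<mu>_a of
  the variables are set equal to u_a.\<close>

definition psum :: "nat \<Rightarrow> ratfun" where
  "psum r = (\<Sum>a=1..M. of_nat (\<mu> a) * u a ^ (2 * r))"

lemma Y_nonzero [simp]: "Y a \<noteq> 0"
  using partial_Y[of a a] by auto

lemma u_nonzero: "a \<in> {1..M} \<Longrightarrow> u a \<noteq> 0"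
  by (simp add: u_def s_nonzero)

lemma partial_u: "partial i (u a) = (if i = a then Cst (s a) else 0)"
  by (simp add: u_def partial_Cst_mult partial_Y)

lemma u_in_ratfuns: "a \<in> {1..M} \<Longrightarrow> u a \<in> ratfuns M"
  by (auto simp: u_def)

text \<open>If u_a^2 = u_b^2 with a \<noteq> b, differentiation by y_a gives 2 s_a u_a = 0.\<close>

lemma u_square_inj: "inj_on (\<lambda>a. u a ^ 2) {1..M}"
proof (rule inj_onI, rule ccontr)
  fix a b assume *: "a \<in> {1..M}" "b \<in> {1..M}" "u a ^ 2 = u b ^ 2" "a \<noteq> b"
  have "partial a (u a * u a) = 2 * Cst (s a) * u a"
    by (simp add: partial_mult partial_u)
  moreover have "partial a (u b * u b) = 0"
    using * by (simp add: partial_mult partial_u)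
  moreover have "(2::ratfun) \<noteq> 0"
    using of_nat_ratfun_eq_0_iff[of 2] by simp
  ultimately show False using * by (simp add: power2_eq_square s_nonzero u_nonzero)
qed

lemma psum_in_ratfuns: "psum r \<in> ratfuns M"
  unfolding psum_def by (intro ratfuns_sum ratfuns_mult ratfuns_power u_in_ratfuns) auto

text \<open>Arranged as a Vandermonde system with nodes u_a^2 and unknowns \<mu>_a u_a
  \<delta>(u_a).\<close>

lemma derivation_psum:
  assumes add: "\<And>f g. f \<in> ratfuns M \<Longrightarrow> g \<in> ratfuns M \<Longrightarrow> \<delta> (f + g) = \<delta> f + \<delta> g"
    and mult: "\<And>f g. f \<in> ratfuns M \<Longrightarrow> g \<in> ratfuns M \<Longrightarrow> \<delta> (f * g) = \<delta> f * g + f * \<delta> g"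
    and const: "\<And>c. \<delta> (Cst c) = 0"
  shows "\<delta> (psum (Suc r)) = of_nat (2 * Suc r) * (\<Sum>a=1..M. of_nat (\<mu> a) * u a * \<delta> (u a) * (u a ^ 2) ^ r)"
proof -
  have 0: "\<delta> 0 = 0" using const[of 0] by simp
  have sum: "\<delta> (\<Sum>a\<in>A. f a) = (\<Sum>a\<in>A. \<delta> (f a))" if "\<And>a. a \<in> A \<Longrightarrow> f a \<in> ratfuns M" for A and f :: "nat \<Rightarrow> ratfun"
    using that by (induction A rule: infinite_finite_induct) (auto simp: 0 add ratfuns_sum)
  have "\<delta> (of_nat (\<mu> a) * u a ^ (2 * Suc r)) = of_nat (2 * Suc r) * (of_nat (\<mu> a) * u a * \<delta> (u a) * (u a ^ 2) ^ r)"
    if a: "a \<in> {1..M}" for a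
  proof -
    have "\<delta> (of_nat (\<mu> a) * u a ^ Suc (Suc (2 * r))) = of_nat (\<mu> a) * \<delta> (u a ^ Suc (Suc (2 * r)))"
      using mult[of "of_nat (\<mu> a)" "u a ^ Suc (Suc (2 * r))"] const[of "of_nat (\<mu> a)"] u_in_ratfuns[OF a]
      by (simp add: Cst_of_nat ratfuns_power del: power_Suc)
    also have "\<delta> (u a ^ Suc (Suc (2 * r))) = of_nat (Suc (Suc (2 * r))) * u a ^ Suc (2 * r) * \<delta> (u a)"
      by (rule derivation_power[where F = "ratfuns M"]) (auto intro: mult u_in_ratfuns[OF a])
    finally show ?thesis by (simp add: power_mult[symmetric] mult_ac)
  qed
  then show ?thesis
    unfolding psum_def sum_distrib_left
    by (subst sum) (auto intro!: ratfuns_mult ratfuns_power u_in_ratfuns sum.cong)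
qed

text \<open>The first \<open>M\<close> power sums form a Vandermonde system with distinct nodes, so
  \<delta> kills each u_a and with it each variable.\<close>

lemma derivation_eq_0_if_psum:
  assumes add: "\<And>f g. f \<in> ratfuns M \<Longrightarrow> g \<in> ratfuns M \<Longrightarrow> \<delta> (f + g) = \<delta> f + \<delta> g"
    and mult: "\<And>f g. f \<in> ratfuns M \<Longrightarrow> g \<in> ratfuns M \<Longrightarrow> \<delta> (f * g) = \<delta> f * g + f * \<delta> g"
    and const: "\<And>c. \<delta> (Cst c) = 0" and psum: "\<And>r. r > 0 \<Longrightarrow> \<delta> (psum r) = 0"
    and f: "f \<in> ratfuns M"
  shows "\<delta> f = 0"
proof (rule derivation_ratfuns_eq_0[OF add mult const _ f])
  fix a assume a: "a \<in> {1..M}"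
  have "of_nat (\<mu> a) * u a * \<delta> (u a) = 0"
  proof (rule vandermonde_eq_0[OF _ u_square_inj _ a, of "\<lambda>a. of_nat (\<mu> a) * u a * \<delta> (u a)"])
    fix r assume "r < card {1..M}"
    have "(of_nat (2 * Suc r) :: ratfun) \<noteq> 0" unfolding of_nat_ratfun_eq_0_iff by simp
    then show "(\<Sum>a=1..M. of_nat (\<mu> a) * u a * \<delta> (u a) * (u a ^ 2) ^ r) = 0"
      using derivation_psum[OF add mult const, of r] psum[of "Suc r"] by simp
  qed simp
  then have "\<delta> (u a) = 0" using \<mu>_pos[OF a] u_nonzero[OF a] by simp
  moreover have "\<delta> (u a) = Cst (s a) * \<delta> (Y a)"
    unfolding u_def using mult[of "Cst (s a)" "Y a"] const[of "s a"] a by simp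
  ultimately show "\<delta> (Y a) = 0" using s_nonzero[OF a] by simp
qed simp_all

text \<open>Induction on the order. Each bracket of \<open>C\<close> with some g again commutes with
  the power sums, so it is multiplication by some \<delta> g. This \<delta> is a derivation that
  kills the power sums, hence zero, and \<open>C\<close> commutes with all multiplications.\<close>

lemma mult_operator_if_bracket_psum:
  assumes "linear_op M C" "order_less M d C"
    and "\<And>r f. r > 0 \<Longrightarrow> f \<in> ratfuns M \<Longrightarrow> bracket C (psum r) f = 0" and "f \<in> ratfuns M"
  shows "C f = f * C 1"
  using assms
proof (induction d arbitrary: C f)
  case (Suc d)
  note C = linear_opD[OF Suc.prems(1)]
  define \<delta> where "\<delta> g = bracket C g 1" for g
  have bracket: "bracket C g f = f * \<delta> g" if g: "g \<in> ratfuns M" and f: "f \<in> ratfuns M" for f g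
    unfolding \<delta>_def
  proof (rule Suc.IH[OF linear_op_bracket[OF Suc.prems(1) g] _ _ f])
    show "order_less M d (bracket C g)" using Suc.prems(2) g by simp
    fix r :: nat and f assume r: "r > 0" and f: "f \<in> ratfuns M"
    have gf: "g * f \<in> ratfuns M" using f g by auto
    have "bracket C (psum r) (g * f) = 0" "bracket C (psum r) f = 0"
      by (rule Suc.prems(3)[OF r gf], rule Suc.prems(3)[OF r f])
    then show "bracket (bracket C g) (psum r) f = 0"
      by (simp add: bracket_def algebra_simps)
  qed
  have "\<delta> f = 0"
  proof (rule derivation_eq_0_if_psum[OF _ _ _ _ Suc.prems(4)])
    fix f g assume fg: "f \<in> ratfuns M" "g \<in> ratfuns M"
    show "\<delta> (f + g) = \<delta> f + \<delta> g"
      using fg by (simp add: \<delta>_def bracket_def C algebra_simps)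
    have "\<delta> (f * g) = bracket C f g + f * bracket C g 1"
      by (simp add: \<delta>_def bracket_def algebra_simps)
    then show "\<delta> (f * g) = \<delta> f * g + f * \<delta> g"
      by (simp add: bracket fg mult.commute)
  next
    fix c show "\<delta> (Cst c) = 0" using C(3)[of 1 c] by (simp add: \<delta>_def bracket_def)
  next
    fix r :: nat assume "r > 0"
    then show "\<delta> (psum r) = 0" unfolding \<delta>_def by (rule Suc.prems(3)) simp
  qed
  then show ?case by (simp add: \<delta>_def bracket_def)
qed simp

text \<open>\<open>A\<close> is closed under products, so the bracket with a power sum still
  vanishes on \<open>A\<close> and is zero by induction on the order. Then \<open>C\<close> commutes
  with the power sums and is multiplication by \<open>C 1\<close>, which is 0.\<close>

lemma operator_eq_0_if_vanishes:
  assumes "linear_op M C" "order_less M d C" and A: "A \<subseteq> ratfuns M" "1 \<in> A" "\<And>f g. f \<in> A \<Longrightarrow> g \<in> A \<Longrightarrow> f * g \<in> A"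
    "\<And>r. psum r \<in> A" and "\<And>f. f \<in> A \<Longrightarrow> C f = 0" and "f \<in> ratfuns M"
  shows "C f = 0"
  using assms(1,2,7,8)
proof (induction d arbitrary: C f)
  case (Suc d)
  have "C f = f * C 1"
  proof (rule mult_operator_if_bracket_psum[OF Suc.prems(1,2) _ Suc.prems(4)])
    fix r :: nat and f assume f: "f \<in> ratfuns M"
    show "bracket C (psum r) f = 0"
    proof (rule Suc.IH[OF linear_op_bracket[OF Suc.prems(1) psum_in_ratfuns] _ _ f])
      show "order_less M d (bracket C (psum r))" using Suc.prems(2) psum_in_ratfuns by simp
    qed (use A in \<open>simp add: bracket_def Suc.prems(3)\<close>)
  qed
  then show ?case using Suc.prems(3) A(2) by simp
qed simp

text \<open>Induction on the degree of \<open>Q\<close>: differentiating the relation shows that the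
  power sums also satisfy every partial derivative of \<open>Q\<close>, and these have lower
  degree.\<close>

lemma algebraic_independence_psum:
  assumes "indets Q \<subseteq> {1..M}" "subst_poly Cst psum Q = 0"
  shows "Q = 0"
proof -
  define deg where "deg \<alpha> = (\<Sum>i=1..M. Poly_Mapping.lookup \<alpha> i)" for \<alpha> :: mono
  \<comment> \<open>The default 0 outside \<open>{1..M}\<close> keeps the chain rule a finite
    sum.\<close>
  define \<sigma> where "\<sigma> r = (if r \<in> {1..M} then psum r else 0)" for r
  have bounded: "Q = 0" if "indets Q \<subseteq> {1..M}" "subst_poly Cst \<sigma> Q = 0" "\<forall>\<alpha>\<in>Poly_Mapping.keys Q. deg \<alpha> \<le> d" for d Q
    using that
  proof (induction d arbitrary: Q)
    case 0
    have "Poly_Mapping.keys Q \<subseteq> {0}"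
    proof
      fix \<alpha> assume \<alpha>: "\<alpha> \<in> Poly_Mapping.keys Q"
      then have "Poly_Mapping.keys \<alpha> \<subseteq> {1..M}" using 0(1) by (auto simp: indets_def)
      moreover have "\<forall>i\<in>{1..M}. Poly_Mapping.lookup \<alpha> i = 0" using 0(3) \<alpha> by (simp add: deg_def)
      ultimately have "\<alpha> = 0" by (intro poly_mapping_eqI) (metis in_keys_iff lookup_zero subsetD)
      then show "\<alpha> \<in> {0}" by simp
    qed
    then have "Q = K (Poly_Mapping.lookup Q 0)"
      by (subst mpol_sum_singles[of Q]) (auto simp: subset_singleton_iff K_def in_keys_iff)
    then show ?case using 0(2) by (metis Cst.subst_poly_K Cst_eq_0_iff K_0)
  next
    case (Suc d)
    have deriv: "mderiv r Q = 0" if r: "r \<in> {1..M}" for r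
    proof (rule Suc.IH)
      show "indets (mderiv r Q) \<subseteq> {1..M}" using indets_mderiv Suc.prems(1) by blast
      have keys: "Poly_Mapping.keys (mderiv r Q) \<subseteq> {\<alpha> - Poly_Mapping.single r 1 | \<alpha>. \<alpha> \<in> Poly_Mapping.keys Q \<and> Poly_Mapping.lookup \<alpha> r \<noteq> 0}"
        unfolding mderiv_def
        by (rule order.trans[OF Poly_Mapping.keys_sum]) (auto split: if_splits)
      show "\<forall>\<alpha>\<in>Poly_Mapping.keys (mderiv r Q). deg \<alpha> \<le> d"
      proof
        fix \<beta> assume "\<beta> \<in> Poly_Mapping.keys (mderiv r Q)"
        with keys obtain \<alpha> where \<alpha>: "\<beta> = \<alpha> - Poly_Mapping.single r 1" "\<alpha> \<in> Poly_Mapping.keys Q" "Poly_Mapping.lookup \<alpha> r \<noteq> 0" by blast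
        have "deg \<beta> < deg \<alpha>"
          unfolding deg_def \<alpha>(1)
          by (rule sum_strict_mono_ex1) (use r \<alpha>(3) in \<open>auto simp: lookup_minus lookup_single when_def intro!: bexI[of _ r]\<close>)
        with Suc.prems(3) \<alpha>(2) show "deg \<beta> \<le> d" by fastforce
      qed
      \<comment> \<open>The coefficients are the values to be shown zero. The relation
        differentiated by y_a says that u_a^2 is a root, and \<open>M\<close> distinct roots are too
        many for this degree.\<close>
      define p where "p = (\<Sum>r<M. monom (of_nat (Suc r) * subst_poly Cst \<sigma> (mderiv (Suc r) Q)) r)"
      have "poly p (u a ^ 2) = 0" if a: "a \<in> {1..M}" for a
      proof -
        have part: "partial a (psum (Suc r)) = of_nat (2 * Suc r) * (of_nat (\<mu> a) * u a * Cst (s a) * (u a ^ 2) ^ r)" for r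
        proof -
          have "(\<Sum>b=1..M. of_nat (\<mu> b) * u b * partial a (u b) * (u b ^ 2) ^ r) = of_nat (\<mu> a) * u a * Cst (s a) * (u a ^ 2) ^ r"
            using a by (subst sum.remove[of _ a]) (auto simp: partial_u intro!: sum.neutral)
          then show ?thesis using derivation_psum[of "partial a" r] by (simp add: partial_add partial_mult partial_Cst)
        qed
        have "0 = partial a (subst_poly Cst \<sigma> Q)" by (simp add: Suc.prems(2))
        also have "\<dots> = (\<Sum>r=1..M. subst_poly Cst \<sigma> (mderiv r Q) * partial a (\<sigma> r))"
          by (rule derivation_subst_poly) (auto simp: partial_add partial_mult partial_Cst \<sigma>_def)
        also have "\<dots> = (\<Sum>r<M. subst_poly Cst \<sigma> (mderiv (Suc r) Q) * partial a (psum (Suc r)))"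
          by (rule sum.reindex_bij_witness[where i = Suc and j = "\<lambda>r. r - 1"]) (auto simp: \<sigma>_def)
        also have "\<dots> = 2 * of_nat (\<mu> a) * u a * Cst (s a) * poly p (u a ^ 2)"
          unfolding part p_def poly_sum poly_monom sum_distrib_left of_nat_mult
          by (intro sum.cong) (simp_all add: mult_ac)
        finally have "2 * of_nat (\<mu> a) * u a * Cst (s a) * poly p (u a ^ 2) = 0" ..
        moreover have "(2 :: ratfun) \<noteq> 0" using of_nat_ratfun_eq_0_iff[of 2] by simp
        ultimately show ?thesis
          using s_nonzero[OF a] u_nonzero[OF a] \<mu>_pos[OF a] by simp
      qed
      then have "(\<lambda>a. u a ^ 2) ` {1..M} \<subseteq> {x. poly p x = 0}" by auto
      moreover have "card ((\<lambda>a. u a ^ 2) ` {1..M}) = M"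
        using card_image[OF u_square_inj] by simp
      moreover have "degree p < M"
      proof -
        have "degree (monom c i) \<le> M - 1" if "i < M" for c :: ratfun and i
          using degree_monom_le[of c i] that by linarith
        then have "degree p \<le> M - 1"
          unfolding p_def by (intro degree_sum_le) simp_all
        with r show ?thesis by (simp, linarith)
      qed
      ultimately have "p = 0"
      proof (rule_tac ccontr)
        assume img: "(\<lambda>a. u a ^ 2) ` {1..M} \<subseteq> {x. poly p x = 0}" "card ((\<lambda>a. u a ^ 2) ` {1..M}) = M"
          and deg: "degree p < M" and "p \<noteq> 0"
        then have "M \<le> card {x. poly p x = 0}"
          using card_mono[OF poly_roots_finite img(1)] by simp
        also have "\<dots> \<le> degree p"
          by (rule card_poly_roots_bound) fact
        finally show False using deg by simp
      qed
      obtain r' where r': "r = Suc r'" "r' < M" using r by (cases r) auto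
      have "coeff p r' = of_nat (Suc r') * subst_poly Cst \<sigma> (mderiv (Suc r') Q)"
        unfolding p_def coeff_sum coeff_monom using r'(2) by simp
      with \<open>p = 0\<close> have "of_nat r * subst_poly Cst \<sigma> (mderiv r Q) = 0"
        unfolding r'(1) by simp
      then show "subst_poly Cst \<sigma> (mderiv r Q) = 0"
        unfolding mult_eq_0_iff of_nat_ratfun_eq_0_iff using r by simp
    qed
    \<comment> \<open>Since all partial derivatives of \<open>Q\<close> vanish, \<open>Q\<close> is
      constant and the induction hypothesis applies to \<open>Q\<close> itself.\<close>
    show ?case
    proof (rule Suc.IH[OF Suc.prems(1,2)], rule ballI)
      fix \<alpha> assume \<alpha>: "\<alpha> \<in> Poly_Mapping.keys Q"
      have "Poly_Mapping.lookup \<alpha> r = 0" if r: "r \<in> {1..M}" for r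
      proof (rule ccontr)
        assume nz: "Poly_Mapping.lookup \<alpha> r \<noteq> 0"
        let ?e = "Poly_Mapping.single r (1::nat)"
        have inj: "\<beta> = \<alpha>" if "Poly_Mapping.lookup \<beta> r \<noteq> 0" "\<beta> - ?e = \<alpha> - ?e" for \<beta>
        proof -
          have e: "\<gamma> - ?e + ?e = \<gamma>" if "Poly_Mapping.lookup \<gamma> r \<noteq> 0" for \<gamma>
            using that by (intro poly_mapping_eqI) (auto simp: lookup_add lookup_minus lookup_single when_def)
          show ?thesis using e[OF that(1)] e[OF nz] that(2) by metis
        qed
        \<comment> \<open>Exponents that involve \<open>r\<close> stay distinct after lowering, so
          \<alpha> alone contributes to this coefficient, and its contribution is nonzero in
          characteristic 0.\<close>
        have "Poly_Mapping.lookup (mderiv r Q) (\<alpha> - ?e) = (\<Sum>\<beta>\<in>Poly_Mapping.keys Q.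
            if \<beta> = \<alpha> then of_nat (Poly_Mapping.lookup \<alpha> r) * Poly_Mapping.lookup Q \<alpha> else 0)"
          unfolding mderiv_def lookup_sum
        proof (rule sum.cong[OF refl])
          fix \<beta>
          show "Poly_Mapping.lookup (Poly_Mapping.single (\<beta> - ?e) (of_nat (Poly_Mapping.lookup \<beta> r) * Poly_Mapping.lookup Q \<beta>)) (\<alpha> - ?e)
            = (if \<beta> = \<alpha> then of_nat (Poly_Mapping.lookup \<alpha> r) * Poly_Mapping.lookup Q \<alpha> else 0)"
            using inj[of \<beta>] by (cases "Poly_Mapping.lookup \<beta> r = 0") (auto simp: lookup_single when_def nz)
        qed
        with \<alpha> nz deriv[OF r] show False by (simp add: in_keys_iff)
      qed
      then show "deg \<alpha> \<le> d" by (simp add: deg_def)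
    qed
  qed
  have "subst_poly Cst \<sigma> Q = 0"
  proof -
    have "subst_poly Cst \<sigma> Q = subst_poly Cst psum Q"
      unfolding subst_poly_def subst_mono_def
      by (intro sum.cong prod.cong refl arg_cong2[where f = "(*)"]) (use assms(1) in \<open>auto simp: \<sigma>_def indets_def\<close>)
    with assms(2) show ?thesis by simp
  qed
  moreover have "\<forall>\<alpha>\<in>Poly_Mapping.keys Q. deg \<alpha> \<le> Max (insert 0 (deg ` Poly_Mapping.keys Q))"
    by auto
  ultimately show ?thesis by (rule bounded[OF assms(1)])
qed

end

section \<open>Symbols and algebraic independence\<close>

text \<open>
  The symbol of degree \<open>d\<close> of \<open>C\<close> at the differential of \<open>g\<close> is \<open>v\<close>: the \<open>d\<close>-fold commutator of \<open>C\<close>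
  with \<open>g\<close> is multiplication by \<open>d! v\<close>.
\<close>

fun symbol :: "nat \<Rightarrow> ratfun \<Rightarrow> nat \<Rightarrow> (ratfun \<Rightarrow> ratfun) \<Rightarrow> ratfun \<Rightarrow> bool" where
  "symbol M g 0 C v \<longleftrightarrow> (\<forall>f\<in>ratfuns M. C f = v * f)"
| "symbol M g (Suc d) C v \<longleftrightarrow> symbol M g d (bracket C g) (of_nat (Suc d) * v)"

context
  fixes M :: nat and g :: ratfun
  assumes g: "g \<in> ratfuns M"
begin

lemma symbol_cong:
  "(\<And>f. f \<in> ratfuns M \<Longrightarrow> C f = C' f) \<Longrightarrow> symbol M g d C v \<longleftrightarrow> symbol M g d C' v"
proof (induction d arbitrary: C C' v)
  case (Suc d)
  have "symbol M g d (bracket C g) w \<longleftrightarrow> symbol M g d (bracket C' g) w" for w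
    by (rule Suc.IH) (simp add: bracket_def ratfuns_mult g Suc.prems)
  then show ?case by simp
qed simp

lemma symbol_add: "symbol M g d C v \<Longrightarrow> symbol M g d C' v' \<Longrightarrow> symbol M g d (\<lambda>f. C f + C' f) (v + v')"
proof (induction d arbitrary: C C' v v')
  case (Suc d)
  have "bracket (\<lambda>f. C f + C' f) g = (\<lambda>f. bracket C g f + bracket C' g f)"
    by (auto simp: bracket_def algebra_simps)
  with Suc.prems Suc.IH[of "bracket C g" "of_nat (Suc d) * v" "bracket C' g" "of_nat (Suc d) * v'"]
  show ?case by (simp only: symbol.simps distrib_left)
qed (simp add: algebra_simps)

lemma symbol_zero: "(\<And>f. f \<in> ratfuns M \<Longrightarrow> C f = 0) \<Longrightarrow> symbol M g d C 0"
proof (induction d arbitrary: C)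
  case (Suc d)
  then show ?case by (simp add: bracket_def ratfuns_mult g)
qed simp

lemma symbol_sum:
  "(\<And>x. x \<in> A \<Longrightarrow> symbol M g d (C x) (v x)) \<Longrightarrow> symbol M g d (\<lambda>f. \<Sum>x\<in>A. C x f) (\<Sum>x\<in>A. v x)"
  by (induction A rule: infinite_finite_induct) (simp_all add: symbol_zero symbol_add)

text \<open>Multiplication operators commute with \<open>g\<close>, so one further bracket gives 0.
  Terms of lower degree can thus be discarded with symbol 0.\<close>

lemma symbol_Suc: "symbol M g d C v \<Longrightarrow> symbol M g (Suc d) C 0"
proof (induction d arbitrary: C v)
  case 0
  then show ?case by (simp add: bracket_def ratfuns_mult g)
next
  case (Suc d)
  then have "symbol M g (Suc d) (bracket C g) 0" by (metis symbol.simps(2))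
  then show ?case by (simp only: symbol.simps(2)[of M g "Suc d"] mult_zero_right)
qed

lemma symbol_less: "symbol M g d C v \<Longrightarrow> d < e \<Longrightarrow> symbol M g e C 0"
proof (induction e)
  case (Suc e)
  then show ?case using symbol_Suc less_Suc_eq by blast
qed simp

lemma symbol_0_bracket: "symbol M g 0 C v \<Longrightarrow> f \<in> ratfuns M \<Longrightarrow> bracket C g f = 0"
  by (simp add: bracket_def ratfuns_mult g)

text \<open>The Leibniz rule for the bracket, iterated; the normalisation by d! is what makes
  symbols multiplicative.\<close>

lemma symbol_comp:
  "linear_op M C \<Longrightarrow> linear_op M C' \<Longrightarrow> symbol M g d C v \<Longrightarrow> symbol M g e C' v' \<Longrightarrow>
    symbol M g (d + e) (\<lambda>f. C (C' f)) (v * v')"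
proof (induction "d + e" arbitrary: C C' d e v v' rule: less_induct)
  case less
  note linear = less.prems(1,2)
  note bracket = bracket_comp[OF linear _ g] linear_op_bracket[OF linear(1) g] linear_op_bracket[OF linear(2) g]
  have 1: "symbol M g (d' + e) (\<lambda>f. bracket C g (C' f)) (of_nat (Suc d') * v * v')" if "d = Suc d'" for d'
    using less.prems that by (intro less.hyps bracket linear) simp_all
  have 2: "symbol M g (d + e') (\<lambda>f. C (bracket C' g f)) (v * (of_nat (Suc e') * v'))" if "e = Suc e'" for e'
    using less.prems that by (intro less.hyps bracket linear) simp_all
  show ?case
  proof (cases d; cases e)
    assume "d = 0" "e = 0"
    then show ?thesis using less.prems(3,4) linear_opD(1)[OF linear(2)] by (simp add: mult.assoc)
  next
    fix e' assume d: "d = 0" and e: "e = Suc e'"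
    have "symbol M g e' (bracket (\<lambda>f. C (C' f)) g) (v * (of_nat (Suc e') * v'))"
      using 2[OF e] d
      by (subst symbol_cong[of _ "\<lambda>f. C (bracket C' g f)"])
         (use less.prems(3) linear_opD(1)[OF linear(2)] in \<open>auto simp: bracket(1) intro!: symbol_0_bracket\<close>)
    then show ?thesis by (simp add: d e mult_ac)
  next
    fix d' assume d: "d = Suc d'" and e: "e = 0"
    have "C (bracket C' g f) = 0" if "f \<in> ratfuns M" for f
      using symbol_0_bracket[of C' v' f] less.prems(4) linear_op_0[OF linear(1)] that e by simp
    then have "symbol M g d' (bracket (\<lambda>f. C (C' f)) g) (of_nat (Suc d') * v * v')"
      using 1[OF d] e by (subst symbol_cong[of _ "\<lambda>f. bracket C g (C' f)"]) (auto simp: bracket(1))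
    then show ?thesis by (simp add: d e mult_ac)
  next
    fix d' e' assume d: "d = Suc d'" and e: "e = Suc e'"
    have "symbol M g (d' + e) (\<lambda>f. bracket C g (C' f) + C (bracket C' g f))
        (of_nat (Suc d') * v * v' + v * (of_nat (Suc e') * v'))"
      using 1[OF d] 2[OF e] d e by (intro symbol_add) (simp_all del: symbol.simps)
    \<comment> \<open>The factors d and e of the two terms add up to d + e, the factor required in
      the next degree.\<close>
    moreover have "of_nat (Suc d') * v * v' + v * (of_nat (Suc e') * v') = of_nat (Suc (d' + e)) * (v * v')"
      by (simp add: e algebra_simps)
    ultimately have "symbol M g (d' + e) (bracket (\<lambda>f. C (C' f)) g) (of_nat (Suc (d' + e)) * (v * v'))"
      by (subst symbol_cong[of _ "\<lambda>f. bracket C g (C' f) + C (bracket C' g f)"]) (simp_all only: bracket(1))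
    then show ?thesis by (simp add: d)
  qed
qed

text \<open>The d-fold bracket yields d! v = 0, and the characteristic is 0.\<close>

lemma symbol_vanishing: "symbol M g d C v \<Longrightarrow> (\<And>f. f \<in> ratfuns M \<Longrightarrow> C f = 0) \<Longrightarrow> v = 0"
proof (induction d arbitrary: C v)
  case 0
  then show ?case by (metis mult.right_neutral ratfuns_1 symbol.simps(1))
next
  case (Suc d)
  have "of_nat (Suc d) * v = 0"
  proof (rule Suc.IH)
    show "symbol M g d (bracket C g) (of_nat (Suc d) * v)" using Suc.prems(1) by (simp only: symbol.simps)
  qed (simp add: bracket_def ratfuns_mult g Suc.prems(2))
  then show ?case using of_nat_ratfun_eq_0_iff[of "Suc d"] by (metis mult_eq_0_iff nat.simps(3))
qed

lemma symbol_partial: "symbol M g (Suc 0) (partial i) (partial i g)"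
  by (simp add: bracket_def partial_mult algebra_simps)

lemma linear_op_funpow: "linear_op M C \<Longrightarrow> linear_op M (C ^^ n)"
  by (induction n) (auto simp: linear_op_def)

lemma symbol_funpow: "linear_op M C \<Longrightarrow> symbol M g d C v \<Longrightarrow> symbol M g (n * d) (C ^^ n) (v ^ n)"
proof (induction n)
  case (Suc n)
  then show ?case using symbol_comp[of C "C ^^ n" d v "n * d" "v ^ n"] linear_op_funpow[of C n]
    by (simp add: comp_def del: symbol.simps)
qed simp

end

lemma op_monomial_eq:
  assumes "\<And>i. i \<in> {1..M} \<Longrightarrow> linear_op M (T i)" and g: "g \<in> ratfuns M"
    and "\<And>i. i \<in> {1..M} \<Longrightarrow> symbol M g (d i) (T i) (v i)"
  shows "linear_op M (op_monomial M T \<alpha>)"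
    and "symbol M g (\<Sum>i=1..M. Poly_Mapping.lookup \<alpha> i * d i) (op_monomial M T \<alpha>)
      (\<Prod>i=1..M. v i ^ Poly_Mapping.lookup \<alpha> i)"
proof -
  \<comment> \<open>An arbitrary list of indices in place of \<open>[1..<Suc M]\<close>, for
    induction on the list.\<close>
  define C where "C is = (\<lambda>f. foldr (\<lambda>i g. (T i ^^ Poly_Mapping.lookup \<alpha> i) g) is f)" for "is"
  have key: "linear_op M (C is) \<and> symbol M g (\<Sum>i\<in>set is. Poly_Mapping.lookup \<alpha> i * d i) (C is)
      (\<Prod>i\<in>set is. v i ^ Poly_Mapping.lookup \<alpha> i)" if "set is \<subseteq> {1..M}" "distinct is" for "is"
    using that
  proof (induction "is")
    case Nil
    then show ?case by (simp add: C_def linear_op_def)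
  next
    case (Cons i "is")
    have i: "i \<in> {1..M}" and IH: "linear_op M (C is)"
      "symbol M g (\<Sum>i\<in>set is. Poly_Mapping.lookup \<alpha> i * d i) (C is) (\<Prod>i\<in>set is. v i ^ Poly_Mapping.lookup \<alpha> i)"
      using Cons by simp_all
    have C: "C (i # is) = (\<lambda>f. (T i ^^ Poly_Mapping.lookup \<alpha> i) (C is f))" by (simp add: C_def)
    have lin: "linear_op M (T i ^^ Poly_Mapping.lookup \<alpha> i)"
      by (rule linear_op_funpow[OF g assms(1)[OF i]])
    have "symbol M g (Poly_Mapping.lookup \<alpha> i * d i) (T i ^^ Poly_Mapping.lookup \<alpha> i) (v i ^ Poly_Mapping.lookup \<alpha> i)"
      by (rule symbol_funpow[OF g assms(1)[OF i] assms(3)[OF i]])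
    from symbol_comp[OF g lin IH(1) this IH(2)] linear_op_comp[OF lin IH(1)] Cons.prems(2)
    show ?case unfolding C by simp
  qed
  have "C [1..<Suc M] = op_monomial M T \<alpha>"
    by (simp only: C_def op_monomial_def[abs_def])
  moreover have "set [1..<Suc M] = {1..M}"
    by (simp only: set_upt atLeastLessThanSuc_atLeastAtMost)
  ultimately have "linear_op M (op_monomial M T \<alpha>) \<and> symbol M g (\<Sum>i=1..M. Poly_Mapping.lookup \<alpha> i * d i)
      (op_monomial M T \<alpha>) (\<Prod>i=1..M. v i ^ Poly_Mapping.lookup \<alpha> i)"
    using key[of "[1..<Suc M]"] by (simp only: distinct_upt order_refl)
  then show "linear_op M (op_monomial M T \<alpha>)"
    and "symbol M g (\<Sum>i=1..M. Poly_Mapping.lookup \<alpha> i * d i) (op_monomial M T \<alpha>)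
      (\<Prod>i=1..M. v i ^ Poly_Mapping.lookup \<alpha> i)"
    by blast+
qed

text \<open>Give variable i the weight \<open>d i\<close>. The symbol, in the top weighted degree of
  a relation \<open>P\<close>, sees only the top part \<open>Q\<close> of \<open>P\<close>; hence
  \<open>Q\<close> is a relation between the symbols \<open>v\<close>. Then \<open>Q = 0\<close>,
  although \<open>Q\<close> contains a monomial of \<open>P\<close>.\<close>

lemma alg_independent_opsI:
  assumes linear: "\<And>i. i \<in> {1..M} \<Longrightarrow> linear_op M (T i)" and g: "g \<in> ratfuns M"
    and symbol: "\<And>i. i \<in> {1..M} \<Longrightarrow> symbol M g (d i) (T i) (v i)"
    and indep: "\<And>Q. indets Q \<subseteq> {1..M} \<Longrightarrow> subst_poly Cst v Q = 0 \<Longrightarrow> Q = 0"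
  shows "alg_independent_ops M T"
  unfolding alg_independent_ops_def
proof (intro allI impI, elim conjE, rule ccontr)
  fix P assume P: "indets P \<subseteq> {1..M}" "\<forall>f\<in>ratfuns M. op_poly M T P f = 0" "P \<noteq> 0"
  define wt where "wt \<alpha> = (\<Sum>i=1..M. Poly_Mapping.lookup \<alpha> i * d i)" for \<alpha>
  define w where "w = Max (wt ` Poly_Mapping.keys P)"
  define top_keys where "top_keys = {\<alpha> \<in> Poly_Mapping.keys P. wt \<alpha> = w}"
  define Q where "Q = (\<Sum>\<alpha>\<in>top_keys. Poly_Mapping.single \<alpha> (Poly_Mapping.lookup P \<alpha>))"
  have fin: "finite top_keys" by (simp add: top_keys_def)
  have "w \<in> wt ` Poly_Mapping.keys P"
    unfolding w_def by (rule Max_in) (use \<open>P \<noteq> 0\<close> in auto)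
  then obtain \<alpha> where \<alpha>: "\<alpha> \<in> top_keys" by (auto simp: top_keys_def)
  have "symbol M g w (\<lambda>f. Cst (Poly_Mapping.lookup P \<alpha>) * op_monomial M T \<alpha> f)
      (if wt \<alpha> = w then Cst (Poly_Mapping.lookup P \<alpha>) * (\<Prod>i=1..M. v i ^ Poly_Mapping.lookup \<alpha> i) else 0)"
    if \<alpha>: "\<alpha> \<in> Poly_Mapping.keys P" for \<alpha>
  proof -
    have "symbol M g (0 + wt \<alpha>) (\<lambda>f. Cst (Poly_Mapping.lookup P \<alpha>) * op_monomial M T \<alpha> f)
        (Cst (Poly_Mapping.lookup P \<alpha>) * (\<Prod>i=1..M. v i ^ Poly_Mapping.lookup \<alpha> i))"
    proof (rule symbol_comp[OF g linear_op_mult])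
      show "linear_op M (op_monomial M T \<alpha>)"
        by (rule op_monomial_eq(1)[OF linear g symbol])
      show "symbol M g (wt \<alpha>) (op_monomial M T \<alpha>) (\<Prod>i=1..M. v i ^ Poly_Mapping.lookup \<alpha> i)"
        unfolding wt_def by (rule op_monomial_eq(2)[OF linear g symbol])
    qed simp_all
    moreover have "wt \<alpha> \<le> w" unfolding w_def using \<alpha> by (intro Max_ge) auto
    ultimately show ?thesis using symbol_less[OF g] by (cases "wt \<alpha> = w") auto
  qed
  then have "symbol M g w (op_poly M T P) (\<Sum>\<alpha>\<in>Poly_Mapping.keys P. if wt \<alpha> = w then
      Cst (Poly_Mapping.lookup P \<alpha>) * (\<Prod>i=1..M. v i ^ Poly_Mapping.lookup \<alpha> i) else 0)"
    unfolding op_poly_def[abs_def] by (rule symbol_sum[OF g])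
  then have "(\<Sum>\<alpha>\<in>Poly_Mapping.keys P. if wt \<alpha> = w then
      Cst (Poly_Mapping.lookup P \<alpha>) * (\<Prod>i=1..M. v i ^ Poly_Mapping.lookup \<alpha> i) else 0) = 0"
    by (rule symbol_vanishing[OF g]) (use P in auto)
  then have "(\<Sum>\<alpha>\<in>top_keys. Cst (Poly_Mapping.lookup P \<alpha>) * (\<Prod>i=1..M. v i ^ Poly_Mapping.lookup \<alpha> i)) = 0"
    by (simp add: top_keys_def sum.inter_filter del: One_nat_def)
  moreover have "subst_mono v \<alpha> = (\<Prod>i=1..M. v i ^ Poly_Mapping.lookup \<alpha> i)" if "\<alpha> \<in> top_keys" for \<alpha>
    by (rule subst_mono_superset) (use that P(1) in \<open>auto simp: top_keys_def indets_def\<close>)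
  ultimately have "subst_poly Cst v Q = 0"
    unfolding Q_def Cst.subst_poly_sum Cst.subst_poly_single by (simp cong: sum.cong)
  have lookup: "Poly_Mapping.lookup Q \<beta> = (if \<beta> \<in> top_keys then Poly_Mapping.lookup P \<beta> else 0)" for \<beta>
    unfolding Q_def lookup_sum lookup_single when_def by (simp add: fin)
  have "Poly_Mapping.keys Q \<subseteq> Poly_Mapping.keys P"
    by (auto simp: in_keys_iff lookup top_keys_def split: if_splits)
  with P(1) have "indets Q \<subseteq> {1..M}"
    unfolding indets_def by blast
  then have "Q = 0" using \<open>subst_poly Cst v Q = 0\<close> by (rule indep)
  with lookup[of \<alpha>] \<alpha> show False by (simp add: top_keys_def in_keys_iff)
qed

lemma linear_op_add: "linear_op M C \<Longrightarrow> linear_op M C' \<Longrightarrow> linear_op M (\<lambda>f. C f + C' f)"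
  by (auto simp: linear_op_def algebra_simps)

lemma linear_op_sum_ops: "(\<And>x. x \<in> J \<Longrightarrow> linear_op M (C x)) \<Longrightarrow> linear_op M (\<lambda>f. \<Sum>x\<in>J. C x f)"
  by (induction J rule: infinite_finite_induct) (simp_all add: linear_op_add linear_op_def[of M "\<lambda>_. 0"])

section \<open>Closure properties of differential operators\<close>

text \<open>The index set may exceed the support, so coefficients that happen to vanish need no
  care.\<close>

lemma diff_op_sumI:
  assumes "finite A" "\<And>\<alpha>. \<alpha> \<in> A \<Longrightarrow> Poly_Mapping.keys \<alpha> \<subseteq> {1..M} \<and> b \<alpha> \<in> ratfuns M"
    and "\<And>f. f \<in> ratfuns M \<Longrightarrow> L f = (\<Sum>\<alpha>\<in>A. b \<alpha> * op_monomial M partial \<alpha> f)"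
  shows "diff_op M L"
proof -
  define a where "a = (\<Sum>\<alpha>\<in>A. Poly_Mapping.single \<alpha> (b \<alpha>))"
  have a: "Poly_Mapping.lookup a \<alpha> = (if \<alpha> \<in> A then b \<alpha> else 0)" for \<alpha>
    unfolding a_def lookup_sum lookup_single when_def using assms(1) by simp
  have "Poly_Mapping.keys a \<subseteq> A" by (auto simp: in_keys_iff a split: if_splits)
  then have "(\<Sum>\<alpha>\<in>A. b \<alpha> * x \<alpha>) = (\<Sum>\<alpha>\<in>Poly_Mapping.keys a. Poly_Mapping.lookup a \<alpha> * x \<alpha>)" for x
    using assms(1) by (intro sum.mono_neutral_cong_right) (auto simp: a in_keys_iff)
  with assms show ?thesis
    unfolding diff_op_def by (intro exI[of _ a]) (auto simp: a in_keys_iff)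
qed

lemma diff_opE:
  assumes "diff_op M L"
  obtains A b where "finite A" "\<And>\<alpha>. \<alpha> \<in> A \<Longrightarrow> Poly_Mapping.keys \<alpha> \<subseteq> {1..M}" "\<And>\<alpha>. b \<alpha> \<in> ratfuns M"
    "\<And>f. f \<in> ratfuns M \<Longrightarrow> L f = (\<Sum>\<alpha>\<in>A. b \<alpha> * op_monomial M partial \<alpha> f)"
proof -
  from assms obtain a where a: "\<And>\<alpha>. \<alpha> \<in> Poly_Mapping.keys a \<Longrightarrow> Poly_Mapping.keys \<alpha> \<subseteq> {1..M} \<and> Poly_Mapping.lookup a \<alpha> \<in> ratfuns M"
    "\<And>f. f \<in> ratfuns M \<Longrightarrow> L f = (\<Sum>\<alpha>\<in>Poly_Mapping.keys a. Poly_Mapping.lookup a \<alpha> * op_monomial M partial \<alpha> f)"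
    unfolding diff_op_def by blast
  moreover have "Poly_Mapping.lookup a \<alpha> \<in> ratfuns M" for \<alpha>
    using a(1)[of \<alpha>] by (cases "\<alpha> \<in> Poly_Mapping.keys a") (auto simp: in_keys_iff)
  ultimately show thesis by (intro that[of "Poly_Mapping.keys a" "Poly_Mapping.lookup a"]) auto
qed

lemma op_monomial_0 [simp]: "op_monomial M T 0 f = f"
proof -
  have "foldr (\<lambda>_ x. x) js f = f" for js :: "nat list" by (induction js) simp_all
  then show ?thesis by (simp add: op_monomial_def id_def)
qed

lemma diff_op_mult: "w \<in> ratfuns M \<Longrightarrow> diff_op M ((*) w)"
  by (rule diff_op_sumI[of "{0}" M "\<lambda>_. w"]) simp_all

lemma diff_op_add:
  assumes "diff_op M L" "diff_op M L'"
  shows "diff_op M (\<lambda>f. L f + L' f)"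
  using assms
proof (elim diff_opE)
  fix A b A' b'
  assume *: "finite A" "\<And>\<alpha>. \<alpha> \<in> A \<Longrightarrow> Poly_Mapping.keys \<alpha> \<subseteq> {1..M}" "\<And>\<alpha>. b \<alpha> \<in> ratfuns M"
    "\<And>f. f \<in> ratfuns M \<Longrightarrow> L f = (\<Sum>\<alpha>\<in>A. b \<alpha> * op_monomial M partial \<alpha> f)"
    "finite A'" "\<And>\<alpha>. \<alpha> \<in> A' \<Longrightarrow> Poly_Mapping.keys \<alpha> \<subseteq> {1..M}" "\<And>\<alpha>. b' \<alpha> \<in> ratfuns M"
    "\<And>f. f \<in> ratfuns M \<Longrightarrow> L' f = (\<Sum>\<alpha>\<in>A'. b' \<alpha> * op_monomial M partial \<alpha> f)"
  let ?b = "\<lambda>\<alpha>. (if \<alpha> \<in> A then b \<alpha> else 0) + (if \<alpha> \<in> A' then b' \<alpha> else 0)"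
  show ?thesis
  proof (rule diff_op_sumI[of "A \<union> A'" M ?b])
    fix f assume f: "f \<in> ratfuns M"
    have "(\<Sum>\<alpha>\<in>A. b \<alpha> * op_monomial M partial \<alpha> f) = (\<Sum>\<alpha>\<in>A \<union> A'. (if \<alpha> \<in> A then b \<alpha> else 0) * op_monomial M partial \<alpha> f)"
      "(\<Sum>\<alpha>\<in>A'. b' \<alpha> * op_monomial M partial \<alpha> f) = (\<Sum>\<alpha>\<in>A \<union> A'. (if \<alpha> \<in> A' then b' \<alpha> else 0) * op_monomial M partial \<alpha> f)"
      using * by (auto intro!: sum.mono_neutral_cong_left)
    then show "L f + L' f = (\<Sum>\<alpha>\<in>A \<union> A'. ?b \<alpha> * op_monomial M partial \<alpha> f)"
      by (simp add: * f distrib_right sum.distrib)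
  qed (use * in auto)
qed

lemma diff_op_cong: "diff_op M L \<Longrightarrow> (\<And>f. f \<in> ratfuns M \<Longrightarrow> L' f = L f) \<Longrightarrow> diff_op M L'"
  by (auto simp: diff_op_def)

lemma diff_op_sum: "(\<And>x. x \<in> A \<Longrightarrow> diff_op M (L x)) \<Longrightarrow> diff_op M (\<lambda>f. \<Sum>x\<in>A. L x f)"
proof (induction A rule: infinite_finite_induct)
  case (insert x A)
  then show ?case by (simp add: diff_op_add)
qed (use diff_op_mult[of 0 M] in \<open>auto elim: diff_op_cong\<close>)

lemma diff_op_scale:
  assumes "diff_op M L" "w \<in> ratfuns M"
  shows "diff_op M (\<lambda>f. w * L f)"
  using assms
proof (elim diff_opE)
  fix A b
  assume "finite A" "\<And>\<alpha>. \<alpha> \<in> A \<Longrightarrow> Poly_Mapping.keys \<alpha> \<subseteq> {1..M}" "\<And>\<alpha>. b \<alpha> \<in> ratfuns M"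
    "\<And>f. f \<in> ratfuns M \<Longrightarrow> L f = (\<Sum>\<alpha>\<in>A. b \<alpha> * op_monomial M partial \<alpha> f)"
  then show ?thesis using assms(2)
    by (intro diff_op_sumI[of A M "\<lambda>\<alpha>. w * b \<alpha>"]) (auto simp: sum_distrib_left mult.assoc)
qed

lemma op_monomial_add_single:
  assumes i: "i \<in> {1..M}"
  shows "op_monomial M partial (\<alpha> + Poly_Mapping.single i 1) f = partial i (op_monomial M partial \<alpha> f)"
proof -
  have comm: "(partial j ^^ n) (partial i g) = partial i ((partial j ^^ n) g)" for j n g
    by (induction n) (simp_all add: partial_commute)
  define \<beta> where "\<beta> = \<alpha> + Poly_Mapping.single i 1"
  have \<beta>: "Poly_Mapping.lookup \<beta> j = (if j = i then Suc (Poly_Mapping.lookup \<alpha> i) else Poly_Mapping.lookup \<alpha> j)" for j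
    by (simp add: \<beta>_def lookup_add lookup_single when_def)
  have notin: "foldr (\<lambda>j. partial j ^^ Poly_Mapping.lookup \<beta> j) js f
    = foldr (\<lambda>j. partial j ^^ Poly_Mapping.lookup \<alpha> j) js f" if "i \<notin> set js" for js
    using that by (induction js) (auto simp: \<beta>)
  have "foldr (\<lambda>j. partial j ^^ Poly_Mapping.lookup \<beta> j) js f
    = partial i (foldr (\<lambda>j. partial j ^^ Poly_Mapping.lookup \<alpha> j) js f)" if "i \<in> set js" "distinct js" for js
    using that
  proof (induction js)
    case (Cons j js)
    show ?case
    proof (cases "j = i")
      case True
      then show ?thesis using Cons.prems notin[of js] by (simp add: \<beta>[of i])
    next
      case False
      then show ?thesis using Cons by (simp add: \<beta>[of j] comm)
    qed
  qed simp
  from this[of "[1..<Suc M]"] show ?thesis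
    unfolding op_monomial_def \<beta>_def using i
    by (simp only: set_upt atLeastLessThanSuc_atLeastAtMost distinct_upt)
qed

lemma diff_op_partial:
  assumes "diff_op M L" "i \<in> {1..M}"
  shows "diff_op M (\<lambda>f. partial i (L f))"
  using assms(1)
proof (elim diff_opE)
  fix A b
  assume *: "finite A" "\<And>\<alpha>. \<alpha> \<in> A \<Longrightarrow> Poly_Mapping.keys \<alpha> \<subseteq> {1..M}" "\<And>\<alpha>. b \<alpha> \<in> ratfuns M"
    "\<And>f. f \<in> ratfuns M \<Longrightarrow> L f = (\<Sum>\<alpha>\<in>A. b \<alpha> * op_monomial M partial \<alpha> f)"
  let ?e = "Poly_Mapping.single i (1::nat)"
  have keys: "Poly_Mapping.keys (\<alpha> + ?e) \<subseteq> {1..M}" if "\<alpha> \<in> A" for \<alpha>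
    using *(2)[OF that] assms(2) Poly_Mapping.keys_add[of \<alpha> ?e] by auto
  have basic: "diff_op M (\<lambda>f. c * op_monomial M partial \<alpha> f)" if "c \<in> ratfuns M" "Poly_Mapping.keys \<alpha> \<subseteq> {1..M}" for c \<alpha>
    using that by (intro diff_op_sumI[of "{\<alpha>}" M "\<lambda>_. c"]) auto
  have "diff_op M (\<lambda>f. \<Sum>\<alpha>\<in>A. partial i (b \<alpha>) * op_monomial M partial \<alpha> f + b \<alpha> * op_monomial M partial (\<alpha> + ?e) f)"
    by (intro diff_op_sum diff_op_add basic keys * ratfuns_partial)
  then show ?thesis
    by (rule diff_op_cong) (simp add: * partial_sum partial_mult op_monomial_add_single[OF assms(2)] del: One_nat_def)
qed

section \<open>Restriction to a stratum\<close>

text \<open>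
  The variables \<open>x\<^sub>i\<close>, \<open>i \<in> I\<close>, are restricted to the stratum on which they coincide along the fibres
  of \<open>cl\<close>; the value on the fibre over \<open>a\<close> is \<open>u a\<close>. A fibre has \<open>1\<close> or \<open>1/c\<close> elements, which
  makes the restrictions of the Dunkl operators well defined.
\<close>

locale stratum = dunkl_oscillator I S c q \<omega> + scaled_variables M \<mu> s
  for I S c q \<omega> M \<mu> s +
  fixes cl :: "nat \<Rightarrow> nat"
  assumes cl: "i \<in> I \<Longrightarrow> cl i \<in> {1..M}"
    and card_fibre: "a \<in> {1..M} \<Longrightarrow> card {i \<in> I. cl i = a} = \<mu> a"
    and s_square: "a \<in> {1..M} \<Longrightarrow> of_nat (\<mu> a) * (s a * s a) = 1"
    and mass: "a \<in> {1..M} \<Longrightarrow> \<mu> a = 1 \<or> c * of_nat (\<mu> a) = 1"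
begin

text \<open>Variables outside \<open>I\<close> are sent to the default 0, so that every polynomial
  restricts into \<open>ratfuns M\<close>.\<close>

definition restrict :: "mpol \<Rightarrow> ratfun" where
  "restrict = subst_poly Cst (\<lambda>i. if i \<in> I then u (cl i) else 0)"

text \<open>As \<mu>_a s_a^2 = 1, this is 1/\<mu>_a times the derivative by u_a: the mean of the
  derivatives in the variables of the cluster.\<close>

definition d :: "nat \<Rightarrow> ratfun \<Rightarrow> ratfun" where
  "d a f = Cst (s a) * partial a f"

text \<open>The total multiplicity of the roots that join one particle of cluster a to cluster b.
  For a = b these are the \<mu>_a - 1 roots x_i + x_j inside the cluster and the sign change, which
  all restrict to the form 2 u_a.\<close>

definition \<Gamma> :: "nat \<Rightarrow> nat \<Rightarrow> complex" where
  "\<Gamma> a b = (if a = b then c * (of_nat (\<mu> a) - 1) + q else c * of_nat (\<mu> b))"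

definition R :: "nat \<Rightarrow> (nat \<times> complex) set" where
  "R a = {1..M} \<times> S - {(a, 1)}"

text \<open>The restricted Dunkl operator. Reflecting the member at a gives \<tau>^e times the
  member at b, which explains the vector argument and the parity \<open>e\<close>.\<close>

definition E :: "nat \<Rightarrow> (nat \<Rightarrow> ratfun) \<Rightarrow> nat \<Rightarrow> ratfun" where
  "E e v a = d a (v a) - (\<Sum>(b, \<tau>)\<in>R a. Cst (\<Gamma> a b) * ((v a - Cst (\<tau> ^ e) * v b) / (u a - Cst \<tau> * u b)))"

definition B :: "complex \<Rightarrow> nat \<Rightarrow> (nat \<Rightarrow> ratfun) \<Rightarrow> nat \<Rightarrow> ratfun" where
  "B t e v a = E e v a + Cst (t * \<omega>) * (u a * v a)"

text \<open>The parity is 0 for the inner factor and 1 for the outer one, since each ladder operator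
  changes it.\<close>

definition h_vec :: "(nat \<Rightarrow> ratfun) \<Rightarrow> nat \<Rightarrow> ratfun" where
  "h_vec v = B 1 1 (B (-1) 0 v)"

definition T :: "nat \<Rightarrow> ratfun \<Rightarrow> ratfun" where
  "T r f = (\<Sum>a=1..M. of_nat (\<mu> a) * (h_vec ^^ r) (\<lambda>_. f) a)"

definition equivariant :: "nat \<Rightarrow> (nat \<Rightarrow> mpol) \<Rightarrow> bool" where
  "equivariant e g \<longleftrightarrow> (\<forall>a\<in>I. \<forall>b\<in>I. \<forall>t\<in>S. \<forall>i. reflect a b t (g i) = K (sgn_at a b t i ^ e) * g (sw a b i))"

lemma finite_R: "finite (R a)"
  by (simp add: R_def finite_S)

lemma u_diff_nonzero:
  assumes "a \<in> {1..M}" "(b, \<tau>) \<in> R a"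
  shows "u a - Cst \<tau> * u b \<noteq> 0"
proof
  assume "u a - Cst \<tau> * u b = 0"
  then have u: "u a = Cst \<tau> * u b" by simp
  have \<tau>: "\<tau> * \<tau> = 1" and b: "b \<in> {1..M}" using assms S_square by (auto simp: R_def)
  have "u a ^ 2 = Cst (\<tau> * \<tau>) * u b ^ 2" unfolding u Cst_mult by (simp add: power2_eq_square)
  then have "a = b" using u_square_inj assms(1) b \<tau> by (auto dest: inj_onD)
  with u u_nonzero[OF b] have "Cst (\<tau> - 1) = 0" by (simp add: Cst.e_diff)
  then have "\<tau> = 1" by simp
  with \<open>a = b\<close> assms(2) show False by (simp add: R_def)
qed

section \<open>Restriction of Dunkl operators to the stratum\<close>

lemma restrict_K [simp]: "restrict (K a) = Cst a"
  and restrict_0 [simp]: "restrict 0 = 0"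
  and restrict_1 [simp]: "restrict 1 = 1"
  and restrict_X: "i \<in> I \<Longrightarrow> restrict (X i) = u (cl i)"
  and restrict_add: "restrict (f + g) = restrict f + restrict g"
  and restrict_diff: "restrict (f - g) = restrict f - restrict g"
  and restrict_minus: "restrict (- f) = - restrict f"
  and restrict_mult: "restrict (f * g) = restrict f * restrict g"
  and restrict_power: "restrict (f ^ n) = restrict f ^ n"
  and restrict_sum: "restrict (sum F J) = (\<Sum>x\<in>J. restrict (F x))"
  by (simp_all add: restrict_def Cst.subst_poly_add Cst.subst_poly_diff Cst.subst_poly_minus Cst.subst_poly_mult
      Cst.subst_poly_power Cst.subst_poly_sum)

lemma restrict_in_ratfuns: "restrict f \<in> ratfuns M"
proof (induction f rule: mpol_induct)
  case (var i)
  then show ?case using u_in_ratfuns[OF cl[of i]] by (simp add: restrict_def)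
qed (auto simp: restrict_add restrict_mult)

lemma sum_over_I: "(\<Sum>i\<in>I. \<phi> (cl i)) = (\<Sum>a=1..M. of_nat (\<mu> a) * (\<phi> a :: ratfun))"
proof -
  have "(\<Sum>i\<in>I. \<phi> (cl i)) = (\<Sum>a=1..M. \<Sum>i\<in>{i \<in> I. cl i = a}. \<phi> (cl i))"
    by (rule sum.group[symmetric]) (use finite_I cl in auto)
  also have "\<dots> = (\<Sum>a=1..M. of_nat (\<mu> a) * \<phi> a)"
    by (intro sum.cong refl) (simp add: card_fibre del: One_nat_def)
  finally show ?thesis .
qed

lemma d_restrict:
  assumes a: "a \<in> {1..M}"
  shows "of_nat (\<mu> a) * d a (restrict g) = (\<Sum>i\<in>{i \<in> I. cl i = a}. restrict (mderiv i g))"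
proof -
  have "partial a (restrict g) = (\<Sum>i\<in>I. restrict (mderiv i g) * partial a (if i \<in> I then u (cl i) else 0))"
    unfolding restrict_def
    by (rule derivation_subst_poly) (auto simp: partial_add partial_mult partial_Cst finite_I)
  also have "\<dots> = (\<Sum>i\<in>{i \<in> I. cl i = a}. restrict (mderiv i g) * Cst (s a))"
    by (rule sum.mono_neutral_cong_right) (auto simp: finite_I partial_u)
  finally have "of_nat (\<mu> a) * d a (restrict g) = Cst (of_nat (\<mu> a) * (s a * s a)) * (\<Sum>i\<in>{i \<in> I. cl i = a}. restrict (mderiv i g))"
    by (simp add: d_def Cst_mult Cst_of_nat sum_distrib_left sum_distrib_right mult_ac)
  then show ?thesis by (simp add: s_square[OF a])
qed

text \<open>Here the root form vanishes on the stratum, so division is impossible after restriction.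
  But there the reflection acts trivially, so the divided difference becomes a derivation and is
  determined by its values on the variables.\<close>

lemma restrict_ddiff_same_fibre:
  assumes "i \<in> I" "j \<in> I" "i \<noteq> j" "cl i = cl j"
  shows "restrict (ddiff i j 1 f) = restrict (mderiv i f) - restrict (mderiv j f)"
proof -
  have root: "is_root i j 1" using assms by (simp add: is_root_def)
  have reflect: "restrict (reflect i j 1 f) = restrict f" for f
    by (induction f rule: mpol_induct)
       (use assms in \<open>auto simp: reflect_add reflect_mult restrict_add restrict_mult reflect_X sgn_at_def sw_def restrict_X\<close>)
  show ?thesis
  proof (induction f rule: mpol_induct)
    case (var l)
    then show ?case using assms by (auto simp: ddiff_X[OF root] mderiv_X restrict_minus)
  next
    case (mult p r)
    show ?case
      unfolding ddiff_mult[OF root] mderiv_mult restrict_add restrict_mult reflect mult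
      by (simp add: algebra_simps)
  qed (simp_all add: root ddiff_add restrict_add mderiv_add)
qed

text \<open>For the other roots the form stays nonzero on the stratum, so the defining equation can
  be restricted and then divided; equivariance evaluates the reflected term.\<close>

lemma restrict_ddiff:
  assumes "i \<in> I" "(j, \<tau>) \<in> roots i" "(cl j, \<tau>) \<noteq> (cl i, 1)" "equivariant e g"
    and v: "\<And>i. i \<in> I \<Longrightarrow> restrict (g i) = v (cl i)"
  shows "restrict (ddiff i j \<tau> (g i)) = (v (cl i) - Cst (\<tau> ^ e) * v (cl j)) / (u (cl i) - Cst \<tau> * u (cl j))"
proof -
  have j: "j \<in> I" "\<tau> \<in> S" using assms(2) by (auto simp: mem_roots)
  have "reflect i j \<tau> (g i) = K (\<tau> ^ e) * g j"
    using assms(1,4) j by (simp add: equivariant_def sgn_at_def sw_def)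
  then have "restrict (root_form i j \<tau>) * restrict (ddiff i j \<tau> (g i)) = v (cl i) - Cst (\<tau> ^ e) * v (cl j)"
    unfolding restrict_mult[symmetric] root_ddiff[OF is_root[OF assms(2)]]
    using assms(1) j by (simp add: restrict_diff restrict_mult v)
  moreover have "restrict (root_form i j \<tau>) = u (cl i) - Cst \<tau> * u (cl j)"
    using assms(1) j by (simp add: root_form_def restrict_diff restrict_mult restrict_X)
  moreover have "u (cl i) - Cst \<tau> * u (cl j) \<noteq> 0"
    using assms(1,3) j cl by (intro u_diff_nonzero) (auto simp: R_def)
  ultimately show ?thesis by (simp add: field_simps)
qed

lemma sum_mult_fibre:
  assumes "i \<in> I" "(b, \<tau>) \<in> R (cl i)"
  shows "(\<Sum>j\<in>{j \<in> I. cl j = b}. mult i j) = \<Gamma> (cl i) b"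
proof -
  have b: "b \<in> {1..M}" using assms(2) by (auto simp: R_def)
  show ?thesis
  proof (cases "cl i = b")
    case True
    have "(\<Sum>j\<in>{j \<in> I. cl j = b}. mult i j) = q + (\<Sum>j\<in>{j \<in> I. cl j = b} - {i}. mult i j)"
      using assms(1) True by (subst sum.remove[of _ i]) (auto simp: finite_I mult_def)
    also have "(\<Sum>j\<in>{j \<in> I. cl j = b} - {i}. mult i j) = (\<Sum>j\<in>{j \<in> I. cl j = b} - {i}. c)"
      by (intro sum.cong) (auto simp: mult_def)
    also have "\<dots> = of_nat (\<mu> b - 1) * c"
      using assms(1) True by (simp add: card_Diff_singleton card_fibre[OF b])
    also have "of_nat (\<mu> b - 1) = (of_nat (\<mu> b) - 1 :: complex)"
      using \<mu>_pos[OF b] by (simp add: of_nat_diff)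
    finally show ?thesis using True by (simp add: \<Gamma>_def mult.commute)
  next
    case False
    then have "(\<Sum>j\<in>{j \<in> I. cl j = b}. mult i j) = (\<Sum>j\<in>{j \<in> I. cl j = b}. c)"
      by (intro sum.cong) (auto simp: mult_def)
    with False show ?thesis by (simp add: \<Gamma>_def card_fibre[OF b] mult.commute)
  qed
qed

lemma restrict_D:
  assumes i: "i \<in> I" and equi: "equivariant e g" and v: "\<And>i. i \<in> I \<Longrightarrow> restrict (g i) = v (cl i)"
  shows "restrict (D i (g i)) = E e v (cl i)"
proof -
  define a where "a = cl i"
  have a: "a \<in> {1..M}" using cl[OF i] by (simp add: a_def)
  define F where "F = {j \<in> I. cl j = a}"
  define x where "x j = restrict (mderiv j (g i))" for j
  define quot where "quot b \<tau> = (v a - Cst (\<tau> ^ e) * v b) / (u a - Cst \<tau> * u b)" for b \<tau>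
  have fin: "finite F" and iF: "i \<in> F" by (auto simp: F_def finite_I a_def i)
  \<comment> \<open>The roots inside the cluster of \<open>i\<close> whose form vanishes on the
    stratum; they replace the single derivative \<open>x i\<close> by the mean derivative.\<close>
  define P1 where "P1 = (F - {i}) \<times> {1 :: complex}"
  define P2 where "P2 = roots i - P1"
  have P1: "P1 \<subseteq> roots i" by (auto simp: P1_def mem_roots F_def one_in_S)
  have dv: "of_nat (\<mu> a) * d a (v a) = (\<Sum>j\<in>F. x j)"
    using d_restrict[OF a, of "g i"] v[OF i] by (simp add: F_def a_def x_def)
  have 1: "(\<Sum>(j, \<tau>)\<in>P1. Cst (mult i j) * restrict (ddiff i j \<tau> (g i))) = x i - d a (v a)"
  proof -
    have "(\<Sum>(j, \<tau>)\<in>P1. Cst (mult i j) * restrict (ddiff i j \<tau> (g i))) = (\<Sum>j\<in>F - {i}. Cst (mult i j) * restrict (ddiff i j 1 (g i)))"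
      unfolding P1_def by (simp flip: sum.cartesian_product)
    also have "\<dots> = (\<Sum>j\<in>F - {i}. Cst c * (x i - x j))"
      by (intro sum.cong refl) (auto simp: x_def F_def a_def mult_def i restrict_ddiff_same_fibre)
    also have "\<dots> = (\<Sum>j\<in>F. Cst c * (x i - x j))"
      using fin iF by (simp add: sum.remove[of F i])
    also have "\<dots> = Cst c * (of_nat (\<mu> a) * x i - of_nat (\<mu> a) * d a (v a))"
      using card_fibre[OF a] unfolding dv by (simp add: sum_subtractf F_def flip: sum_distrib_left)
    also have "\<dots> = x i - d a (v a)"
    \<comment> \<open>Otherwise the cluster is a single particle, whose derivative is already the
      mean.\<close>
    proof (cases "c * of_nat (\<mu> a) = 1")
      case True
      then have "Cst c * of_nat (\<mu> a) = 1" by (metis Cst_1 Cst_mult Cst_of_nat)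
      then show ?thesis by (simp flip: right_diff_distrib mult.assoc)
    next
      case False
      then have "\<mu> a = 1" using mass[OF a] by simp
      moreover from this have "F = {i}"
        using card_fibre[OF a] iF unfolding F_def[symmetric] by (auto simp: card_1_singleton_iff)
      ultimately show ?thesis using dv by simp
    qed
    finally show ?thesis .
  qed
  have "(\<Sum>(j, \<tau>)\<in>P2. Cst (mult i j) * restrict (ddiff i j \<tau> (g i))) = (\<Sum>(j, \<tau>)\<in>P2. Cst (mult i j) * quot (cl j) \<tau>)"
  proof (intro sum.cong refl, clarify)
    fix j \<tau> assume "(j, \<tau>) \<in> P2"
    then have "(j, \<tau>) \<in> roots i" "(cl j, \<tau>) \<noteq> (cl i, 1)" by (auto simp: P2_def P1_def F_def a_def mem_roots)
    then show "Cst (mult i j) * restrict (ddiff i j \<tau> (g i)) = Cst (mult i j) * quot (cl j) \<tau>"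
      using restrict_ddiff[OF i _ _ equi v] by (simp add: quot_def a_def)
  qed
  also have "\<dots> = (\<Sum>(b, \<tau>)\<in>R a. \<Sum>x\<in>{x \<in> P2. (cl (fst x), snd x) = (b, \<tau>)}. Cst (mult i (fst x)) * quot (cl (fst x)) (snd x))"
    unfolding case_prod_unfold prod.collapse
    by (rule sum.group[symmetric])
       (use cl in \<open>auto simp: finite_S P2_def finite_roots R_def mem_roots P1_def F_def\<close>)
  also have "\<dots> = (\<Sum>(b, \<tau>)\<in>R a. Cst (\<Gamma> a b) * quot b \<tau>)"
  proof (intro sum.cong refl, clarify)
    fix b \<tau> assume b: "(b, \<tau>) \<in> R a"
    have set: "{x \<in> P2. (cl (fst x), snd x) = (b, \<tau>)} = {j \<in> I. cl j = b} \<times> {\<tau>}"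
      using b by (auto simp: P2_def P1_def F_def mem_roots R_def a_def)
    have "(\<Sum>x\<in>{x \<in> P2. (cl (fst x), snd x) = (b, \<tau>)}. Cst (mult i (fst x)) * quot (cl (fst x)) (snd x))
      = (\<Sum>j\<in>{j \<in> I. cl j = b}. Cst (mult i j)) * quot b \<tau>"
      unfolding set sum_distrib_right
      by (rule sum.reindex_bij_witness[where i = "\<lambda>j. (j, \<tau>)" and j = fst]) auto
    also have "(\<Sum>j\<in>{j \<in> I. cl j = b}. Cst (mult i j)) = Cst (\<Sum>j\<in>{j \<in> I. cl j = b}. mult i j)"
      by (rule Cst.e_sum[symmetric])
    also have "\<dots> = Cst (\<Gamma> a b)" using sum_mult_fibre[OF i, of b \<tau>] b by (simp add: a_def)
    finally show "(\<Sum>x\<in>{x \<in> P2. (cl (fst x), snd x) = (b, \<tau>)}. Cst (mult i (fst x)) * quot (cl (fst x)) (snd x))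
      = Cst (\<Gamma> a b) * quot b \<tau>" .
  qed
  finally have 2: "(\<Sum>(j, \<tau>)\<in>P2. Cst (mult i j) * restrict (ddiff i j \<tau> (g i))) = (\<Sum>(b, \<tau>)\<in>R a. Cst (\<Gamma> a b) * quot b \<tau>)" .
  have "restrict (D i (g i)) = x i - (\<Sum>(j, \<tau>)\<in>roots i. Cst (mult i j) * restrict (ddiff i j \<tau> (g i)))"
    by (simp add: D_def restrict_diff restrict_sum restrict_mult case_prod_unfold x_def)
  also have "(\<Sum>(j, \<tau>)\<in>roots i. Cst (mult i j) * restrict (ddiff i j \<tau> (g i)))
    = x i - d a (v a) + (\<Sum>(b, \<tau>)\<in>R a. Cst (\<Gamma> a b) * quot b \<tau>)"
    unfolding 1[symmetric] 2[symmetric] P2_def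
    by (subst sum.subset_diff[OF P1 finite_roots]) (rule add.commute)
  finally show ?thesis by (simp add: E_def quot_def a_def)
qed

lemma restrict_A:
  assumes "i \<in> I" "equivariant e g" "\<And>i. i \<in> I \<Longrightarrow> restrict (g i) = v (cl i)"
  shows "restrict (A t i (g i)) = B t e v (cl i)"
  using assms by (simp add: A_def B_def restrict_add restrict_mult restrict_X restrict_D)

lemma equivariant_A: "equivariant e g \<Longrightarrow> equivariant (Suc e) (\<lambda>i. A t i (g i))"
  by (simp add: equivariant_def reflect_A A_K_mult K_mult mult.assoc)

lemma restrict_h_power:
  assumes "invariant f"
  shows "equivariant 0 (\<lambda>i. (h i ^^ r) f) \<and> (\<forall>i\<in>I. restrict ((h i ^^ r) f) = (h_vec ^^ r) (\<lambda>_. restrict f) (cl i))"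
proof (induction r)
  case 0
  then show ?case using assms by (simp add: equivariant_def invariant_def)
next
  case (Suc r)
  define g where "g i = (h i ^^ r) f" for i
  define v where "v = (h_vec ^^ r) (\<lambda>_. restrict f)"
  have 0: "equivariant 0 g" "\<And>i. i \<in> I \<Longrightarrow> restrict (g i) = v (cl i)"
    using Suc by (simp_all add: g_def[abs_def] v_def)
  have 1: "equivariant 1 (\<lambda>i. A (-1) i (g i))" "\<And>i. i \<in> I \<Longrightarrow> restrict (A (-1) i (g i)) = B (-1) 0 v (cl i)"
    using equivariant_A[OF 0(1)] restrict_A[OF _ 0] by simp_all
  have 2: "equivariant 2 (\<lambda>i. h i (g i))" "\<And>i. i \<in> I \<Longrightarrow> restrict (h i (g i)) = h_vec v (cl i)"
    using equivariant_A[OF 1(1), of 1] restrict_A[OF _ 1, of _ 1] by (simp_all add: h_def h_vec_def numeral_2_eq_2)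
  \<comment> \<open>Two ladder operators contribute the square of a sign, so the parity returns to
    0.\<close>
  have "equivariant 0 (\<lambda>i. h i (g i))"
    using 2(1) unfolding equivariant_def by (simp add: power2_eq_square K_mult K_sgn_at_square S_square)
  with 2(2) show ?case by (simp add: g_def v_def)
qed

lemma restrict_integral:
  assumes "invariant f"
  shows "restrict (integral r f) = T r (restrict f)"
proof -
  have "restrict (integral r f) = (\<Sum>i\<in>I. (h_vec ^^ r) (\<lambda>_. restrict f) (cl i))"
    using restrict_h_power[OF assms] by (simp add: integral_def restrict_sum)
  then show ?thesis by (simp add: T_def sum_over_I)
qed

end

section \<open>The restricted integrals\<close>

context stratum
begin

text \<open>On rational functions the quotients can be split, leaving one derivative and a matrix of
  coefficients. Both the closure properties and the symbols of the integrals are read off from this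
  form.\<close>

lemma B_expand:
  assumes a: "a \<in> {1..M}"
  obtains k where "\<And>b. k b \<in> ratfuns M"
    "\<And>v. B t e v a = Cst (s a) * partial a (v a) + (\<Sum>b=1..M. k b * v b)"
proof -
  define w where "w b \<tau> = Cst (\<Gamma> a b) / (u a - Cst \<tau> * u b)" for b \<tau>
  define k where "k b = (if b = a then Cst (t * \<omega>) * u a - (\<Sum>(b, \<tau>)\<in>R a. w b \<tau>) else 0)
     + (\<Sum>\<tau>\<in>{\<tau> \<in> S. (b, \<tau>) \<in> R a}. w b \<tau> * Cst (\<tau> ^ e))" for b
  have w: "w b \<tau> \<in> ratfuns M" if "(b, \<tau>) \<in> R a" for b \<tau>
    unfolding w_def using that
    by (intro ratfuns_divide ratfuns_diff ratfuns_mult ratfuns_Cst u_in_ratfuns a) (simp add: R_def)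
  have "(\<Sum>(b, \<tau>)\<in>R a. w b \<tau>) \<in> ratfuns M"
    "(\<Sum>\<tau>\<in>{\<tau> \<in> S. (b, \<tau>) \<in> R a}. w b \<tau> * Cst (\<tau> ^ e)) \<in> ratfuns M" for b
    using w by (auto intro!: ratfuns_sum)
  then have "k b \<in> ratfuns M" for b
    unfolding k_def using u_in_ratfuns[OF a] by (simp add: ratfuns_add ratfuns_diff ratfuns_mult)
  moreover have "B t e v a = Cst (s a) * partial a (v a) + (\<Sum>b=1..M. k b * v b)" for v
  proof -
    have "(\<Sum>(b, \<tau>)\<in>R a. w b \<tau> * Cst (\<tau> ^ e) * v b) = (\<Sum>b=1..M. \<Sum>\<tau>\<in>{\<tau> \<in> S. (b, \<tau>) \<in> R a}. w b \<tau> * Cst (\<tau> ^ e) * v b)"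
      by (subst sum.Sigma) (auto simp: finite_S R_def intro!: sum.cong)
    also have "\<dots> = (\<Sum>b=1..M. (\<Sum>\<tau>\<in>{\<tau> \<in> S. (b, \<tau>) \<in> R a}. w b \<tau> * Cst (\<tau> ^ e)) * v b)"
      by (simp add: sum_distrib_right)
    finally have 1: "(\<Sum>b=1..M. (\<Sum>\<tau>\<in>{\<tau> \<in> S. (b, \<tau>) \<in> R a}. w b \<tau> * Cst (\<tau> ^ e)) * v b) =
      (\<Sum>(b, \<tau>)\<in>R a. w b \<tau> * Cst (\<tau> ^ e) * v b)" ..
    have 2: "(\<Sum>b=1..M. (if b = a then x else 0) * v b) = x * v a" for x
      using a by (subst sum.remove[of _ a]) auto
    have 3: "Cst (\<Gamma> a b) * ((v a - Cst (\<tau> ^ e) * v b) / (u a - Cst \<tau> * u b))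
      = w b \<tau> * v a - w b \<tau> * Cst (\<tau> ^ e) * v b" for b \<tau>
      by (simp add: w_def diff_divide_distrib right_diff_distrib)
    show ?thesis
      unfolding k_def distrib_right sum.distrib 1 2 B_def E_def d_def 3
      by (simp add: sum_subtractf sum_distrib_left sum_distrib_right case_prod_unfold algebra_simps)
  qed
  ultimately show thesis by (rule that)
qed

lemma h_vec_Suc: "(h_vec ^^ Suc r) v = B 1 1 (B (-1) 0 ((h_vec ^^ r) v))"
  by (simp add: h_vec_def[of "(h_vec ^^ r) v"])

text \<open>An induction principle for operators assembled from multiplications and derivatives; it
  gives the differential form and the finite order alike.\<close>

lemma h_vec_op_closed:
  assumes mult: "\<And>w. w \<in> ratfuns M \<Longrightarrow> P ((*) w)" and scale: "\<And>w L. w \<in> ratfuns M \<Longrightarrow> P L \<Longrightarrow> P (\<lambda>f. w * L f)"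
    and add: "\<And>L L'. P L \<Longrightarrow> P L' \<Longrightarrow> P (\<lambda>f. L f + L' f)"
    and partial: "\<And>i L. i \<in> {1..M} \<Longrightarrow> P L \<Longrightarrow> P (\<lambda>f. partial i (L f))"
  shows "P (T r)"
proof -
  have "(*) 0 = (\<lambda>f :: ratfun. 0)" "(*) 1 = (\<lambda>f :: ratfun. f)" by auto
  then have zero: "P (\<lambda>f. 0)" and one: "P (\<lambda>f. f)"
    using mult[OF ratfuns_0] mult[OF ratfuns_1] by simp_all
  have sum: "P (\<lambda>f. \<Sum>x\<in>J. L x f)" if "\<And>x. x \<in> J \<Longrightarrow> P (L x)" for J and L :: "nat \<Rightarrow> ratfun \<Rightarrow> ratfun"
    using that by (induction J rule: infinite_finite_induct) (auto intro: zero add)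
  have B: "P (\<lambda>f. B t e (V f) a)" if V: "\<And>b. b \<in> {1..M} \<Longrightarrow> P (\<lambda>f. V f b)" and a: "a \<in> {1..M}" for t e V a
  proof -
    obtain k where k: "\<And>b. k b \<in> ratfuns M"
      and expand: "\<And>v. B t e v a = Cst (s a) * partial a (v a) + (\<Sum>b=1..M. k b * v b)"
      using B_expand[OF a] by blast
    show ?thesis
      unfolding expand by (intro add scale sum partial V a k ratfuns_Cst)
  qed
  have "\<forall>a\<in>{1..M}. P (\<lambda>f. (h_vec ^^ r) (\<lambda>_. f) a)"
  proof (induction r)
    case 0
    show ?case using one by simp
  next
    case (Suc r)
    define V where "V f = (h_vec ^^ r) (\<lambda>_. f)" for f
    have "P (\<lambda>f. B (-1) 0 (V f) a)" if "a \<in> {1..M}" for a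
      using Suc that by (intro B[of V]) (auto simp: V_def)
    then have "P (\<lambda>f. B 1 1 (B (-1) 0 (V f)) a)" if "a \<in> {1..M}" for a
      using that by (intro B[of "\<lambda>f. B (-1) 0 (V f)"])
    then show ?case unfolding h_vec_Suc V_def by blast
  qed
  then have "P (\<lambda>f. of_nat (\<mu> a) * (h_vec ^^ r) (\<lambda>_. f) a)" if "a \<in> {1..M}" for a
    using that by (intro scale ratfuns_of_nat) blast
  then show ?thesis
    unfolding T_def[abs_def] by (rule sum)
qed

lemma diff_op_T: "diff_op M (T r)"
  by (rule h_vec_op_closed) (auto intro: diff_op_mult diff_op_scale diff_op_add diff_op_partial)

lemma finite_order_T: "finite_order M (T r)"
  by (rule h_vec_op_closed)
     (auto intro: finite_order_mult finite_order_comp[OF finite_order_mult] finite_order_add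
       finite_order_comp[OF finite_order_partial])

lemma linear_op_T: "linear_op M (T r)"
  using finite_order_T by (simp add: finite_order_def)

lemma T_in_ratfuns: "f \<in> ratfuns M \<Longrightarrow> T r f \<in> ratfuns M"
  using linear_opD(1)[OF linear_op_T] .

lemma restrict_power_sum: "restrict (\<Sum>i\<in>I. X i ^ (2 * r)) = psum r"
  using sum_over_I[of "\<lambda>a. u a ^ (2 * r)"]
  by (simp add: restrict_sum restrict_power restrict_X psum_def cong: sum.cong)

text \<open>On restrictions of invariant polynomials the operators commute, and these detect all operators.\<close>

lemma T_commute:
  assumes f: "f \<in> ratfuns M"
  shows "T r (T r' f) = T r' (T r f)"
proof -
  \<comment> \<open>The commutator, written as a sum because finite order is available for sums and
    compositions.\<close>
  define C where "C f = T r (T r' f) + Cst (- 1) * T r' (T r f)" for f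
  have "finite_order M C"
    unfolding C_def[abs_def]
    by (intro finite_order_add finite_order_comp[OF finite_order_mult] finite_order_comp[OF finite_order_T] finite_order_T ratfuns_Cst)
  then obtain d where C: "linear_op M C" "order_less M d C" by (auto simp: finite_order_def)
  have "C f = 0"
  proof (rule operator_eq_0_if_vanishes[OF C, of "restrict ` Collect invariant"])
    show "1 \<in> restrict ` Collect invariant"
      using invariant_1 by (metis imageI mem_Collect_eq restrict_1)
    show "psum r \<in> restrict ` Collect invariant" for r
      using invariant_power_sum[of r] by (metis imageI mem_Collect_eq restrict_power_sum)
    show "f * g \<in> restrict ` Collect invariant"
      if "f \<in> restrict ` Collect invariant" "g \<in> restrict ` Collect invariant" for f g
    proof -
      from that obtain p p' where "invariant p" "invariant p'" "f = restrict p" "g = restrict p'" by auto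
      then have "f * g = restrict (p * p')" "invariant (p * p')" by (simp_all add: restrict_mult invariant_mult)
      then show ?thesis by blast
    qed
    show "C f = 0" if fA: "f \<in> restrict ` Collect invariant" for f
    proof -
      from fA obtain p where p: "invariant p" "f = restrict p" by auto
      have "restrict (integral r (integral r' p)) = restrict (integral r' (integral r p))"
        using integral_commute[OF p(1)] by simp
      then show ?thesis
        using p by (simp add: restrict_integral invariant_integral C_def Cst_minus)
    qed
  qed (use restrict_in_ratfuns f in auto)
  then show ?thesis by (simp add: C_def Cst_minus)
qed

text \<open>With \<partial>_a g = y_a, the symbol of \<open>d a\<close> at the differential of
  \<open>g\<close> is exactly \<open>u a\<close>.\<close>

definition g where "g = Cst (1/2) * (\<Sum>a=1..M. Y a ^ 2)"

lemma g_in_ratfuns: "g \<in> ratfuns M"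
  unfolding g_def by (intro ratfuns_mult ratfuns_sum ratfuns_power ratfuns_Y ratfuns_Cst)

lemma partial_g:
  assumes "a \<in> {1..M}"
  shows "partial a g = Y a"
proof -
  have "partial a (\<Sum>b=1..M. Y b ^ 2) = (\<Sum>b=1..M. if b = a then Cst 2 * Y a else 0)"
    unfolding partial_sum using Cst_of_nat[of 2]
    by (intro sum.cong) (auto simp: power2_eq_square partial_mult partial_Y)
  also have "\<dots> = Cst 2 * Y a" using assms by simp
  finally show ?thesis by (simp add: g_def partial_Cst_mult flip: mult.assoc Cst_mult)
qed

text \<open>Each \<open>B\<close> raises the degree by one and multiplies component a by u_a; its
  matrix part has lower degree and so symbol 0.\<close>

lemma symbol_T: "symbol M g (2 * r) (T r) (psum r)"
proof -
  note symbol_scale = symbol_comp[OF g_in_ratfuns linear_op_mult, where d = 0, unfolded add_0]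
  have B: "linear_op M (\<lambda>f. B t e (V f) a) \<and> symbol M g (Suc n) (\<lambda>f. B t e (V f) a) (u a * w a)"
    if V: "\<And>b. b \<in> {1..M} \<Longrightarrow> linear_op M (\<lambda>f. V f b) \<and> symbol M g n (\<lambda>f. V f b) (w b)"
      and a: "a \<in> {1..M}" for t e V a n w
  proof -
    obtain k where k: "\<And>b. k b \<in> ratfuns M" and
      B: "\<And>v. B t e v a = Cst (s a) * partial a (v a) + (\<Sum>b=1..M. k b * v b)"
      using B_expand[OF a] by blast
    have lin: "linear_op M (\<lambda>f. k b * V f b)" if "b \<in> {1..M}" for b
      using linear_op_comp[OF linear_op_mult[OF k] conjunct1[OF V[OF that]]] .
    have lin': "linear_op M (\<lambda>f. partial a (V f a))"
      using linear_op_comp[OF linear_op_partial conjunct1[OF V[OF a]]] .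
    have "symbol M g (Suc n) (\<lambda>f. k b * V f b) 0" if "b \<in> {1..M}" for b
    proof (rule symbol_Suc[OF g_in_ratfuns])
      show "symbol M g n (\<lambda>f. k b * V f b) (k b * w b)"
        using V[OF that] by (intro symbol_scale[OF k]) simp_all
    qed
    then have 1: "symbol M g (Suc n) (\<lambda>f. \<Sum>b=1..M. k b * V f b) (\<Sum>b=1..M. 0)"
      by (intro symbol_sum[OF g_in_ratfuns])
    have "symbol M g (Suc 0 + n) (\<lambda>f. partial a (V f a)) (Y a * w a)"
    proof (rule symbol_comp[OF g_in_ratfuns linear_op_partial])
      show "symbol M g (Suc 0) (partial a) (Y a)"
        using symbol_partial[OF g_in_ratfuns, of a] unfolding partial_g[OF a] .
    qed (use V[OF a] in auto)
    then have 2: "symbol M g (Suc n) (\<lambda>f. Cst (s a) * partial a (V f a)) (Cst (s a) * (Y a * w a))"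
      by (intro symbol_scale lin') simp_all
    have "linear_op M (\<lambda>f. \<Sum>b=1..M. k b * V f b)"
      by (rule linear_op_sum_ops[OF lin])
    moreover have "linear_op M (\<lambda>f. Cst (s a) * partial a (V f a))"
      by (rule linear_op_comp[OF linear_op_mult lin']) simp
    ultimately have "linear_op M (\<lambda>f. Cst (s a) * partial a (V f a) + (\<Sum>b=1..M. k b * V f b))"
      by (rule linear_op_add[rotated])
    with symbol_add[OF g_in_ratfuns 2 1] show ?thesis
      unfolding B u_def by (simp add: mult.assoc)
  qed
  have "\<forall>a\<in>{1..M}. linear_op M (\<lambda>f. (h_vec ^^ r) (\<lambda>_. f) a) \<and> symbol M g (2 * r) (\<lambda>f. (h_vec ^^ r) (\<lambda>_. f) a) (u a ^ (2 * r))"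
  proof (induction r)
    case 0
    then show ?case by (simp add: linear_op_def)
  next
    case (Suc r)
    define V where "V = (\<lambda>f. (h_vec ^^ r) (\<lambda>_. f))"
    have V: "linear_op M (\<lambda>f. V f a) \<and> symbol M g (2 * r) (\<lambda>f. V f a) (u a ^ (2 * r))" if "a \<in> {1..M}" for a
      using Suc that by (simp add: V_def)
    have 1: "linear_op M (\<lambda>f. B (-1) 0 (V f) a) \<and> symbol M g (Suc (2 * r)) (\<lambda>f. B (-1) 0 (V f) a) (u a * u a ^ (2 * r))"
      if "a \<in> {1..M}" for a
      by (rule B[of V, OF V that])
    have "linear_op M (\<lambda>f. B 1 1 (B (-1) 0 (V f)) a) \<and> symbol M g (Suc (Suc (2 * r))) (\<lambda>f. B 1 1 (B (-1) 0 (V f)) a) (u a * (u a * u a ^ (2 * r)))"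
      if "a \<in> {1..M}" for a
      by (rule B[of "\<lambda>f. B (-1) 0 (V f)" "Suc (2 * r)", OF 1 that])
    then show ?case unfolding h_vec_Suc V_def by simp
  qed
  then have "symbol M g (2 * r) (\<lambda>f. of_nat (\<mu> a) * (h_vec ^^ r) (\<lambda>_. f) a) (of_nat (\<mu> a) * u a ^ (2 * r))" if "a \<in> {1..M}" for a
    using that by (intro symbol_scale) simp_all
  then show ?thesis
    unfolding T_def[abs_def] psum_def by (rule symbol_sum[OF g_in_ratfuns])
qed

text \<open>A constant added to the first integral affects neither the commutators nor the symbol,
  whose degree is positive.\<close>

lemma quantum_integrableI:
  assumes "1 \<le> M" and L: "\<And>f. f \<in> ratfuns M \<Longrightarrow> L f = T 1 f + Cst \<kappa> * f"
  shows "quantum_integrable M L"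
proof -
  define T' where "T' i = (if i = 1 then L else T i)" for i
  define \<kappa>' where "\<kappa>' i = (if i = 1 then \<kappa> else 0)" for i :: nat
  have T': "T' i f = T i f + Cst (\<kappa>' i) * f" if "f \<in> ratfuns M" for i f
    using L that by (simp add: T'_def \<kappa>'_def)
  have lin: "linear_op M (T' i)" for i
    using linear_opD[OF linear_op_T[of i]] unfolding linear_op_def
    by (auto simp: T' ratfuns_add ratfuns_mult algebra_simps)
  have "diff_op M (T' i)" for i
    by (rule diff_op_cong[OF diff_op_add[OF diff_op_T diff_op_mult[of "Cst (\<kappa>' i)"]]]) (simp_all add: T')
  moreover have "ops_commute M (T' i) (T' j)" for i j
    unfolding ops_commute_def
  proof
    fix f assume f: "f \<in> ratfuns M"
    have "T' i (T' j f) = T i (T j f) + Cst (\<kappa>' j) * T i f + Cst (\<kappa>' i) * (T j f + Cst (\<kappa>' j) * f)" for i j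
      using f by (simp add: T' T_in_ratfuns ratfuns_add ratfuns_mult linear_opD[OF linear_op_T])
    then show "T' i (T' j f) = T' j (T' i f)"
      using T_commute[OF f, of i j] by (simp add: algebra_simps)
  qed
  moreover have "alg_independent_ops M T'"
  proof (rule alg_independent_opsI[OF lin g_in_ratfuns])
    fix i assume i: "i \<in> {1..M}"
    have "symbol M g 0 (\<lambda>f. Cst (\<kappa>' i) * f) (Cst (\<kappa>' i))" by simp
    then have "symbol M g (2 * i) (\<lambda>f. Cst (\<kappa>' i) * f) 0"
      by (rule symbol_less[OF g_in_ratfuns]) (use i in simp)
    from symbol_add[OF g_in_ratfuns symbol_T this]
    show "symbol M g (2 * i) (T' i) (psum i)"
      by (subst symbol_cong[OF g_in_ratfuns, of _ "\<lambda>f. T i f + Cst (\<kappa>' i) * f"]) (simp_all add: T')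
  qed (rule algebraic_independence_psum)
  moreover have "T' 1 = L" by (simp add: T'_def)
  ultimately show ?thesis unfolding quantum_integrable_def by blast
qed

lemma T_1:
  obtains \<kappa> where "\<And>f. T 1 f = (\<Sum>a=1..M. partial a (partial a f))
    - (\<Sum>a=1..M. \<Sum>(b, \<tau>)\<in>R a. Cst (of_nat (\<mu> a) * \<Gamma> a b) * ((d a f - Cst \<tau> * d b f) / (u a - Cst \<tau> * u b)))
    - Cst (\<omega>\<^sup>2) * (\<Sum>a=1..M. (Y a)\<^sup>2) * f - Cst \<kappa> * f"
proof
  \<comment> \<open>The term s_a^2 comes from differentiating \<omega> u_a f, and the multiplicities
    from the quotients of \<omega> u_a - \<tau> \<omega> u_b by the root forms.\<close>
  define \<kappa> where "\<kappa> = \<omega> * (\<Sum>a=1..M. of_nat (\<mu> a) * (s a * s a - (\<Sum>(b, \<tau>)\<in>R a. \<Gamma> a b)))"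
  fix f
  define W where "W a = (\<Sum>(b, \<tau>)\<in>R a. Cst (\<Gamma> a b) * ((d a f - Cst \<tau> * d b f) / (u a - Cst \<tau> * u b)))" for a
  have h: "of_nat (\<mu> a) * h_vec (\<lambda>_. f) a = partial a (partial a f) - of_nat (\<mu> a) * W a - Cst (\<omega>\<^sup>2) * (Y a)\<^sup>2 * f
      - Cst (\<omega> * (of_nat (\<mu> a) * (s a * s a - (\<Sum>(b, \<tau>)\<in>R a. \<Gamma> a b)))) * f"
    if a: "a \<in> {1..M}" for a
  proof -
    \<comment> \<open>In parity 0 a constant vector has vanishing difference quotients, so only the
      derivative and the oscillator term remain.\<close>
    have B0: "B (-1) 0 (\<lambda>_. f) = (\<lambda>b. d b f - Cst \<omega> * (u b * f))"
      by (simp add: B_def E_def fun_eq_iff Cst_minus)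
    have sum: "(\<Sum>(b, \<tau>)\<in>R a. Cst (\<Gamma> a b) * (((d a f - Cst \<omega> * (u a * f)) - Cst (\<tau> ^ 1) * (d b f - Cst \<omega> * (u b * f))) / (u a - Cst \<tau> * u b)))
      = W a - Cst \<omega> * Cst (\<Sum>(b, \<tau>)\<in>R a. \<Gamma> a b) * f"
    proof -
      have "Cst (\<Gamma> a b) * (((d a f - Cst \<omega> * (u a * f)) - Cst (\<tau> ^ 1) * (d b f - Cst \<omega> * (u b * f))) / (u a - Cst \<tau> * u b))
        = Cst (\<Gamma> a b) * ((d a f - Cst \<tau> * d b f) / (u a - Cst \<tau> * u b)) - Cst \<omega> * Cst (\<Gamma> a b) * f"
        if "(b, \<tau>) \<in> R a" for b \<tau>
      proof -
        have numerator: "(d a f - Cst \<omega> * (u a * f)) - Cst (\<tau> ^ 1) * (d b f - Cst \<omega> * (u b * f))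
          = (d a f - Cst \<tau> * d b f) - Cst \<omega> * f * (u a - Cst \<tau> * u b)"
          by (simp add: algebra_simps)
        have "x * ((y - w * f * z) / z) = x * (y / z) - w * x * f" if "z \<noteq> 0" for x y z w :: ratfun
          using that by (simp add: field_simps)
        then show ?thesis unfolding numerator using u_diff_nonzero[OF a that] .
      qed
      then have "(\<Sum>(b, \<tau>)\<in>R a. Cst (\<Gamma> a b) * (((d a f - Cst \<omega> * (u a * f)) - Cst (\<tau> ^ 1) * (d b f - Cst \<omega> * (u b * f))) / (u a - Cst \<tau> * u b)))
        = (\<Sum>(b, \<tau>)\<in>R a. Cst (\<Gamma> a b) * ((d a f - Cst \<tau> * d b f) / (u a - Cst \<tau> * u b)) - Cst \<omega> * Cst (\<Gamma> a b) * f)"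
        by (intro sum.cong) auto
      then show ?thesis
        by (simp add: W_def case_prod_unfold sum_subtractf Cst.e_sum sum_distrib_left sum_distrib_right)
    qed
    have d: "d a (d a f - Cst \<omega> * (u a * f)) = Cst (s a * s a) * partial a (partial a f) - Cst \<omega> * (Cst (s a * s a) * f + u a * d a f)"
      by (simp add: d_def partial_diff partial_Cst partial_mult partial_u Cst_mult algebra_simps)
    have "h_vec (\<lambda>_. f) a = Cst (s a * s a) * partial a (partial a f) - W a - Cst (\<omega> * \<omega>) * (u a * u a) * f
      - Cst \<omega> * (Cst (s a * s a) - Cst (\<Sum>(b, \<tau>)\<in>R a. \<Gamma> a b)) * f"
      unfolding h_vec_def B0 B_def[of 1] E_def sum d by (simp add: Cst_mult algebra_simps)
    moreover have "u a * u a = Cst (s a * s a) * (Y a * Y a)" by (simp add: u_def Cst_mult mult_ac)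
    \<comment> \<open>Here x is the mass \<mu>_a and t is s_a^2; their product is 1.\<close>
    moreover have "x * (t * p - y - w * (t * z) * f - v) = (x * t) * p - x * y - w * z * f * (x * t) - x * v"
      for x t p y w z v :: ratfun by (simp add: algebra_simps)
    moreover have "of_nat (\<mu> a) * Cst (s a * s a) = 1"
      using s_square[OF a] by (metis Cst_1 Cst_mult Cst_of_nat)
    moreover have "of_nat (\<mu> a) * (Cst \<omega> * (Cst (s a * s a) - Cst (\<Sum>(b, \<tau>)\<in>R a. \<Gamma> a b)) * f)
      = Cst (\<omega> * (of_nat (\<mu> a) * (s a * s a - (\<Sum>(b, \<tau>)\<in>R a. \<Gamma> a b)))) * f"
      by (simp only: Cst_mult Cst.e_diff Cst_of_nat mult_ac)
    ultimately show ?thesis by (simp only: power2_eq_square mult_1_left mult_1_right)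
  qed
  have "T 1 f = (\<Sum>a=1..M. partial a (partial a f) - of_nat (\<mu> a) * W a - Cst (\<omega>\<^sup>2) * (Y a)\<^sup>2 * f
      - Cst (\<omega> * (of_nat (\<mu> a) * (s a * s a - (\<Sum>(b, \<tau>)\<in>R a. \<Gamma> a b)))) * f)"
    unfolding T_def by (intro sum.cong refl) (simp add: h)
  also have "\<dots> = (\<Sum>a=1..M. partial a (partial a f)) - (\<Sum>a=1..M. of_nat (\<mu> a) * W a)
    - Cst (\<omega>\<^sup>2) * (\<Sum>a=1..M. (Y a)\<^sup>2) * f - Cst \<kappa> * f"
    unfolding \<kappa>_def sum_distrib_left Cst.e_sum by (simp add: sum_subtractf sum_distrib_left sum_distrib_right)
  also have "(\<Sum>a=1..M. of_nat (\<mu> a) * W a) = (\<Sum>a=1..M. \<Sum>(b, \<tau>)\<in>R a. Cst (of_nat (\<mu> a) * \<Gamma> a b) * ((d a f - Cst \<tau> * d b f) / (u a - Cst \<tau> * u b)))"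
    by (simp add: W_def sum_distrib_left case_prod_unfold Cst_mult Cst_of_nat mult.assoc)
  finally show "T 1 f = (\<Sum>a=1..M. partial a (partial a f))
    - (\<Sum>a=1..M. \<Sum>(b, \<tau>)\<in>R a. Cst (of_nat (\<mu> a) * \<Gamma> a b) * ((d a f - Cst \<tau> * d b f) / (u a - Cst \<tau> * u b)))
    - Cst (\<omega>\<^sup>2) * (\<Sum>a=1..M. (Y a)\<^sup>2) * f - Cst \<kappa> * f" .
qed

end

section \<open>The two Hamiltonians\<close>

text \<open>Each unordered pair is counted twice; this is the source of the factor 2 in the
  Hamiltonians.\<close>

lemma sum_off_diagonal_blocks:
  fixes \<phi> :: "nat \<Rightarrow> nat \<Rightarrow> 'a::comm_ring_1"
  assumes sym: "\<And>a b. a \<in> {1..m + n} \<Longrightarrow> b \<in> {1..m + n} \<Longrightarrow> \<phi> a b = \<phi> b a"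
  shows "(\<Sum>a=1..m + n. \<Sum>b\<in>{1..m + n} - {a}. \<phi> a b) =
    2 * (\<Sum>a=1..m. \<Sum>b=a+1..m. \<phi> a b) + 2 * (\<Sum>a=1..m. \<Sum>b=m+1..m+n. \<phi> a b)
    + 2 * (\<Sum>a=m+1..m+n. \<Sum>b=a+1..m+n. \<phi> a b)"
proof -
  let ?U = "\<Sum>a=1..m + n. \<Sum>b=a+1..m+n. \<phi> a b"
  have "(\<Sum>a=1..m + n. \<Sum>b\<in>{1..m + n} - {a}. \<phi> a b) = (\<Sum>a=1..m + n. (\<Sum>b=a+1..m+n. \<phi> a b) + (\<Sum>b=1..<a. \<phi> a b))"
    by (intro sum.cong refl, subst sum.union_disjoint[symmetric]) (auto intro!: sum.cong)
  also have "\<dots> = ?U + (\<Sum>a=1..m + n. \<Sum>b=1..<a. \<phi> a b)" by (rule sum.distrib)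
  also have "(\<Sum>a=1..m + n. \<Sum>b=1..<a. \<phi> a b) = ?U"
    unfolding sum.Sigma[OF finite_atLeastAtMost ballI[OF finite_atLeastLessThan]]
      sum.Sigma[OF finite_atLeastAtMost ballI[OF finite_atLeastAtMost]]
    by (rule sum.reindex_bij_witness[where i = prod.swap and j = prod.swap]) (auto intro: sym)
  also have "?U = (\<Sum>a=1..m. \<Sum>b=a+1..m+n. \<phi> a b) + (\<Sum>a=m+1..m+n. \<Sum>b=a+1..m+n. \<phi> a b)"
    by (subst sum.union_disjoint[symmetric]) (auto intro!: sum.cong)
  also have "(\<Sum>a=1..m. \<Sum>b=a+1..m+n. \<phi> a b) = (\<Sum>a=1..m. (\<Sum>b=a+1..m. \<phi> a b) + (\<Sum>b=m+1..m+n. \<phi> a b))"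
    by (intro sum.cong refl, subst sum.union_disjoint[symmetric]) (auto intro!: sum.cong)
  finally show ?thesis by (simp add: sum.distrib distrib_left)
qed

definition mass_of :: "nat \<Rightarrow> nat \<Rightarrow> nat \<Rightarrow> nat" where
  "mass_of m k a = (if a \<le> m then k else 1)"

definition scale_of :: "nat \<Rightarrow> nat \<Rightarrow> nat \<Rightarrow> complex" where
  "scale_of m k a = (if a \<le> m then 1 / complex_of_real (sqrt (real k)) else 1)"

text \<open>Variables are indexed by natural numbers, so a pair of a cluster and a position in it is
  encoded as one number.\<close>

definition particles :: "nat \<Rightarrow> nat \<Rightarrow> nat \<Rightarrow> nat set" where
  "particles m n k = prod_encode ` (SIGMA a:{1..m + n}. {..<mass_of m k a})"

definition cluster :: "nat \<Rightarrow> nat" where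
  "cluster i = fst (prod_decode i)"

lemma complex_sqrt_square: "complex_of_real (sqrt (real k)) * complex_of_real (sqrt (real k)) = of_nat k"
  by (simp flip: of_real_mult)

lemma stratum_particles:
  assumes "k > 1" "1 \<in> S" "S \<subseteq> {1, -1}"
  shows "stratum (particles m n k) S (1 / of_nat k) (m + n) (mass_of m k) (scale_of m k) cluster"
proof
  show "finite (particles m n k)" by (simp add: particles_def)
  fix a assume a: "a \<in> {1..m + n}"
  show "mass_of m k a > 0" "scale_of m k a \<noteq> 0" using assms by (simp_all add: mass_of_def scale_of_def)
  have "{i \<in> particles m n k. cluster i = a} = prod_encode ` ({a} \<times> {..<mass_of m k a})"
    using a by (auto simp: particles_def cluster_def)
  then show "card {i \<in> particles m n k. cluster i = a} = mass_of m k a"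
    by (simp add: card_image inj_prod_encode)
  show "of_nat (mass_of m k a) * (scale_of m k a * scale_of m k a) = 1"
    using assms by (simp add: mass_of_def scale_of_def complex_sqrt_square)
  show "mass_of m k a = 1 \<or> 1 / of_nat k * of_nat (mass_of m k a) = (1 :: complex)"
    using assms by (simp add: mass_of_def)
qed (use assms in \<open>auto simp: particles_def cluster_def\<close>)

context stratum
begin

definition interaction :: "nat \<Rightarrow> nat \<Rightarrow> complex \<Rightarrow> ratfun \<Rightarrow> ratfun" where
  "interaction a b \<tau> f = (partial a f - Cst (\<tau> * (s b / s a)) * partial b f) / (Y a - Cst (\<tau> * (s b / s a)) * Y b)"

lemma interaction_eq:
  assumes "a \<in> {1..M}"
  shows "(d a f - Cst \<tau> * d b f) / (u a - Cst \<tau> * u b) = interaction a b \<tau> f"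
proof -
  have s: "Cst (s a) \<noteq> 0" using s_nonzero[OF assms] by simp
  have "Cst (s a) * Cst (\<tau> * (s b / s a)) = Cst \<tau> * Cst (s b)"
    using s_nonzero[OF assms] by (simp flip: Cst_mult)
  then have "Cst (s a) * (x - Cst (\<tau> * (s b / s a)) * y) = Cst (s a) * x - Cst \<tau> * (Cst (s b) * y)" for x y
    by (simp add: right_diff_distrib flip: mult.assoc)
  then have "(d a f - Cst \<tau> * d b f) / (u a - Cst \<tau> * u b) =
    (Cst (s a) * (partial a f - Cst (\<tau> * (s b / s a)) * partial b f)) / (Cst (s a) * (Y a - Cst (\<tau> * (s b / s a)) * Y b))"
    by (simp add: d_def u_def)
  also have "\<dots> = interaction a b \<tau> f" unfolding interaction_def using s by simp
  finally show ?thesis .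
qed

text \<open>Exchanging a and b multiplies numerator and denominator alike by -\<tau>.\<close>

lemma interaction_commute:
  assumes "a \<in> {1..M}" "b \<in> {1..M}" "\<tau> * \<tau> = 1"
  shows "interaction a b \<tau> f = interaction b a \<tau> f"
proof -
  have \<tau>: "Cst \<tau> * (Cst \<tau> * x) = x" for x using assms(3) by (metis Cst_1 Cst_mult mult.assoc mult_1)
  have "d b f - Cst \<tau> * d a f = - Cst \<tau> * (d a f - Cst \<tau> * d b f)" "u b - Cst \<tau> * u a = - Cst \<tau> * (u a - Cst \<tau> * u b)"
    by (simp_all add: right_diff_distrib \<tau>)
  moreover have "- Cst \<tau> \<noteq> 0" using assms(3) by auto
  ultimately show ?thesis
    unfolding interaction_eq[OF assms(1), symmetric] interaction_eq[OF assms(2), symmetric] by simp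
qed

text \<open>For a \<noteq> b the coefficient \<mu>_a \<Gamma>_ab is c \<mu>_a \<mu>_b, symmetric in
  the pair; the terms with a = b form the separate last sum.\<close>

lemma quantum_integrable_with_oscillator:
  assumes "1 \<le> M" and H: "\<And>f. H f = laplacian M f
    - (\<Sum>a=1..M. \<Sum>b\<in>{1..M} - {a}. \<Sum>\<tau>\<in>S. Cst (c * (of_nat (\<mu> a) * of_nat (\<mu> b))) * interaction a b \<tau> f)
    - (\<Sum>a=1..M. \<Sum>\<tau>\<in>S - {1}. Cst (of_nat (\<mu> a) * (c * (of_nat (\<mu> a) - 1) + q)) * interaction a a \<tau> f)"
  shows "quantum_integrable M (with_oscillator M \<omega> H)"
proof -
  obtain \<kappa> where T: "\<And>f. T 1 f = (\<Sum>a=1..M. partial a (partial a f))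
    - (\<Sum>a=1..M. \<Sum>(b, \<tau>)\<in>R a. Cst (of_nat (\<mu> a) * \<Gamma> a b) * ((d a f - Cst \<tau> * d b f) / (u a - Cst \<tau> * u b)))
    - Cst (\<omega>\<^sup>2) * (\<Sum>a=1..M. (Y a)\<^sup>2) * f - Cst \<kappa> * f"
    using T_1 by blast
  have "(\<Sum>a=1..M. \<Sum>(b, \<tau>)\<in>R a. Cst (of_nat (\<mu> a) * \<Gamma> a b) * ((d a f - Cst \<tau> * d b f) / (u a - Cst \<tau> * u b)))
    = (\<Sum>a=1..M. (\<Sum>b\<in>{1..M} - {a}. \<Sum>\<tau>\<in>S. Cst (c * (of_nat (\<mu> a) * of_nat (\<mu> b))) * interaction a b \<tau> f)
       + (\<Sum>\<tau>\<in>S - {1}. Cst (of_nat (\<mu> a) * (c * (of_nat (\<mu> a) - 1) + q)) * interaction a a \<tau> f))" for f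
  proof (rule sum.cong[OF refl])
    fix a assume a: "a \<in> {1..M}"
    have R: "R a = ({1..M} - {a}) \<times> S \<union> {a} \<times> (S - {1})" using a by (auto simp: R_def)
    have "(\<Sum>(b, \<tau>)\<in>R a. Cst (of_nat (\<mu> a) * \<Gamma> a b) * interaction a b \<tau> f)
      = (\<Sum>(b, \<tau>)\<in>({1..M} - {a}) \<times> S. Cst (of_nat (\<mu> a) * \<Gamma> a b) * interaction a b \<tau> f)
        + (\<Sum>(b, \<tau>)\<in>{a} \<times> (S - {1}). Cst (of_nat (\<mu> a) * \<Gamma> a b) * interaction a b \<tau> f)"
      unfolding R by (rule sum.union_disjoint) (auto simp: finite_S)
    also have "\<dots> = (\<Sum>b\<in>{1..M} - {a}. \<Sum>\<tau>\<in>S. Cst (c * (of_nat (\<mu> a) * of_nat (\<mu> b))) * interaction a b \<tau> f)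
       + (\<Sum>\<tau>\<in>S - {1}. Cst (of_nat (\<mu> a) * (c * (of_nat (\<mu> a) - 1) + q)) * interaction a a \<tau> f)"
      unfolding sum.cartesian_product[symmetric]
      by (intro arg_cong2[where f = "(+)"] sum.cong refl) (auto simp: \<Gamma>_def mult.left_commute)
    finally show "(\<Sum>(b, \<tau>)\<in>R a. Cst (of_nat (\<mu> a) * \<Gamma> a b) * ((d a f - Cst \<tau> * d b f) / (u a - Cst \<tau> * u b)))
      = (\<Sum>b\<in>{1..M} - {a}. \<Sum>\<tau>\<in>S. Cst (c * (of_nat (\<mu> a) * of_nat (\<mu> b))) * interaction a b \<tau> f)
       + (\<Sum>\<tau>\<in>S - {1}. Cst (of_nat (\<mu> a) * (c * (of_nat (\<mu> a) - 1) + q)) * interaction a a \<tau> f)"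
      unfolding interaction_eq[OF a] .
  qed
  then have "with_oscillator M \<omega> H f = T 1 f + Cst \<kappa> * f" for f
    unfolding with_oscillator_def H T laplacian_def sum.distrib by (simp only: algebra_simps)
  then show ?thesis by (rule quantum_integrableI[OF assms(1)])
qed

end

lemma interaction_particles:
  assumes "stratum (particles m n k) S (1 / of_nat k) (m + n) (mass_of m k) (scale_of m k) cluster"
    and "k > 1" "a \<in> {1..m + n}" "b \<in> {1..m + n}" "a \<le> m \<or> m < b"
  shows "stratum.interaction (scale_of m k) a b \<tau> f = (if a \<le> m \<and> m < b
      then (partial a f - Cst \<tau> * sqrt_k k * partial b f) / (Y a - Cst \<tau> * sqrt_k k * Y b)
      else (partial a f - Cst \<tau> * partial b f) / (Y a - Cst \<tau> * Y b))"
proof -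
  \<comment> \<open>The zeros for \<open>q\<close> and \<omega> are placeholders; the pair quotients
    are determined by the scales.\<close>
  interpret stratum "particles m n k" S "1 / of_nat k" 0 0 "m + n" "mass_of m k" "scale_of m k" cluster
    by (rule assms(1))
  have "complex_of_real (sqrt (real k)) \<noteq> 0" using assms(2) by simp
  then have "scale_of m k b / scale_of m k a = (if a \<le> m \<and> m < b then complex_of_real (sqrt (real k)) else 1)"
    using assms(5) by (auto simp: scale_of_def)
  then show ?thesis by (simp add: interaction_def sqrt_k_def Cst_mult)
qed

theorem theorem9:
  fixes m n k :: nat and \<omega> q :: complex
  assumes "m \<ge> 1" and "k > 1"
  shows "quantum_integrable (m + n) (with_oscillator (m + n) \<omega> (H_A m n k)) \<and>
         quantum_integrable (m + n) (with_oscillator (m + n) \<omega> (H_B m n k q))"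
proof
  have k: "(of_nat k :: complex) \<noteq> 0" "(of_nat k :: ratfun) \<noteq> 0"
    using assms(2) of_nat_ratfun_eq_0_iff[of k] by simp_all
  have M: "1 \<le> m + n" using assms(1) by simp
  define w where "w a b = Cst (1 / of_nat k * (of_nat (mass_of m k a) * of_nat (mass_of m k b)))" for a b
  \<comment> \<open>With c = 1/k, the weight c \<mu>_a \<mu>_b is k, 1 or 1/k for a heavy, mixed or
    light pair; in a mixed pair the heavy particle comes first.\<close>
  have coeff: "w a b
    = (if b \<le> m then of_nat k else if a \<le> m then 1 else inverse (of_nat k))" if "a \<le> m \<or> m < b" for a b
  proof -
    have "1 / of_nat k * (of_nat (mass_of m k a) * of_nat (mass_of m k b))
      = (if b \<le> m then of_nat k else if a \<le> m then 1 else inverse (of_nat k) :: complex)"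
      using that k by (auto simp: mass_of_def divide_inverse)
    then show ?thesis unfolding w_def by (simp add: Cst_of_nat Cst_inverse)
  qed
  show "quantum_integrable (m + n) (with_oscillator (m + n) \<omega> (H_A m n k))"
  proof -
    \<comment> \<open>Type A: there are no sign changes, so the sum over \<open>S - {1}\<close> is
      empty and 0 is put for \<open>q\<close>.\<close>
    interpret stratum "particles m n k" "{1}" "1 / of_nat k" 0 \<omega> "m + n" "mass_of m k" "scale_of m k" cluster
      by (rule stratum_particles) (use assms in auto)
    note pair = interaction_particles[OF stratum_axioms assms(2)]
    define \<phi> where "\<phi> f a b = w a b * interaction a b 1 f" for f a b
    show ?thesis
    proof (rule quantum_integrable_with_oscillator[OF M])
      fix f
      have "(\<Sum>a=1..m + n. \<Sum>b\<in>{1..m + n} - {a}. \<phi> f a b) = 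
        2 * (\<Sum>a=1..m. \<Sum>b=a+1..m. \<phi> f a b) + 2 * (\<Sum>a=1..m. \<Sum>b=m+1..m+n. \<phi> f a b)
        + 2 * (\<Sum>a=m+1..m+n. \<Sum>b=a+1..m+n. \<phi> f a b)"
        by (rule sum_off_diagonal_blocks) (simp add: \<phi>_def w_def interaction_commute mult.commute)
      moreover have "(\<Sum>a=1..m. \<Sum>b=a+1..m. \<phi> f a b) = of_nat k * (\<Sum>a=1..m. \<Sum>b=a+1..m. (partial a f - partial b f) / (Y a - Y b))"
        unfolding \<phi>_def sum_distrib_left by (intro sum.cong refl) (auto simp: coeff pair simp del: times_divide_eq_right)
      moreover have "(\<Sum>a=m+1..m+n. \<Sum>b=a+1..m+n. \<phi> f a b) = inverse (of_nat k) * (\<Sum>a=m+1..m+n. \<Sum>b=a+1..m+n. (partial a f - partial b f) / (Y a - Y b))"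
        unfolding \<phi>_def sum_distrib_left by (intro sum.cong refl) (auto simp: coeff pair simp del: times_divide_eq_right)
      moreover have "(\<Sum>a=1..m. \<Sum>b=m+1..m+n. \<phi> f a b) = (\<Sum>a=1..m. \<Sum>b=m+1..m+n. (partial a f - sqrt_k k * partial b f) / (Y a - sqrt_k k * Y b))"
        unfolding \<phi>_def by (intro sum.cong refl) (auto simp: coeff pair)
      moreover have fold: "(\<Sum>\<tau>\<in>{1}. Cst (1 / of_nat k * (of_nat (mass_of m k a) * of_nat (mass_of m k b))) * interaction a b \<tau> f) = \<phi> f a b" for a b
        by (simp add: \<phi>_def w_def)
      ultimately show "H_A m n k f = laplacian (m + n) f - (\<Sum>a=1..m + n. \<Sum>b\<in>{1..m + n} - {a}. \<Sum>\<tau>\<in>{1}. Cst (1 / of_nat k * (of_nat (mass_of m k a) * of_nat (mass_of m k b))) * interaction a b \<tau> f)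
        - (\<Sum>a=1..m + n. \<Sum>\<tau>\<in>{1} - {1}. Cst (of_nat (mass_of m k a) * (1 / of_nat k * (of_nat (mass_of m k a) - 1) + 0)) * interaction a a \<tau> f)"
        unfolding fold by (simp add: H_A_def divide_inverse mult.assoc del: One_nat_def)
    qed
  qed
  show "quantum_integrable (m + n) (with_oscillator (m + n) \<omega> (H_B m n k q))"
  proof -
    interpret stratum "particles m n k" "{1, -1}" "1 / of_nat k" q \<omega> "m + n" "mass_of m k" "scale_of m k" cluster
      by (rule stratum_particles) (use assms in auto)
    note pair = interaction_particles[OF stratum_axioms assms(2)]
    \<comment> \<open>Type B: the two roots of a pair have the same weight and are summed
      together.\<close>
    define \<phi> where "\<phi> f a b = w a b * (interaction a b 1 f + interaction a b (-1) f)" for f a b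
    show ?thesis
    proof (rule quantum_integrable_with_oscillator[OF M])
      fix f
      have "(\<Sum>a=1..m + n. \<Sum>b\<in>{1..m + n} - {a}. \<phi> f a b) = 
        2 * (\<Sum>a=1..m. \<Sum>b=a+1..m. \<phi> f a b) + 2 * (\<Sum>a=1..m. \<Sum>b=m+1..m+n. \<phi> f a b)
        + 2 * (\<Sum>a=m+1..m+n. \<Sum>b=a+1..m+n. \<phi> f a b)"
        by (rule sum_off_diagonal_blocks) (simp add: \<phi>_def w_def interaction_commute mult.commute)
      moreover have "2 * (\<Sum>a=1..m. \<Sum>b=a+1..m. \<phi> f a b) = (\<Sum>a=1..m. \<Sum>b=a+1..m.
         2 * of_nat k * (partial a f - partial b f) / (Y a - Y b) + 2 * of_nat k * (partial a f + partial b f) / (Y a + Y b))"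
        unfolding \<phi>_def sum_distrib_left
        by (intro sum.cong refl) (auto simp: coeff pair Cst_minus distrib_left mult.assoc)
      moreover have "2 * (\<Sum>a=m+1..m+n. \<Sum>b=a+1..m+n. \<phi> f a b) = (\<Sum>a=m+1..m+n. \<Sum>b=a+1..m+n.
         2 * inverse (of_nat k) * (partial a f - partial b f) / (Y a - Y b) + 2 * inverse (of_nat k) * (partial a f + partial b f) / (Y a + Y b))"
        unfolding \<phi>_def sum_distrib_left
        by (intro sum.cong refl) (auto simp: coeff pair Cst_minus distrib_left mult.assoc)
      moreover have "2 * (\<Sum>a=1..m. \<Sum>b=m+1..m+n. \<phi> f a b) = (\<Sum>a=1..m. \<Sum>b=m+1..m+n.
         2 * (partial a f - sqrt_k k * partial b f) / (Y a - sqrt_k k * Y b) + 2 * (partial a f + sqrt_k k * partial b f) / (Y a + sqrt_k k * Y b))"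
        unfolding \<phi>_def sum_distrib_left
        by (intro sum.cong refl) (auto simp: coeff pair Cst_minus distrib_left mult.assoc)
      moreover have "(\<Sum>a=1..m + n. Cst (of_nat (mass_of m k a) * (1 / of_nat k * (of_nat (mass_of m k a) - 1) + q)) * interaction a a (-1) f)
        = (\<Sum>a=1..m. Cst (of_nat k * q + of_nat k - 1) * partial a f / Y a) + (\<Sum>a=m+1..m+n. Cst q * partial a f / Y a)"
      proof -
        have "interaction a a (-1) f = partial a f / Y a" if "a \<in> {1..m + n}" for a
        proof -
          have "interaction a a (-1) f = (2 * partial a f) / (2 * Y a)"
            unfolding interaction_def using s_nonzero[OF that] by (simp add: Cst_minus)
          also have "\<dots> = partial a f / Y a" using of_nat_ratfun_eq_0_iff[of 2] by (simp add: mult_divide_mult_cancel_left)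
          finally show ?thesis .
        qed
        moreover have "of_nat (mass_of m k a) * (1 / of_nat k * (of_nat (mass_of m k a) - 1) + q) = (if a \<le> m then of_nat k * q + of_nat k - 1 else q)" for a
          using k by (simp add: mass_of_def field_simps)
        ultimately have "(\<Sum>a=1..m + n. Cst (of_nat (mass_of m k a) * (1 / of_nat k * (of_nat (mass_of m k a) - 1) + q)) * interaction a a (-1) f)
          = (\<Sum>a=1..m + n. Cst (if a \<le> m then of_nat k * q + of_nat k - 1 else q) * partial a f / Y a)"
          by (intro sum.cong refl) simp
        also have "\<dots> = (\<Sum>a=1..m. Cst (if a \<le> m then of_nat k * q + of_nat k - 1 else q) * partial a f / Y a)
           + (\<Sum>a=m+1..m+n. Cst (if a \<le> m then of_nat k * q + of_nat k - 1 else q) * partial a f / Y a)"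
          by (subst sum.union_disjoint[symmetric]) (auto intro!: sum.cong)
        also have "\<dots> = (\<Sum>a=1..m. Cst (of_nat k * q + of_nat k - 1) * partial a f / Y a) + (\<Sum>a=m+1..m+n. Cst q * partial a f / Y a)"
          by (intro arg_cong2[where f = "(+)"] sum.cong refl) auto
        finally show ?thesis .
      qed
      moreover have "{1, - 1} - {1} = {- 1 :: complex}" by auto
      moreover have fold: "(\<Sum>\<tau>\<in>{1, -1}. Cst (1 / of_nat k * (of_nat (mass_of m k a) * of_nat (mass_of m k b))) * interaction a b \<tau> f) = \<phi> f a b" for a b
        by (simp add: \<phi>_def w_def distrib_left)
      ultimately show "H_B m n k q f = laplacian (m + n) f - (\<Sum>a=1..m + n. \<Sum>b\<in>{1..m + n} - {a}. \<Sum>\<tau>\<in>{1, -1}. Cst (1 / of_nat k * (of_nat (mass_of m k a) * of_nat (mass_of m k b))) * interaction a b \<tau> f)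
        - (\<Sum>a=1..m + n. \<Sum>\<tau>\<in>{1, -1} - {1}. Cst (of_nat (mass_of m k a) * (1 / of_nat k * (of_nat (mass_of m k a) - 1) + q)) * interaction a a \<tau> f)"
        unfolding fold by (simp add: H_B_def del: One_nat_def)
    qed
  qed
qed

end
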